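(* Let $f, y \in C^1_b(\mathbb{R}_+;\mathbb{R})$ and $h\in C^2_b(\mathbb{R}_+;\mathbb{R})$ be bounded with bounded derivatives (up to order 2 for $h$), with $f(0)=0$; write $\dot y=y'$. Let $g(x):=\mathrm{sgn}(x)f(|x|)$, $\tilde V_w^\varepsilon(x,t) := \tfrac12 h(|x|)^2 - \dot y(t)h(|x|) + \varepsilon f'(|x|) - \tfrac{\varepsilon}{2}y(t)h''(|x|)$, and $\tilde H^\varepsilon(x,t,\lambda) := \tfrac12\lambda^2 + \lambda g(x) - \tilde V_w^\varepsilon(x,t)$. Let $\tilde w_0$ be bounded and Lipschitz on $\mathbb{R}$. Assume that $\tilde H^\varepsilon$ is locally Lipschitz continuous, locally uniformly Lipschitz continuous, convex and coercive in its last variable, and let $T>0$ be such that, for the considered $\varepsilon$, the problem $$\partial_t\tilde w^\varepsilon + \tilde H^\varepsilon(x,t,\partial_x\tilde w^\varepsilon) = \tfrac{\varepsilon}{2}\partial_{xx}^2\tilde w^\varepsilon\ \ (x\in\mathbb{R},t>0),\qquad \tilde w^\varepsilon(\cdot,0)=\tilde w_0$$ admits a unique smooth solution $\tilde w^\varepsilon$ on $\mathbb{R}\times[0,T]$. Then for every compact $Q\subset\mathbb{R}\times[0,T]$ there exist $\varepsilon_0>0$ and $K>0$ such that for all $0<\varepsilon<\min(\varepsilon_0,1)$ and all $(x,t),(x,s)\in Q$: (i) $|\tilde w^\varepsilon(x,t)|\le K$; (ii) $|\partial_x\tilde w^\varepsilon(x,t)|\le K$; (iii) $|\tilde w^\varepsilon(x,t)-\tilde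 w^\varepsilon(x,s)|\le K(|t-s|^{1/2}+|t-s|)$. Moreover, (iv): for all $R\ge 8$, setting $\varepsilon_R := \frac{1}{32R^4}$, for all $0<\varepsilon<\varepsilon_R$, $$\|\tilde w^\varepsilon\|_{L^\infty(Q_R)} \le \|\tilde w_0\|_{L^\infty(\mathbb{R})} + \Big[8\big(1+\|g\|_{L^\infty(\mathbb{R})}\big) + \|\tilde V_w^\varepsilon\|_{L^\infty(\mathbb{R}\times[0,T])} + 1\Big]T + 1,$$ where $Q_R := [-R,R]\times[0,T]$. *)

theory Defs
  imports "HOL-Analysis.Analysis"
begin

definition C1b_nonneg :: "(real \<Rightarrow> real) \<Rightarrow> (real \<Rightarrow> real) \<Rightarrow> bool" where
  "C1b_nonneg f f' \<longleftrightarrow>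
     (\<forall>x\<ge>0. (f has_real_derivative f' x) (at x within {0..})) \<and>
     continuous_on {0..} f' \<and> bounded (f ` {0..}) \<and> bounded (f' ` {0..})"

definition C2b_nonneg :: "(real \<Rightarrow> real) \<Rightarrow> (real \<Rightarrow> real) \<Rightarrow> (real \<Rightarrow> real) \<Rightarrow> bool" where
  "C2b_nonneg h h1 h2 \<longleftrightarrow>
     (\<forall>x\<ge>0. (h has_real_derivative h1 x) (at x within {0..})) \<and>
     (\<forall>x\<ge>0. (h1 has_real_derivative h2 x) (at x within {0..})) \<and>
     continuous_on {0..} h2 \<and> bounded (h ` {0..}) \<and> bounded (h1 ` {0..}) \<and>
     bounded (h2 ` {0..})"

definition gfun :: "(real \<Rightarrow> real) \<Rightarrow> real \<Rightarrow> real" where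
  "gfun f x = sgn x * f \<bar>x\<bar>"

text \<open>\<tilde>V_w^\<epsilon>(x,t); fd = f', y, yd = y', h, h2 = h''.\<close>
definition Vw :: "(real \<Rightarrow> real) \<Rightarrow> (real \<Rightarrow> real) \<Rightarrow> (real \<Rightarrow> real) \<Rightarrow> (real \<Rightarrow> real)
    \<Rightarrow> (real \<Rightarrow> real) \<Rightarrow> real \<Rightarrow> real \<Rightarrow> real \<Rightarrow> real" where
  "Vw fd y yd h h2 eps x t =
     (1/2) * (h \<bar>x\<bar>)^2 - yd t * h \<bar>x\<bar> + eps * fd \<bar>x\<bar> - (eps/2) * y t * h2 \<bar>x\<bar>"

definition Hfun :: "(real \<Rightarrow> real) \<Rightarrow> (real \<Rightarrow> real) \<Rightarrow> (real \<Rightarrow> real) \<Rightarrow> (real \<Rightarrow> real)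
    \<Rightarrow> (real \<Rightarrow> real) \<Rightarrow> (real \<Rightarrow> real) \<Rightarrow> real \<Rightarrow> real \<Rightarrow> real \<Rightarrow> real \<Rightarrow> real" where
  "Hfun f fd y yd h h2 eps x t l = (1/2) * l^2 + l * gfun f x - Vw fd y yd h h2 eps x t"

definition H_loc_lipschitz :: "real \<Rightarrow> (real \<Rightarrow> real \<Rightarrow> real \<Rightarrow> real) \<Rightarrow> bool" where
  "H_loc_lipschitz T H \<longleftrightarrow> (\<forall>R>0. \<exists>L. \<forall>x1 x2 t1 t2 p1 p2.
      \<bar>x1\<bar> \<le> R \<and> \<bar>x2\<bar> \<le> R \<and> t1 \<in> {0..T} \<and> t2 \<in> {0..T} \<and> \<bar>p1\<bar> \<le> R \<and> \<bar>p2\<bar> \<le> R \<longrightarrow>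
      \<bar>H x1 t1 p1 - H x2 t2 p2\<bar> \<le> L * (\<bar>x1 - x2\<bar> + \<bar>t1 - t2\<bar> + \<bar>p1 - p2\<bar>))"

definition H_loc_unif_lipschitz_p :: "real \<Rightarrow> (real \<Rightarrow> real \<Rightarrow> real \<Rightarrow> real) \<Rightarrow> bool" where
  "H_loc_unif_lipschitz_p T H \<longleftrightarrow> (\<forall>R>0. \<exists>L. \<forall>x t p1 p2.
      t \<in> {0..T} \<and> \<bar>p1\<bar> \<le> R \<and> \<bar>p2\<bar> \<le> R \<longrightarrow> \<bar>H x t p1 - H x t p2\<bar> \<le> L * \<bar>p1 - p2\<bar>)"

definition H_convex_p :: "real \<Rightarrow> (real \<Rightarrow> real \<Rightarrow> real \<Rightarrow> real) \<Rightarrow> bool" where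
  "H_convex_p T H \<longleftrightarrow> (\<forall>x. \<forall>t\<in>{0..T}. convex_on UNIV (H x t))"

definition H_coercive_p :: "real \<Rightarrow> (real \<Rightarrow> real \<Rightarrow> real \<Rightarrow> real) \<Rightarrow> bool" where
  "H_coercive_p T H \<longleftrightarrow> (\<forall>M. \<exists>R. \<forall>x. \<forall>t\<in>{0..T}. \<forall>p. \<bar>p\<bar> \<ge> R \<longrightarrow> H x t p \<ge> M)"

definition smooth_solution :: "real \<Rightarrow> real \<Rightarrow> (real \<Rightarrow> real \<Rightarrow> real \<Rightarrow> real)
    \<Rightarrow> (real \<Rightarrow> real) \<Rightarrow> (real \<Rightarrow> real \<Rightarrow> real) \<Rightarrow> bool" where
  "smooth_solution eps T H w0 w \<longleftrightarrow> (\<exists>wx wxx wt.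
     (\<forall>x. \<forall>t\<in>{0..T}. ((\<lambda>\<xi>. w \<xi> t) has_real_derivative wx x t) (at x)) \<and>
     (\<forall>x. \<forall>t\<in>{0..T}. ((\<lambda>\<xi>. wx \<xi> t) has_real_derivative wxx x t) (at x)) \<and>
     (\<forall>x. \<forall>t\<in>{0..T}. ((\<lambda>\<tau>. w x \<tau>) has_real_derivative wt x t) (at t within {0..T})) \<and>
     continuous_on (UNIV \<times> {0..T}) (\<lambda>(x,t). w x t) \<and>
     continuous_on (UNIV \<times> {0..T}) (\<lambda>(x,t). wx x t) \<and>
     continuous_on (UNIV \<times> {0..T}) (\<lambda>(x,t). wxx x t) \<and>
     continuous_on (UNIV \<times> {0..T}) (\<lambda>(x,t). wt x t) \<and>
     (\<forall>x. \<forall>t\<in>{0<..T}. wt x t + H x t (wx x t) = (eps/2) * wxx x t) \<and>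
     (\<forall>x. w x 0 = w0 x))"

end

theory Submission
  imports Defs
begin

text \<open>The solution is not assumed bounded, so the first step is to exclude growth at infinity. The
function \<open>v = exp (- w / \<epsilon>)\<close> is a positive solution of the linear equation
\<open>v\<^sub>t = (\<epsilon>/2) v\<^sub>x\<^sub>x - g v\<^sub>x - (V/\<epsilon>) v\<close>, and as in Widder's theorem positivity alone controls growth: testing
with a compactly supported bump that travels from \<open>x\<close> at time \<open>s\<close> to \<open>0\<close> at time \<open>T\<close> bounds the mass of
\<open>v\<close> near \<open>x\<close> by \<open>exp (C x\<^sup>2 / (T - s))\<close> times its mass near \<open>0\<close> at time \<open>T\<close>. A convex function of
\<open>v - K\<close> is then a subsolution of Gaussian growth with zero initial value, hence zero on short time
steps and so everywhere. This gives the lower bound on \<open>w\<close>; the upper bound is the minimum principle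
for \<open>v \<ge> 0\<close>. Both are independent of \<open>\<epsilon>\<close>.

For the gradient, \<open>u = exp (- w / 2)\<close> satisfies an equation whose Bernstein estimate has the good term
\<open>- u\<^sub>x\<^sup>3 / u\<^sup>2\<close>, uniformly in \<open>\<epsilon>\<close>, which absorbs the cutoff. Since \<open>w\<close> is only \<open>C\<^sup>2\<close> in space, the
maximum principle is applied to a difference quotient of \<open>u\<close>. The modulus in time follows by
integrating the equation over \<open>[x, x + sqrt (t - s)]\<close>.\<close>

section \<open>Functions of class $C^{2,1}$\<close>

text \<open>Even for the heat equation the initial value does not determine a solution of
  unrestricted growth (Tychonoff), so no maximum principle applies directly; the sign of
  \<open>v\<close> has to replace the missing growth condition. It does so asymmetrically. From
  below, \<open>v \<ge> 0\<close> dominates any quadratic barrier at infinity, and an elementary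
  minimum principle suffices. From above, growth has to be excluded first, which is what the mass
  estimate is for. The exponent \<open>1/\<epsilon>\<close> makes the equation linear but is useless
  for gradients: \<open>1/v\<close> is only bounded by \<open>exp (K/\<epsilon>)\<close>. The fixed
  exponent \<open>1/2\<close> keeps \<open>u\<close> between positive constants, at the price of the
  nonlinear term \<open>\<kappa> u_x^2 / u\<close> with
  \<open>\<kappa> = 1 - \<epsilon>/2 \<ge> 1/2\<close>. That term is the gain: its derivative
  contains the damping \<open>- \<kappa> u_x^3 / u^2\<close>, whereas differentiating the quadratic
  term in the equation for \<open>w\<close> only gives transport.\<close>

definition C21 :: "real \<Rightarrow> (real \<Rightarrow> real \<Rightarrow> real) \<Rightarrow> (real \<Rightarrow> real \<Rightarrow> real) \<Rightarrow>
    (real \<Rightarrow> real \<Rightarrow> real) \<Rightarrow> (real \<Rightarrow> real \<Rightarrow> real) \<Rightarrow> bool" where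
  "C21 T u ux uxx ut \<longleftrightarrow>
     (\<forall>x. \<forall>t\<in>{0..T}. ((\<lambda>\<xi>. u \<xi> t) has_real_derivative ux x t) (at x)) \<and>
     (\<forall>x. \<forall>t\<in>{0..T}. ((\<lambda>\<xi>. ux \<xi> t) has_real_derivative uxx x t) (at x)) \<and>
     (\<forall>x. \<forall>t\<in>{0..T}. ((\<lambda>\<tau>. u x \<tau>) has_real_derivative ut x t) (at t within {0..T})) \<and>
     continuous_on (UNIV \<times> {0..T}) (\<lambda>p. u (fst p) (snd p)) \<and>
     continuous_on (UNIV \<times> {0..T}) (\<lambda>p. ux (fst p) (snd p)) \<and>
     continuous_on (UNIV \<times> {0..T}) (\<lambda>p. uxx (fst p) (snd p)) \<and>
     continuous_on (UNIV \<times> {0..T}) (\<lambda>p. ut (fst p) (snd p))"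

lemma C21D:
  assumes "C21 T u ux uxx ut"
  shows "t \<in> {0..T} \<Longrightarrow> ((\<lambda>\<xi>. u \<xi> t) has_real_derivative ux x t) (at x)"
    and "t \<in> {0..T} \<Longrightarrow> ((\<lambda>\<xi>. ux \<xi> t) has_real_derivative uxx x t) (at x)"
    and "t \<in> {0..T} \<Longrightarrow> ((\<lambda>\<tau>. u x \<tau>) has_real_derivative ut x t) (at t within {0..T})"
    and "continuous_on (UNIV \<times> {0..T}) (\<lambda>p. u (fst p) (snd p))"
    and "continuous_on (UNIV \<times> {0..T}) (\<lambda>p. ux (fst p) (snd p))"
    and "continuous_on (UNIV \<times> {0..T}) (\<lambda>p. uxx (fst p) (snd p))"
    and "continuous_on (UNIV \<times> {0..T}) (\<lambda>p. ut (fst p) (snd p))"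
  using assms unfolding C21_def by auto

lemma continuous_on_slice:
  assumes "continuous_on (UNIV \<times> {0..T}) (\<lambda>p. u (fst p) (snd p))" "t \<in> {0..T}"
  shows "continuous_on S (\<lambda>x. (u::real\<Rightarrow>real\<Rightarrow>real) x t)"
proof -
  have "continuous_on S (\<lambda>x. (x, t))" by (intro continuous_intros)
  moreover have "(\<lambda>x. (x, t)) ` S \<subseteq> UNIV \<times> {0..T}" using assms(2) by auto
  ultimately have "continuous_on S (\<lambda>x. u (fst (x, t)) (snd (x, t)))"
    by (rule continuous_on_compose2[OF assms(1)])
  then show ?thesis by simp
qed

lemma continuous_on_compose_fun:
  assumes "\<And>s. (F has_real_derivative F1 s) (at s)" "continuous_on S u"
  shows "continuous_on S (\<lambda>p. F (u p))"
proof -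
  have "continuous_on UNIV F" using assms(1) by (meson DERIV_isCont continuous_at_imp_continuous_on)
  from continuous_on_compose2[OF this assms(2)] show ?thesis by simp
qed

lemma C21_compose:
  assumes F: "\<And>s. (F has_real_derivative F1 s) (at s)" "\<And>s. (F1 has_real_derivative F2 s) (at s)"
    and F2: "continuous_on UNIV F2" and u: "C21 T u ux uxx ut"
  shows "C21 T (\<lambda>x t. F (u x t)) (\<lambda>x t. F1 (u x t) * ux x t)
     (\<lambda>x t. F2 (u x t) * (ux x t)\<^sup>2 + F1 (u x t) * uxx x t) (\<lambda>x t. F1 (u x t) * ut x t)"
proof -
  note d = C21D[OF u]
  have c: "continuous_on (UNIV \<times> {0..T}) (\<lambda>p. F (u (fst p) (snd p)))"
    "continuous_on (UNIV \<times> {0..T}) (\<lambda>p. F1 (u (fst p) (snd p)))"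
    using continuous_on_compose_fun[OF F(1) d(4)] continuous_on_compose_fun[OF F(2) d(4)] by auto
  have c2: "continuous_on (UNIV \<times> {0..T}) (\<lambda>p. F2 (u (fst p) (snd p)))"
    using continuous_on_compose2[OF F2 d(4)] by simp
  have 1: "((\<lambda>\<xi>. F (u \<xi> t)) has_real_derivative F1 (u x t) * ux x t) (at x)" if "t \<in> {0..T}" for x t
    using DERIV_chain2[OF F(1) d(1)[OF that]] by simp
  have 2: "((\<lambda>\<xi>. F1 (u \<xi> t)) has_real_derivative F2 (u x t) * ux x t) (at x)" if "t \<in> {0..T}" for x t
    using DERIV_chain2[OF F(2) d(1)[OF that]] by simp
  have 3: "((\<lambda>\<xi>. F (u x \<xi>)) has_real_derivative F1 (u x t) * ut x t) (at t within {0..T})" 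
    if "t \<in> {0..T}" for x t
    using DERIV_chain2[OF F(1) d(3)[OF that]] by simp
  show ?thesis unfolding C21_def
    using 1 3 by (auto intro!: continuous_intros c c2 d(4-7) derivative_eq_intros 2 d(2) simp: power2_eq_square)
qed

lemma C21_add:
  assumes u: "C21 T u ux uxx ut" and v: "C21 T v vx vxx vt"
  shows "C21 T (\<lambda>x t. u x t + v x t) (\<lambda>x t. ux x t + vx x t) (\<lambda>x t. uxx x t + vxx x t)
    (\<lambda>x t. ut x t + vt x t)"
  unfolding C21_def
  by (auto intro!: continuous_intros C21D(4-7)[OF u] C21D(4-7)[OF v] derivative_eq_intros
      C21D(1-3)[OF u] C21D(1-3)[OF v])

lemma C21_mult:
  assumes u: "C21 T u ux uxx ut" and v: "C21 T v vx vxx vt"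
  shows "C21 T (\<lambda>x t. u x t * v x t) (\<lambda>x t. ux x t * v x t + u x t * vx x t)
    (\<lambda>x t. uxx x t * v x t + 2 * ux x t * vx x t + u x t * vxx x t)
    (\<lambda>x t. ut x t * v x t + u x t * vt x t)"
  unfolding C21_def
  by (auto intro!: continuous_intros C21D(4-7)[OF u] C21D(4-7)[OF v] derivative_eq_intros
      C21D(1-3)[OF u] C21D(1-3)[OF v])

lemma C21_shift:
  assumes u: "C21 T u ux uxx ut"
  shows "C21 T (\<lambda>x t. u (x + a) t) (\<lambda>x t. ux (x + a) t) (\<lambda>x t. uxx (x + a) t) (\<lambda>x t. ut (x + a) t)"
proof -
  have c: "continuous_on (UNIV \<times> {0..T}) (\<lambda>p. f (fst p + a) (snd p))"
    if "continuous_on (UNIV \<times> {0..T}) (\<lambda>p. f (fst p) (snd p))" for f :: "real \<Rightarrow> real \<Rightarrow> real"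
  proof -
    have "continuous_on (UNIV \<times> {0..T}) (\<lambda>p. (fst p + a, snd p))" by (intro continuous_intros)
    moreover have "(\<lambda>p. (fst p + a, snd p)) ` (UNIV \<times> {0..T}) \<subseteq> UNIV \<times> {0..T}" by auto
    ultimately have "continuous_on (UNIV \<times> {0..T}) (\<lambda>p. f (fst (fst p + a, snd p)) (snd (fst p + a, snd p)))"
      by (rule continuous_on_compose2[OF that])
    then show ?thesis by simp
  qed
  show ?thesis unfolding C21_def
    by (auto intro!: c C21D(3-7)[OF u] C21D(1,2)[OF u, THEN DERIV_shift[THEN iffD1]])
qed

lemma C21_space:
  assumes "\<And>s. (F has_real_derivative F1 s) (at s)" "\<And>s. (F1 has_real_derivative F2 s) (at s)"
    and F2: "continuous_on UNIV F2"
  shows "C21 T (\<lambda>x t. F x) (\<lambda>x t. F1 x) (\<lambda>x t. F2 x) (\<lambda>x t. 0)"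
proof -
  have "C21 T (\<lambda>x t. x) (\<lambda>x t. 1) (\<lambda>x t. 0) (\<lambda>x t. 0)"
    unfolding C21_def by (auto intro!: continuous_intros derivative_eq_intros)
  from C21_compose[OF assms this] show ?thesis by simp
qed

lemma C21_time:
  assumes "\<And>s. (a has_real_derivative b s) (at s)" "continuous_on UNIV b"
  shows "C21 T (\<lambda>x t. a t) (\<lambda>x t. 0) (\<lambda>x t. 0) (\<lambda>x t. b t)"
proof -
  have 1: "continuous_on UNIV a"
    using assms(1) by (meson DERIV_isCont continuous_at_imp_continuous_on)
  have c: "continuous_on (UNIV \<times> {0..T}) (\<lambda>p::real\<times>real. f (snd p))"
    if "continuous_on UNIV f" for f :: "real \<Rightarrow> real"
  proof -
    have "continuous_on (UNIV \<times> {0..T}) (snd :: real \<times> real \<Rightarrow> real)" by (intro continuous_intros)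
    from continuous_on_compose2[OF that this] show ?thesis by auto
  qed
  show ?thesis unfolding C21_def
    by (auto intro!: c 1 assms has_field_derivative_at_within)
qed

text \<open>The cube is the lowest integer power of the positive part that is \<open>C^2\<close>,
  the regularity that \<open>C21_compose\<close> asks of the outer function.\<close>

definition pos3 :: "real \<Rightarrow> real" where "pos3 s = (max 0 s)^3"

text \<open>The exponent is written so as to be at least 2: at 0 the difference quotient is then at
  most \<open>\<bar>h\<bar>^(Suc n)\<close>, which tends to 0.\<close>

lemma has_derivative_max_power:
  "((\<lambda>s::real. (max 0 s)^(Suc (Suc n))) has_real_derivative real (Suc (Suc n)) * (max 0 s)^(Suc n)) (at s)"
proof -
  consider "s < 0" | "s > 0" | "s = 0" by linarith
  then show ?thesis
  proof cases
    case 1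
    have "((\<lambda>s::real. 0) has_real_derivative 0) (at s)" by simp
    then have "((\<lambda>s::real. (max 0 s)^(Suc (Suc n))) has_real_derivative 0) (at s)"
      by (rule has_field_derivative_transform_within_open[where S="{..<0}"]) (use 1 in auto)
    then show ?thesis using 1 by simp
  next
    case 2
    have "((\<lambda>s::real. s^(Suc (Suc n))) has_real_derivative real (Suc (Suc n)) * s^(Suc n)) (at s)"
      by (rule derivative_eq_intros | simp)+
    then have "((\<lambda>s::real. (max 0 s)^(Suc (Suc n))) has_real_derivative real (Suc (Suc n)) * s^(Suc n)) (at s)"
      by (rule has_field_derivative_transform_within_open[where S="{0<..}"]) (use 2 in auto)
    then show ?thesis using 2 by simp
  next
    case 3
    have "((\<lambda>h::real. (max 0 h)^(Suc (Suc n)) / h) \<longlongrightarrow> 0) (at 0)"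
    proof (rule Lim_null_comparison)
      show "\<forall>\<^sub>F h in at 0. norm ((max 0 h)^(Suc (Suc n)) / h) \<le> \<bar>h\<bar>^(Suc n)"
      proof (rule eventuallyI)
        fix h :: real
        show "norm ((max 0 h)^(Suc (Suc n)) / h) \<le> \<bar>h\<bar>^(Suc n)"
        proof (cases "h > 0")
          case False
          then have "max 0 h = 0" by simp
          then show ?thesis using zero_le_power_abs[of h "Suc n"] by (simp del: power_Suc)
        qed (simp add: abs_mult max_def)
      qed
      show "((\<lambda>h::real. \<bar>h\<bar>^(Suc n)) \<longlongrightarrow> 0) (at 0)"
        by (auto intro!: tendsto_eq_intros)
    qed
    then show ?thesis using 3 by (simp add: DERIV_def)
  qed
qed

lemma pos3_deriv: "(pos3 has_real_derivative 3 * (max 0 s)^2) (at s)"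
  using has_derivative_max_power[of 1 s] unfolding pos3_def[abs_def] by (simp add: numeral_eq_Suc)

lemma pos3_deriv2: "((\<lambda>s. 3 * (max 0 s)^2) has_real_derivative 6 * max 0 s) (at s)"
  using DERIV_cmult[OF has_derivative_max_power[of 0 s], of 3] by (simp add: numeral_eq_Suc)

text \<open>Only the value of the second derivative at \<open>x0\<close> is given, so Taylor's
  formula is replaced by the mean value theorem: if \<open>c < 0\<close>, then \<open>f'\<close> is
  negative just to the right of \<open>x0\<close> and \<open>f\<close> drops below its
  minimum.\<close>

lemma second_derivative_nonneg_at_min:
  fixes f f' :: "real \<Rightarrow> real"
  assumes d: "\<And>x. (f has_real_derivative f' x) (at x)" and d2: "(f' has_real_derivative c) (at x0)"
    and "r > 0" and mn: "\<And>x. \<bar>x - x0\<bar> < r \<Longrightarrow> f x0 \<le> f x"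
  shows "f' x0 = 0" "c \<ge> 0"
proof -
  show 0: "f' x0 = 0"
    using DERIV_local_min[OF d, of r] assms(3) mn by (auto simp: abs_minus_commute)
  show "c \<ge> 0"
  proof (rule ccontr)
    assume "\<not> c \<ge> 0"
    then obtain \<delta> where \<delta>: "\<delta> > 0" "\<And>h. 0 < h \<Longrightarrow> h < \<delta> \<Longrightarrow> f' (x0 + h) < f' x0"
      using DERIV_neg_dec_right[OF d2] by (auto simp: not_le)
    define h where "h = min (\<delta>/2) (r/2)"
    have h: "h > 0" "h < \<delta>" "h < r" using \<delta>(1) assms(3) unfolding h_def by auto
    obtain z where z: "x0 < z" "z < x0 + h" "f (x0 + h) - f x0 = (x0 + h - x0) * f' z"
      using MVT2[of x0 "x0+h" f f'] h d by auto
    have "f' z < 0" using \<delta>(2)[of "z - x0"] z h 0 by auto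
    then have "f (x0 + h) < f x0" using z(3) h by (smt (verit) mult_pos_neg)
    then show False using mn[of "x0 + h"] h by auto
  qed
qed

text \<open>A minimum over a space-time box may sit at the final time, where only the one-sided
  derivative exists and only earlier times can be compared.\<close>

lemma left_derivative_nonpos_at_min:
  fixes f :: "real \<Rightarrow> real"
  assumes d: "(f has_real_derivative c) (at t within {0..T})" and "t \<in> {0<..T}"
    and mn: "\<And>s. s \<in> {0..T} \<Longrightarrow> f t \<le> f s"
  shows "c \<le> 0"
proof (rule ccontr)
  assume "\<not> c \<le> 0"
  then obtain \<delta> where \<delta>: "\<delta> > 0" "\<And>h. 0 < h \<Longrightarrow> t - h \<in> {0..T} \<Longrightarrow> h < \<delta> \<Longrightarrow> f (t - h) < f t"
    using has_real_derivative_pos_inc_left[OF d] by (auto simp: not_le)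
  define h where "h = min (\<delta>/2) (t/2)"
  have h: "h > 0" "h < \<delta>" "h < t" using \<delta>(1) assms(2) unfolding h_def by auto
  have "f (t - h) < f t" using \<delta>(2)[of h] h assms(2) by auto
  then show False using mn[of "t - h"] h assms(2) by auto
qed

section \<open>Mass bounds for positive supersolutions\<close>

lemma C21_slice_continuous:
  assumes "C21 T u ux uxx ut" "t \<in> {0..T}"
  shows "continuous_on S (\<lambda>x. u x t)" "continuous_on S (\<lambda>x. ux x t)"
    "continuous_on S (\<lambda>x. uxx x t)" "continuous_on S (\<lambda>x. ut x t)"
  using C21D(4-7)[OF assms(1)] assms(2) by (auto intro: continuous_on_slice[where u=u]
    continuous_on_slice[where u=ux] continuous_on_slice[where u=uxx] continuous_on_slice[where u=ut])

text \<open>Time comes first here because the Leibniz rule takes the parameter before the variable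
  of integration.\<close>

lemma continuous_on_swap_slice:
  assumes "continuous_on (UNIV \<times> {0..T}) (\<lambda>p. u (fst p) (snd p))"
  shows "continuous_on ({0..T} \<times> S) (\<lambda>p. (u::real\<Rightarrow>real\<Rightarrow>real) (snd p) (fst p))"
proof -
  have "continuous_on ({0..T} \<times> S) (\<lambda>p. (snd p, fst p))" by (intro continuous_intros)
  moreover have "(\<lambda>p. (snd p, fst p)) ` ({0..T} \<times> S) \<subseteq> UNIV \<times> {0..T}" by auto
  ultimately have "continuous_on ({0..T} \<times> S) (\<lambda>p. u (fst (snd p, fst p)) (snd (snd p, fst p)))"
    by (rule continuous_on_compose2[OF assms])
  then show ?thesis by simp
qed

lemma integral_derivative:
  assumes u: "C21 T u ux uxx ut" and s: "s \<in> {0..T}"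
  shows "((\<lambda>\<tau>. integral {l..r} (\<lambda>x. u x \<tau>)) has_real_derivative integral {l..r} (\<lambda>x. ut x s))
    (at s within {0..T})"
proof -
  have "((\<lambda>\<tau>. integral (cbox l r) (\<lambda>x. u x \<tau>)) has_real_derivative
      integral (cbox l r) (\<lambda>x. ut x s)) (at s within {0..T})"
  proof (rule leibniz_rule_field_derivative)
    show "continuous_on ({0..T} \<times> cbox l r) (\<lambda>(x, t). ut t x)"
      using continuous_on_swap_slice[OF C21D(7)[OF u]] by (simp add: case_prod_unfold)
    show "\<And>x. x \<in> {0..T} \<Longrightarrow> (\<lambda>xa. u xa x) integrable_on cbox l r"
      by (rule integrable_continuous) (rule C21_slice_continuous(1)[OF u])
  qed (use s C21D(3)[OF u] in auto)
  then show ?thesis by simp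
qed

text \<open>Integration by parts moves the operator
  \<open>\<partial>_t - e \<partial>_xx + g \<partial>_x\<close> from \<open>q\<close> to its
  adjoint acting on \<open>p\<close>. The sign of the derivative can then be read off from a
  differential inequality for \<open>q\<close> and one for \<open>p\<close>.\<close>

lemma weighted_mass_derivative:
  assumes q: "C21 T q qx qxx qt" and p: "C21 T p px pxx pt"
    and g: "\<And>x. (g has_real_derivative g' x) (at x)" and g': "continuous_on UNIV g'"
    and s: "s \<in> {0..T}" and lr: "l \<le> r"
    and bd: "p l s = 0" "p r s = 0" "px l s = 0" "px r s = 0"
  shows "((\<lambda>\<tau>. integral {l..r} (\<lambda>x. q x \<tau> * p x \<tau>)) has_real_derivative
     integral {l..r} (\<lambda>x. (qt x s - e * qxx x s + g x * qx x s) * p x s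
        + q x s * (pt x s + e * pxx x s + g x * px x s + g' x * p x s)))
    (at s within {0..T})"
proof -
  have cg: "continuous_on S g" for S
    using g by (meson DERIV_isCont continuous_at_imp_continuous_on)
  have cg': "continuous_on S g'" for S using g' continuous_on_subset by blast
  note cs = C21_slice_continuous[OF q s] C21_slice_continuous[OF p s]
  \<comment> \<open>\<open>P\<close> collects all boundary terms, so \<open>P'\<close> has integral
    0 and may be added freely.\<close>
  define P where "P x = e * (qx x s * p x s - q x s * px x s) - g x * q x s * p x s" for x
  define P' where "P' x = e * (qxx x s * p x s - q x s * pxx x s)
      - (g' x * q x s * p x s + g x * qx x s * p x s + g x * q x s * px x s)" for x
  have "(P' has_integral (P r - P l)) {l..r}"
  proof (rule fundamental_theorem_of_calculus[OF lr])
    fix x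
    have "(P has_real_derivative P' x) (at x)"
      unfolding P_def P'_def
      by (auto intro!: derivative_eq_intros C21D(1,2)[OF q s] C21D(1,2)[OF p s] g simp: algebra_simps)
    then show "(P has_vector_derivative P' x) (at x within {l..r})"
      by (simp add: has_real_derivative_iff_has_vector_derivative has_vector_derivative_at_within)
  qed
  then have P0: "(P' has_integral 0) {l..r}" using bd by (simp add: P_def)
  have "((\<lambda>x. (qt x s - e * qxx x s + g x * qx x s) * p x s
        + q x s * (pt x s + e * pxx x s + g x * px x s + g' x * p x s)) has_integral
       integral {l..r} (\<lambda>x. (qt x s - e * qxx x s + g x * qx x s) * p x s
        + q x s * (pt x s + e * pxx x s + g x * px x s + g' x * p x s))) {l..r}"
    by (intro integrable_integral integrable_continuous_real continuous_intros cs cg cg')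
  from has_integral_add[OF this P0]
  have "((\<lambda>x. qt x s * p x s + q x s * pt x s) has_integral
       integral {l..r} (\<lambda>x. (qt x s - e * qxx x s + g x * qx x s) * p x s
        + q x s * (pt x s + e * pxx x s + g x * px x s + g' x * p x s))) {l..r}"
    by (simp add: P'_def algebra_simps)
  then show ?thesis
    using integral_derivative[OF C21_mult[OF q p] s, of l r] by (simp add: integral_unique)
qed

section \<open>A compactly supported bump and the mass it controls\<close>

definition bump :: "real \<Rightarrow> real" where "bump y = pos3 (1 - y\<^sup>2)"
definition bump1 :: "real \<Rightarrow> real" where "bump1 y = 3 * (max 0 (1 - y\<^sup>2))^2 * (- 2 * y)"
definition bump2 :: "real \<Rightarrow> real" where
  "bump2 y = 6 * max 0 (1 - y\<^sup>2) * (4 * y\<^sup>2) - 6 * (max 0 (1 - y\<^sup>2))^2"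

lemma bump_deriv: "(bump has_real_derivative bump1 y) (at y)"
proof -
  have "((\<lambda>y::real. 1 - y\<^sup>2) has_real_derivative (- 2 * y)) (at y)"
    by (auto intro!: derivative_eq_intros)
  from DERIV_chain2[OF pos3_deriv this] show ?thesis
    by (simp add: bump_def[abs_def] bump1_def)
qed

lemma bump1_deriv: "(bump1 has_real_derivative bump2 y) (at y)"
proof -
  have 1: "((\<lambda>y::real. 1 - y\<^sup>2) has_real_derivative (- 2 * y)) (at y)"
    by (auto intro!: derivative_eq_intros)
  have 2: "((\<lambda>y::real. - 2 * y) has_real_derivative -2) (at y)"
    by (auto intro!: derivative_eq_intros)
  from DERIV_mult[OF DERIV_chain2[OF pos3_deriv2 1] 2] show ?thesis
    by (simp add: bump1_def[abs_def] bump2_def power2_eq_square algebra_simps)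
qed

lemma bump2_continuous: "continuous_on UNIV bump2"
  unfolding bump2_def[abs_def] by (intro continuous_intros)

lemma bump_nonneg: "bump y \<ge> 0"
  by (simp add: bump_def pos3_def)

lemma bump_outside: "\<bar>y\<bar> \<ge> 1 \<Longrightarrow> bump y = 0 \<and> bump1 y = 0"
  using abs_square_le_1[of y] one_le_power[of "\<bar>y\<bar>" 2] by (simp add: bump_def bump1_def pos3_def)

lemma bump_lower: "\<bar>y\<bar> \<le> 1/2 \<Longrightarrow> bump y \<ge> 27/64"
proof -
  assume "\<bar>y\<bar> \<le> 1/2"
  then have "y\<^sup>2 \<le> (1/2)\<^sup>2" by (metis abs_le_square_iff abs_of_nonneg zero_le_divide_1_iff zero_le_numeral)
  then have "3/4 \<le> max 0 (1 - y\<^sup>2)" by (simp add: power2_eq_square)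
  from power_mono[OF this, of 3] show ?thesis by (simp add: bump_def pos3_def power3_eq_cube)
qed

text \<open>With \<open>m = 1 - y^2\<close> the expression is \<open>m\<close> times
  \<open>L m^2 - 6 c y m + 24 e y^2 - 6 e m\<close>. Completing the square for the drift uses
  \<open>18 e y^2\<close> and \<open>c^2/(2 e) m^2\<close>; the remaining \<open>6 e y^2\<close>
  together with \<open>12 e m^2\<close> covers \<open>- 6 e m\<close>. The threshold is quadratic in
  the drift bound \<open>B\<close>, and this is the origin of the Gaussian growth below.\<close>

lemma bump_subsolution:
  assumes e: "e > 0" and L: "L \<ge> 12 * e + B\<^sup>2 / (2 * e)" and c: "\<bar>c\<bar> \<le> B"
  shows "L * bump y + c * bump1 y + e * bump2 y \<ge> 0"
proof (cases "1 - y\<^sup>2 > 0")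
  case False
  then show ?thesis by (simp add: bump_def bump1_def bump2_def pos3_def)
next
  case True
  define m where "m = 1 - y\<^sup>2"
  have m: "m > 0" "max 0 (1 - y\<^sup>2) = m" "y\<^sup>2 = 1 - m" using True by (auto simp: m_def)
  have "c\<^sup>2 \<le> B\<^sup>2" using c by (metis abs_ge_zero abs_le_square_iff abs_of_nonneg order_trans)
  then have "c\<^sup>2 / (2*e) \<le> B\<^sup>2 / (2*e)" using e by (simp add: divide_right_mono)
  with L have L': "L \<ge> 12 * e + c\<^sup>2 / (2 * e)" by linarith
  have "0 \<le> (c * m - 6 * e * y)\<^sup>2 / (2*e)" using e by simp
  also have "\<dots> = c\<^sup>2/(2*e) * m\<^sup>2 - 6 * c * y * m + 18 * e * y\<^sup>2"
    using e by (simp add: field_simps power2_eq_square)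
  also have "\<dots> \<le> L * m\<^sup>2 - 12 * e * m\<^sup>2 - 6 * c * y * m + 18 * e * y\<^sup>2"
    using mult_right_mono[OF L', of "m\<^sup>2"] by (simp add: algebra_simps)
  also have "\<dots> \<le> L * m\<^sup>2 - 6 * c * y * m + 24 * e * y\<^sup>2 - 6 * e * m"
  proof -
    have "0 \<le> m\<^sup>2 + (1 - m)\<^sup>2" by simp
    then have "m \<le> y\<^sup>2 + 2 * m\<^sup>2" unfolding m(3) by (simp add: power2_eq_square algebra_simps)
    from mult_left_mono[OF this, of "6*e"] e show ?thesis by (simp add: algebra_simps)
  qed
  finally have "0 \<le> m * (L * m\<^sup>2 - 6 * c * y * m + 24 * e * y\<^sup>2 - 6 * e * m)" using m by simp
  also have "\<dots> = L * bump y + c * bump1 y + e * bump2 y"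
    unfolding bump_def bump1_def bump2_def pos3_def m(2) by (simp add: power2_eq_square power3_eq_cube algebra_simps)
  finally show ?thesis .
qed

lemma C21_affine: "C21 T (\<lambda>x t. x - a - b * t) (\<lambda>x t. 1) (\<lambda>x t. 0) (\<lambda>x t. - b)"
  unfolding C21_def by (auto intro!: continuous_intros derivative_eq_intros)

lemma nondecreasing_from_derivative:
  assumes d: "\<And>s. s \<in> {0..T} \<Longrightarrow> s \<in> {a..b} \<Longrightarrow> (J has_real_derivative J' s) (at s within {0..T})"
    and "0 \<le> a" "a \<le> b" "b \<le> T" and p: "\<And>s. a < s \<Longrightarrow> s < b \<Longrightarrow> J' s \<ge> 0"
  shows "J a \<le> J b"
proof (rule DERIV_nonneg_imp_increasing_open[OF assms(3)])
  fix s assume s: "a < s" "s < b"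
  have "(J has_real_derivative J' s) (at s within {0..T})" using d[of s] s assms by auto
  moreover have "at s within {0..T} = at s" by (rule at_within_Icc_at) (use s assms in auto)
  ultimately show "\<exists>y. (J has_real_derivative y) (at s) \<and> 0 \<le> y" using p s by auto
next
  have "continuous_on {a..b} J" 
    unfolding continuous_on_eq_continuous_within
  proof
    fix s assume s: "s \<in> {a..b}"
    then have "continuous (at s within {0..T}) J"
      using d[of s] assms by (auto intro!: DERIV_continuous)
    then show "continuous (at s within {a..b}) J"
      by (rule continuous_within_subset) (use assms in auto)
  qed
  then show "continuous_on {a..b} J" .
qed

text \<open>The weight \<open>exp (L * \<tau>)\<close> times the moving bump is a subsolution of the
  backward adjoint equation, so the weighted mass \<open>J\<close> of the nonnegative supersolution
  \<open>z\<close> increases from \<open>s\<close> to \<open>T\<close>. At \<open>s\<close> it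
  dominates the mass on the unit interval around \<open>x\<close>, because the bump is at least
  \<open>27/64\<close> there.\<close>

lemma unit_mass_bound:
  assumes z: "C21 T z zx zxx zt" and T: "T > 0" and e: "e > 0" and C: "C \<ge> 0"
    and g: "\<And>x. (g has_real_derivative g' x) (at x)" and g': "continuous_on UNIV g'"
    and gG: "\<And>x. \<bar>g x\<bar> \<le> G" and gL: "\<And>x. \<bar>g' x\<bar> \<le> Lg"
    and pos: "\<And>x t. t \<in> {0..T} \<Longrightarrow> z x t \<ge> 0"
    and sup: "\<And>x t. t \<in> {0<..T} \<Longrightarrow> zt x t \<ge> e * zxx x t - g x * zx x t - C * z x t"
  shows "\<exists>K\<ge>0. \<forall>x. \<forall>s\<in>{0..<T}. integral {x-1/2..x+1/2} (\<lambda>y. z y s) \<le> K * exp (x\<^sup>2 / (e * (T - s)))"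
proof -
  define I where "I = integral {-1..1} (\<lambda>y. z y T * bump y)"
  have cb: "continuous_on S bump" for S
    using bump_deriv by (meson DERIV_isCont continuous_at_imp_continuous_on)
  have cz: "continuous_on S (\<lambda>y. z y t)" if "t \<in> {0..T}" for S t
    by (rule C21_slice_continuous(1)[OF z that])
  have I0: "I \<ge> 0" unfolding I_def
    by (intro integral_nonneg integrable_continuous_real continuous_intros cz cb)
      (use T pos bump_nonneg in auto)
  define K where "K = 64/27 * exp ((Lg + C + 12 * e) * T + G\<^sup>2 * T / e) * I"
  have "integral {x-1/2..x+1/2} (\<lambda>y. z y s) \<le> K * exp (x\<^sup>2 / (e * (T - s)))" if s: "s \<in> {0..<T}" for x s
  proof -
    define D where "D = T - s"
    have D: "D > 0" "D \<le> T" using s by (auto simp: D_def)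
    \<comment> \<open>The bump is centred at \<open>a + b * \<tau>\<close>, which is \<open>x\<close> at time \<open>s\<close> and \<open>0\<close> at time \<open>T\<close>.\<close>
    define b where "b = - x / D"
    define a where "a = x * T / D"
    define B where "B = \<bar>x\<bar> / D + G"
    \<comment> \<open>Chosen so that \<open>L + g' - C\<close>, the factor that the adjoint operator
      and the potential leave in front of \<open>bump\<close>, meets the threshold of
      \<open>bump_subsolution\<close>.\<close>
    define L where "L = Lg + C + 12 * e + B\<^sup>2 / (2 * e)"
    define y where "y v \<tau> = v - a - b * \<tau>" for v \<tau>
    have ab: "a + b * \<tau> = x * ((T - \<tau>) / D)" for \<tau>
      using D by (simp add: a_def b_def field_simps)
    have G0: "G \<ge> 0" using gG[of 0] by linarith
    have bB: "\<bar>g v - b\<bar> \<le> B" for v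
    proof -
      have "\<bar>b\<bar> = \<bar>x\<bar> / D" using D by (simp add: b_def abs_divide)
      then show ?thesis using gG[of v] by (simp add: B_def)
    qed
    have p1: "C21 T (\<lambda>x t. bump (x - a - b * t)) (\<lambda>x t. bump1 (x - a - b * t))
        (\<lambda>x t. bump2 (x - a - b * t)) (\<lambda>x t. bump1 (x - a - b * t) * (- b))"
      using C21_compose[OF bump_deriv bump1_deriv bump2_continuous C21_affine[of T a b]] by simp
    have p2: "C21 T (\<lambda>x t. exp (L * t)) (\<lambda>x t. 0) (\<lambda>x t. 0) (\<lambda>x t. L * exp (L * t))"
      by (rule C21_time) (auto intro!: derivative_eq_intros continuous_intros)
    have p: "C21 T (\<lambda>x t. exp (L * t) * bump (y x t)) (\<lambda>x t. exp (L * t) * bump1 (y x t))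
        (\<lambda>x t. exp (L * t) * bump2 (y x t)) (\<lambda>x t. exp (L * t) * (L * bump (y x t) - b * bump1 (y x t)))"
      using C21_mult[OF p2 p1] by (simp add: y_def algebra_simps)
    \<comment> \<open>The centre stays between \<open>x\<close> and 0, so this fixed interval
      contains the support at all times from \<open>s\<close> to \<open>T\<close>.\<close>
    define l where "l = - \<bar>x\<bar> - 2"
    define r where "r = \<bar>x\<bar> + 2"
    have lr: "l \<le> r" by (simp add: l_def r_def)
    have ybd: "\<bar>y l \<tau>\<bar> \<ge> 1 \<and> \<bar>y r \<tau>\<bar> \<ge> 1" if "\<tau> \<in> {s..T}" for \<tau>
    proof -
      have "\<bar>(T - \<tau>) / D\<bar> \<le> 1" using that D by (simp add: D_def)
      then have "\<bar>a + b * \<tau>\<bar> \<le> \<bar>x\<bar>" unfolding ab abs_mult by (rule mult_left_le) simp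
      then show ?thesis by (auto simp: y_def l_def r_def)
    qed
    define J where "J \<tau> = integral {l..r} (\<lambda>v. z v \<tau> * (exp (L * \<tau>) * bump (y v \<tau>)))" for \<tau>
    define J' where "J' \<tau> = integral {l..r} (\<lambda>v. (zt v \<tau> - e * zxx v \<tau> + g v * zx v \<tau>) * (exp (L * \<tau>) * bump (y v \<tau>))
        + z v \<tau> * (exp (L * \<tau>) * (L * bump (y v \<tau>) - b * bump1 (y v \<tau>)) + e * (exp (L * \<tau>) * bump2 (y v \<tau>))
         + g v * (exp (L * \<tau>) * bump1 (y v \<tau>)) + g' v * (exp (L * \<tau>) * bump (y v \<tau>))))" for \<tau>
    have cg: "continuous_on S g" for S
      using g by (meson DERIV_isCont continuous_at_imp_continuous_on)
    have cg': "continuous_on S g'" for S using g' continuous_on_subset by blast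
    have "J s \<le> J T"
    proof (rule nondecreasing_from_derivative[where J = J and J' = J' and T = T])
      fix \<tau> assume \<tau>: "\<tau> \<in> {0..T}" "\<tau> \<in> {s..T}"
      show "(J has_real_derivative J' \<tau>) (at \<tau> within {0..T})"
        unfolding J_def[abs_def] J'_def
        by (rule weighted_mass_derivative[OF z p g g' \<tau>(1) lr, where e = e])
          (simp_all only: ybd[OF \<tau>(2), THEN conjunct1, THEN bump_outside]
            ybd[OF \<tau>(2), THEN conjunct2, THEN bump_outside] mult_zero_right)
    next
      fix \<tau> assume \<tau>: "s < \<tau>" "\<tau> < T"
      then have \<tau>': "\<tau> \<in> {0..T}" "\<tau> \<in> {0<..T}" using s by auto
      have cy: "continuous_on S (\<lambda>v. bump (y v \<tau>))" "continuous_on S (\<lambda>v. bump1 (y v \<tau>))"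
        "continuous_on S (\<lambda>v. bump2 (y v \<tau>))" for S
        unfolding y_def by (rule C21_slice_continuous[OF p1 \<tau>'(1)])+
      show "J' \<tau> \<ge> 0" unfolding J'_def
      proof (rule integral_nonneg)
        show "(\<lambda>v. (zt v \<tau> - e * zxx v \<tau> + g v * zx v \<tau>) * (exp (L * \<tau>) * bump (y v \<tau>))
        + z v \<tau> * (exp (L * \<tau>) * (L * bump (y v \<tau>) - b * bump1 (y v \<tau>)) + e * (exp (L * \<tau>) * bump2 (y v \<tau>))
         + g v * (exp (L * \<tau>) * bump1 (y v \<tau>)) + g' v * (exp (L * \<tau>) * bump (y v \<tau>)))) integrable_on {l..r}"
          by (intro integrable_continuous_real continuous_intros cg cg'
              C21_slice_continuous[OF z \<tau>'(1)] cy)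
        fix v
        have gL': "- Lg \<le> g' v" using gL[of v] by linarith
        have "0 \<le> (L + g' v - C) * bump (y v \<tau>) + (g v - b) * bump1 (y v \<tau>) + e * bump2 (y v \<tau>)"
          by (rule bump_subsolution[OF e _ bB]) (use gL' in \<open>simp add: L_def\<close>)
        then have 1: "0 \<le> z v \<tau> * exp (L * \<tau>) * ((L + g' v - C) * bump (y v \<tau>) + (g v - b) * bump1 (y v \<tau>) + e * bump2 (y v \<tau>))"
          using pos[OF \<tau>'(1)] by simp
        have 2: "- C * z v \<tau> * (exp (L * \<tau>) * bump (y v \<tau>)) \<le> 
            (zt v \<tau> - e * zxx v \<tau> + g v * zx v \<tau>) * (exp (L * \<tau>) * bump (y v \<tau>))"
          using sup[OF \<tau>'(2), of v] bump_nonneg by (intro mult_right_mono) auto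
        have id: "A * (E * b0) + Z * (E * (L * b0 - b * b1) + e * (E * b2) + g0 * (E * b1) + h * (E * b0))
            = A * (E * b0) - (- C * Z * (E * b0)) + Z * E * ((L + h - C) * b0 + (g0 - b) * b1 + e * b2)"
          for A E b0 Z b1 b2 g0 h :: real by (simp add: algebra_simps)
        show "0 \<le> (zt v \<tau> - e * zxx v \<tau> + g v * zx v \<tau>) * (exp (L * \<tau>) * bump (y v \<tau>))
        + z v \<tau> * (exp (L * \<tau>) * (L * bump (y v \<tau>) - b * bump1 (y v \<tau>)) + e * (exp (L * \<tau>) * bump2 (y v \<tau>))
         + g v * (exp (L * \<tau>) * bump1 (y v \<tau>)) + g' v * (exp (L * \<tau>) * bump (y v \<tau>)))"
          unfolding id using 1 2 by linarith
      qed
    qed (use s in auto)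
    \<comment> \<open>At time \<open>T\<close> the bump is centred at 0 for every \<open>x\<close>
      and \<open>s\<close>, hence a single constant \<open>I\<close>.\<close>
    also have "J T = exp (L * T) * I"
    proof -
      have "((\<lambda>v. z v T * bump v) has_integral I) {-1..1}"
        unfolding I_def by (intro integrable_integral integrable_continuous_real continuous_intros cz cb) (use T in auto)
      then have "((\<lambda>v. z v T * bump v) has_integral I) {l..r}"
        by (rule has_integral_on_superset) (use bump_outside in \<open>auto simp: l_def r_def\<close>)
      then have "((\<lambda>v. z v T * (exp (L * T) * bump (y v T))) has_integral exp (L * T) * I) {l..r}"
        using ab[of T] has_integral_mult_right[of "\<lambda>v. z v T * bump v" I "{l..r}" "exp (L*T)"]
        by (simp add: y_def algebra_simps)
      then show ?thesis unfolding J_def by (rule integral_unique)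
    qed
    finally have J: "J s \<le> exp (L * T) * I" .
    have s': "s \<in> {0..T}" using s by auto
    have ys: "y v s = v - x" for v using ab[of s] D by (simp add: y_def D_def algebra_simps)
    have "integral {x-1/2..x+1/2} (\<lambda>v. z v s * (exp (L * s) * (27/64))) \<le>
        integral {x-1/2..x+1/2} (\<lambda>v. z v s * (exp (L * s) * bump (y v s)))"
    proof (rule integral_le)
      show "(\<lambda>v. z v s * (exp (L * s) * (27/64))) integrable_on {x-1/2..x+1/2}"
        by (intro integrable_continuous_real continuous_intros cz s')
      show "(\<lambda>v. z v s * (exp (L * s) * bump (y v s))) integrable_on {x-1/2..x+1/2}"
        by (intro integrable_continuous_real continuous_intros cz s' C21_slice_continuous[OF p s'])
      fix v assume "v \<in> {x-1/2..x+1/2}"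
      then have "27/64 \<le> bump (y v s)" unfolding ys by (intro bump_lower) (auto simp: abs_if)
      then show "z v s * (exp (L * s) * (27/64)) \<le> z v s * (exp (L * s) * bump (y v s))"
        using pos[OF s'] by (intro mult_left_mono) auto
    qed
    also have "\<dots> \<le> J s" unfolding J_def
    proof (rule integral_subset_le)
      show "{x-1/2..x+1/2} \<subseteq> {l..r}" by (auto simp: l_def r_def)
      show "(\<lambda>v. z v s * (exp (L * s) * bump (y v s))) integrable_on {x-1/2..x+1/2}"
        "(\<lambda>v. z v s * (exp (L * s) * bump (y v s))) integrable_on {l..r}"
        by (intro integrable_continuous_real continuous_intros cz s' C21_slice_continuous[OF p s'])+
    qed (use pos[OF s'] bump_nonneg in auto)
    also note J
    finally have "integral {x-1/2..x+1/2} (\<lambda>v. z v s) * (exp (L * s) * (27/64)) \<le> exp (L * T) * I" by simp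
    then have "integral {x-1/2..x+1/2} (\<lambda>v. z v s) \<le> exp (L * T) * I / (exp (L * s) * (27/64))"
      by (simp add: pos_le_divide_eq)
    also have "\<dots> = 64/27 * exp (L * D) * I" by (simp add: D_def exp_diff right_diff_distrib)
    also have "\<dots> \<le> 64/27 * exp ((Lg + C + 12 * e) * T + G\<^sup>2 * T / e + x\<^sup>2 / (e * D)) * I"
    proof -
      have Lg0: "Lg \<ge> 0" using gL[of 0] by linarith
      \<comment> \<open>The bump moves with speed \<open>\<bar>x\<bar> / D\<close> for a time
        \<open>D\<close>, and \<open>L\<close> is quadratic in the speed: the exponent is of order
        \<open>x^2 / (e * D)\<close>.\<close>
      have "B\<^sup>2 \<le> 2 * (\<bar>x\<bar> / D)\<^sup>2 + 2 * G\<^sup>2" unfolding B_def power2_sum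
        using sum_squares_bound[of "\<bar>x\<bar>/D" G] by linarith
      then have "B\<^sup>2 * (D / (2*e)) \<le> (2 * (\<bar>x\<bar> / D)\<^sup>2 + 2 * G\<^sup>2) * (D / (2*e))"
        using D e by (intro mult_right_mono) auto
      also have "\<dots> = x\<^sup>2 / (e * D) + G\<^sup>2 * D / e" using D e by (simp add: field_simps power2_eq_square)
      also have "G\<^sup>2 * D / e \<le> G\<^sup>2 * T / e" using D e by (simp add: divide_right_mono mult_left_mono)
      finally have 1: "B\<^sup>2 / (2*e) * D \<le> x\<^sup>2 / (e * D) + G\<^sup>2 * T / e" by (simp add: algebra_simps)
      have "(Lg + C + 12 * e) * D \<le> (Lg + C + 12 * e) * T" using D Lg0 C e by (intro mult_left_mono) auto
      then have "L * D \<le> (Lg + C + 12 * e) * T + G\<^sup>2 * T / e + x\<^sup>2 / (e * D)"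
        using 1 unfolding L_def by (simp add: algebra_simps)
      then show ?thesis using I0 by (intro mult_right_mono mult_left_mono) auto
    qed
    also have "\<dots> = K * exp (x\<^sup>2 / (e * (T - s)))" by (simp add: K_def D_def exp_add)
    finally show ?thesis .
  qed
  moreover have "K \<ge> 0" using I0 by (simp add: K_def)
  ultimately show ?thesis by blast
qed

section \<open>Subsolutions of Gaussian growth\<close>

definition cutoffR :: "real \<Rightarrow> real \<Rightarrow> real" where
  "cutoffR N y = pos3 ((y\<^sup>2 - N\<^sup>2) / (2 * N + 1))"
definition cutoffR1 :: "real \<Rightarrow> real \<Rightarrow> real" where
  "cutoffR1 N y = 3 * (max 0 ((y\<^sup>2 - N\<^sup>2) / (2 * N + 1)))^2 * (2 * y / (2 * N + 1))"
definition cutoffR2 :: "real \<Rightarrow> real \<Rightarrow> real" where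
  "cutoffR2 N y = 6 * max 0 ((y\<^sup>2 - N\<^sup>2) / (2 * N + 1)) * (2 * y / (2 * N + 1))^2
    + 3 * (max 0 ((y\<^sup>2 - N\<^sup>2) / (2 * N + 1)))^2 * (2 / (2 * N + 1))"
text \<open>\<open>cutoffR\<close> is 0 for \<open>\<bar>y\<bar> \<le> N\<close> and 1 at
  \<open>\<bar>y\<bar> = N + 1\<close>, because \<open>(N+1)^2 - N^2 = 2 N + 1\<close>; the use of
  \<open>y^2\<close> avoids the corner of \<open>\<bar>y\<bar>\<close>. The outer cube lets the
  cutoff vanish together with its derivative at \<open>\<bar>y\<bar> = N + 1\<close>. It is negative
  further out, so it serves only up to there.\<close>

definition cutoff :: "real \<Rightarrow> real \<Rightarrow> real" where "cutoff N y = (1 - cutoffR N y)^3"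
definition cutoff1 :: "real \<Rightarrow> real \<Rightarrow> real" where "cutoff1 N y = - 3 * (1 - cutoffR N y)^2 * cutoffR1 N y"
definition cutoff2 :: "real \<Rightarrow> real \<Rightarrow> real" where
  "cutoff2 N y = 6 * (1 - cutoffR N y) * (cutoffR1 N y)^2 - 3 * (1 - cutoffR N y)^2 * cutoffR2 N y"

lemma cutoffR_deriv: "(cutoffR N has_real_derivative cutoffR1 N y) (at y)"
proof -
  have 1: "((\<lambda>y::real. (y\<^sup>2 - N\<^sup>2) / (2 * N + 1)) has_real_derivative (2 * y / (2 * N + 1))) (at y)"
    by (rule DERIV_cdivide) (auto intro!: derivative_eq_intros)
  from DERIV_chain2[OF pos3_deriv 1] show ?thesis
    by (simp add: cutoffR_def[abs_def] cutoffR1_def)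
qed

lemma cutoffR1_deriv: "(cutoffR1 N has_real_derivative cutoffR2 N y) (at y)"
proof -
  have 1: "((\<lambda>y::real. (y\<^sup>2 - N\<^sup>2) / (2 * N + 1)) has_real_derivative (2 * y / (2 * N + 1))) (at y)"
    by (rule DERIV_cdivide) (auto intro!: derivative_eq_intros)
  have 2: "((\<lambda>y::real. 2 * y / (2 * N + 1)) has_real_derivative 2 / (2 * N + 1)) (at y)"
    by (rule DERIV_cdivide) (auto intro!: derivative_eq_intros)
  from DERIV_mult[OF DERIV_chain2[OF pos3_deriv2 1] 2] show ?thesis
    by (simp add: cutoffR1_def[abs_def] cutoffR2_def power2_eq_square algebra_simps)
qed

lemma cutoff_deriv: "(cutoff N has_real_derivative cutoff1 N y) (at y)"
  unfolding cutoff_def[abs_def] cutoff1_def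
  by (rule derivative_eq_intros cutoffR_deriv refl | simp)+

lemma cutoff1_deriv: "(cutoff1 N has_real_derivative cutoff2 N y) (at y)"
  unfolding cutoff1_def[abs_def] cutoff2_def
  by (rule derivative_eq_intros cutoffR_deriv cutoffR1_deriv refl | simp)+ (simp add: algebra_simps power2_eq_square)

lemma cutoff2_continuous: "N \<ge> 0 \<Longrightarrow> continuous_on UNIV (cutoff2 N)"
proof -
  assume "N \<ge> 0"
  have 1: "continuous_on UNIV (cutoffR N)" "continuous_on UNIV (cutoffR1 N)"
    using cutoffR_deriv cutoffR1_deriv by (meson DERIV_isCont continuous_at_imp_continuous_on)+
  have "continuous_on UNIV (cutoffR2 N)"
    unfolding cutoffR2_def[abs_def] using \<open>N \<ge> 0\<close> by (intro continuous_intros) auto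
  with 1 show ?thesis unfolding cutoff2_def[abs_def] by (intro continuous_intros)
qed

lemma cutoff_inside:
  assumes "N \<ge> 0" "\<bar>y\<bar> \<le> N"
  shows "cutoff N y = 1" "cutoff1 N y = 0" "cutoff2 N y = 0"
proof -
  have "y\<^sup>2 \<le> N\<^sup>2" using assms by (metis abs_le_square_iff abs_of_nonneg)
  then have "(y\<^sup>2 - N\<^sup>2) / (2 * N + 1) \<le> 0" using assms by (simp add: divide_le_0_iff)
  then have "max 0 ((y\<^sup>2 - N\<^sup>2) / (2 * N + 1)) = 0" by simp
  then show "cutoff N y = 1" "cutoff1 N y = 0" "cutoff2 N y = 0"
    by (simp_all add: cutoff_def cutoff1_def cutoff2_def cutoffR_def cutoffR1_def cutoffR2_def pos3_def)
qed

lemma cutoff_end: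
  assumes "N \<ge> 0" "\<bar>y\<bar> = N + 1"
  shows "cutoff N y = 0" "cutoff1 N y = 0"
proof -
  have "y\<^sup>2 = (N+1)\<^sup>2" using assms by (metis power2_abs)
  then have "(y\<^sup>2 - N\<^sup>2) / (2 * N + 1) = 1" using assms by (simp add: power2_eq_square field_simps)
  then show "cutoff N y = 0" "cutoff1 N y = 0"
    by (simp_all add: cutoff_def cutoff1_def cutoffR_def pos3_def)
qed

text \<open>Independence of \<open>N\<close> comes from
  \<open>2 \<bar>y\<bar> / (2 N + 1) \<le> 2\<close>. This bounds \<open>cutoffR1\<close> by 6 and
  \<open>cutoffR2\<close> by 30, and then \<open>18 = 3 * 6\<close> and
  \<open>306 = 6 * 36 + 3 * 30\<close>.\<close>

lemma cutoff_bounds: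
  assumes "N \<ge> 0" "\<bar>y\<bar> \<le> N + 1"
  shows "0 \<le> cutoff N y" "cutoff N y \<le> 1" "\<bar>cutoff1 N y\<bar> \<le> 18" "\<bar>cutoff2 N y\<bar> \<le> 306"
proof -
  define r where "r = max 0 ((y\<^sup>2 - N\<^sup>2) / (2 * N + 1))"
  define d where "d = 2 * y / (2 * N + 1)"
  define f where "f = 2 / (2 * N + 1)"
  have "y\<^sup>2 \<le> (N+1)\<^sup>2" using power_mono[OF assms(2), of 2] by simp
  then have "y\<^sup>2 - N\<^sup>2 \<le> 2 * N + 1" by (simp add: power2_eq_square algebra_simps)
  then have r: "0 \<le> r" "r \<le> 1" using assms by (auto simp: r_def)
  have "\<bar>d\<bar> = 2 * \<bar>y\<bar> / (2 * N + 1)" using assms by (simp add: d_def abs_divide abs_mult)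
  also have "\<dots> \<le> 2" using assms by (simp add: divide_le_eq)
  finally have d: "\<bar>d\<bar> \<le> 2" .
  have f: "0 \<le> f" "f \<le> 2" using assms by (auto simp: f_def divide_le_eq)
  have R: "cutoffR N y = r^3" "cutoffR1 N y = 3 * r\<^sup>2 * d" "cutoffR2 N y = 6 * r * d\<^sup>2 + 3 * r\<^sup>2 * f"
    by (simp_all add: cutoffR_def cutoffR1_def cutoffR2_def pos3_def r_def d_def f_def)
  have r2: "0 \<le> r\<^sup>2" "r\<^sup>2 \<le> 1" and r3: "0 \<le> r^3" "r^3 \<le> 1" using r by (auto simp: power_le_one)
  have d2: "0 \<le> d\<^sup>2" "d\<^sup>2 \<le> 4" using d power_mono[of "\<bar>d\<bar>" 2 2] by auto
  define c where "c = 1 - r^3"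
  have c: "0 \<le> c" "c \<le> 1" "0 \<le> c\<^sup>2" "c\<^sup>2 \<le> 1" "0 \<le> c^3" "c^3 \<le> 1" using r3 by (auto simp: c_def power_le_one)
  have R1: "\<bar>cutoffR1 N y\<bar> \<le> 6"
  proof -
    have "\<bar>cutoffR1 N y\<bar> = 3 * r\<^sup>2 * \<bar>d\<bar>" by (simp add: R abs_mult)
    also have "\<dots> \<le> 3 * 1 * 2" using r2 d by (intro mult_mono) auto
    finally show ?thesis by simp
  qed
  have R2: "0 \<le> cutoffR2 N y" "cutoffR2 N y \<le> 30"
  proof -
    have "6 * r * d\<^sup>2 \<le> 6 * 1 * 4" using r d2 by (intro mult_mono) auto
    moreover have "3 * r\<^sup>2 * f \<le> 3 * 1 * 2" using r2 f by (intro mult_mono) auto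
    ultimately show "cutoffR2 N y \<le> 30" unfolding R by linarith
    show "0 \<le> cutoffR2 N y" using r r2 f d2 by (simp add: R)
  qed
  show "0 \<le> cutoff N y" "cutoff N y \<le> 1" using c by (simp_all add: cutoff_def R c_def[symmetric])
  have "\<bar>cutoff1 N y\<bar> = 3 * c\<^sup>2 * \<bar>cutoffR1 N y\<bar>" by (simp add: cutoff1_def R(1) c_def[symmetric] abs_mult)
  also have "\<dots> \<le> 3 * 1 * 6" using R1 c by (intro mult_mono) auto
  finally show "\<bar>cutoff1 N y\<bar> \<le> 18" by simp
  have "(cutoffR1 N y)\<^sup>2 \<le> 36" using R1 power_mono[of "\<bar>cutoffR1 N y\<bar>" 6 2] by auto
  then have 1: "0 \<le> 6 * c * (cutoffR1 N y)\<^sup>2" "6 * c * (cutoffR1 N y)\<^sup>2 \<le> 6 * 1 * 36" 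
    using c by (simp, intro mult_mono) (use c in auto)
  have 2: "0 \<le> 3 * c\<^sup>2 * cutoffR2 N y" "3 * c\<^sup>2 * cutoffR2 N y \<le> 3 * 1 * 30" using c R2 
    by simp (use c R2 in \<open>intro mult_mono; auto\<close>)
  have "cutoff2 N y = 6 * c * (cutoffR1 N y)\<^sup>2 - 3 * c\<^sup>2 * cutoffR2 N y" by (simp add: cutoff2_def R(1) c_def)
  then show "\<bar>cutoff2 N y\<bar> \<le> 306" using 1 2 by linarith
qed

text \<open>With \<open>\<kappa> = 1 + k * (s - s0)\<close> the Gaussian \<open>exp (- (a * y\<^sup>2 * \<kappa> + k2 * s))\<close> is a supersolution of the adjoint
equation as long as \<open>\<kappa> \<le> 2\<close>; this is what limits the length of a time step.\<close>

lemma gaussian_weight_supersolution: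
  fixes a e \<kappa> g G h Lg y :: real
  assumes "a > 0" "e > 0" "1 \<le> \<kappa>" "\<kappa> \<le> 2" "\<bar>g\<bar> \<le> G" "\<bar>h\<bar> \<le> Lg"
  shows "- (a * y\<^sup>2 * (16 * e * a + 1) + (4 * a * G\<^sup>2 + Lg)) + e * ((- 2 * a * \<kappa> * y)\<^sup>2 - 2 * a * \<kappa>)
    + g * (- 2 * a * \<kappa> * y) + h \<le> 0"
proof -
  have "\<kappa>\<^sup>2 \<le> 4" using power_mono[of \<kappa> 2 2] assms by auto
  then have "(4 * e * a\<^sup>2 * y\<^sup>2) * \<kappa>\<^sup>2 \<le> (4 * e * a\<^sup>2 * y\<^sup>2) * 4" using assms by (intro mult_left_mono) auto
  then have 1: "e * (- 2 * a * \<kappa> * y)\<^sup>2 \<le> 16 * e * a\<^sup>2 * y\<^sup>2" by (simp add: power2_eq_square algebra_simps)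
  have "\<bar>g * (- 2 * a * \<kappa> * y)\<bar> = \<bar>g\<bar> * (2 * a * \<kappa> * \<bar>y\<bar>)" using assms by (simp add: abs_mult)
  also have "\<dots> \<le> G * (2 * a * 2 * \<bar>y\<bar>)" using assms by (intro mult_mono) auto
  also have "\<dots> = a * (2 * \<bar>y\<bar> * (2 * G))" by simp
  also have "\<dots> \<le> a * (\<bar>y\<bar>\<^sup>2 + (2 * G)\<^sup>2)" using sum_squares_bound[of "\<bar>y\<bar>" "2*G"] assms 
    by (intro mult_left_mono) auto
  finally have 2: "g * (- 2 * a * \<kappa> * y) \<le> a * y\<^sup>2 + 4 * a * G\<^sup>2" by (simp add: algebra_simps)
  have 3: "e * (2 * a * \<kappa>) \<ge> 0" using assms by simp
  show ?thesis using 1 2 3 assms(6) by (simp add: algebra_simps power2_eq_square)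
qed

text \<open>Test \<open>q\<close> with the Gaussian weight times \<open>cutoff N\<close>. The
  derivative of the weighted mass is nonpositive except for contributions of the strips
  \<open>N \<le> \<bar>y\<bar> \<le> N + 1\<close>, where the weight beats the assumed growth of the
  mass. Starting from zero, the mass of \<open>q\<close> near \<open>x1\<close> at time
  \<open>t1\<close> is thus at most \<open>Q / N\<close> for every large \<open>N\<close>.\<close>

lemma vanish_step:
  assumes q: "C21 T q qx qxx qt" and e: "e > 0"
    and g: "\<And>x. (g has_real_derivative g' x) (at x)" and g': "continuous_on UNIV g'"
    and gG: "\<And>x. \<bar>g x\<bar> \<le> G" and gL: "\<And>x. \<bar>g' x\<bar> \<le> Lg"
    and pos: "\<And>x t. t \<in> {0..T} \<Longrightarrow> q x t \<ge> 0"
    and sub: "\<And>x t. t \<in> {0<..T} \<Longrightarrow> qt x t \<le> e * qxx x t - g x * qx x t"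
    and A: "A \<ge> 0" and K: "K \<ge> 0"
    and mass: "\<And>x s. s \<in> {s0..t1} \<Longrightarrow> integral {x-1/2..x+1/2} (\<lambda>y. q y s) \<le> K * exp (A * x\<^sup>2)"
    and s0: "0 \<le> s0" "s0 \<le> t1" "t1 \<le> T" "t1 - s0 \<le> 1 / (16 * e * (2 * A + 1) + 1)"
    and init: "\<And>x. q x s0 = 0"
  shows "q x1 t1 = 0"
proof (rule ccontr)
  assume "q x1 t1 \<noteq> 0"
  have t1: "t1 \<in> {0..T}" using s0 by auto
  \<comment> \<open>Since \<open>(N + 1/2)^2 \<le> 2 N^2 + 1/2\<close>, this weight times the mass
    bound on a strip is still at most \<open>exp (A/2 - N^2)\<close>.\<close>
  define a where "a = 2 * A + 1"
  \<comment> \<open>\<open>k\<close> pays for the terms of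
    \<open>gaussian_weight_supersolution\<close> that grow like \<open>y^2\<close>, and
    \<open>k2\<close> for the bounded ones.\<close>
  define k where "k = 16 * e * a + 1"
  define k2 where "k2 = 4 * a * G\<^sup>2 + Lg"
  have a: "a > 0" "a \<ge> 1" using A by (auto simp: a_def)
  have k: "k > 0" using e a by (simp add: k_def add_pos_pos)
  have G0: "G \<ge> 0" "Lg \<ge> 0" using gG[of 0] gL[of 0] by linarith+
  have k2: "k2 \<ge> 0" using a G0 by (simp add: k2_def)
  define \<kappa> where "\<kappa> s = 1 + k * (s - s0)" for s
  have \<kappa>: "1 \<le> \<kappa> s \<and> \<kappa> s \<le> 2" if "s \<in> {s0..t1}" for s
  proof -
    have "s - s0 \<le> 1 / k" using that s0(4) by (simp add: k_def a_def)
    then have "k * (s - s0) \<le> 1" using k by (simp add: field_simps)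
    then show ?thesis using that k by (simp add: \<kappa>_def)
  qed
  define \<rho> where "\<rho> y s = exp (- (a * y\<^sup>2 * \<kappa> s + k2 * s))" for y s
  have E: "C21 T (\<lambda>y s. - (a * y\<^sup>2 * \<kappa> s + k2 * s)) (\<lambda>y s. - 2 * a * \<kappa> s * y) (\<lambda>y s. - 2 * a * \<kappa> s)
     (\<lambda>y s. - (a * y\<^sup>2 * k + k2))"
    unfolding C21_def \<kappa>_def
    by (auto intro!: continuous_intros derivative_eq_intros simp: algebra_simps power2_eq_square)
  have \<rho>: "C21 T \<rho> (\<lambda>y s. \<rho> y s * (- 2 * a * \<kappa> s * y))
     (\<lambda>y s. \<rho> y s * (- 2 * a * \<kappa> s * y)\<^sup>2 + \<rho> y s * (- 2 * a * \<kappa> s))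
     (\<lambda>y s. \<rho> y s * (- (a * y\<^sup>2 * k + k2)))"
    using C21_compose[OF DERIV_exp DERIV_exp _ E] unfolding \<rho>_def by (simp add: continuous_intros)
  have \<rho>pos: "\<rho> y s > 0" for y s by (simp add: \<rho>_def)
  have c\<rho>: "continuous_on S (\<lambda>y. \<rho> y s)" if "s \<in> {0..T}" for s S by (rule C21_slice_continuous(1)[OF \<rho> that])
  have cq: "continuous_on S (\<lambda>y. q y s)" "continuous_on S (\<lambda>y. qx y s)"
    "continuous_on S (\<lambda>y. qxx y s)" "continuous_on S (\<lambda>y. qt y s)" if "s \<in> {0..T}" for s S 
    using C21_slice_continuous[OF q that] by auto
  define Q where "Q = 2 * T * K * exp (A/2) * (e * (144 * a * 2 + 306) + 18 * G)"
  \<comment> \<open>A fixed window around \<open>x1\<close>: unlike the mass \<open>J\<close> below,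
    \<open>I0\<close> does not depend on \<open>N\<close>, and it is positive as soon as
    \<open>q x1 t1\<close> is.\<close>
  define N0 where "N0 = \<bar>x1\<bar> + 1"
  define I0 where "I0 = integral {-N0..N0} (\<lambda>y. q y t1 * \<rho> y t1)"
  have main: "I0 \<le> Q / N" if N: "N \<ge> N0" for N
  proof -
    have N1: "N \<ge> 1" "N \<ge> 0" using N by (auto simp: N0_def)
    have ch: "C21 T (\<lambda>y s. cutoff N y) (\<lambda>y s. cutoff1 N y) (\<lambda>y s. cutoff2 N y) (\<lambda>y s. 0)"
      by (rule C21_space[OF cutoff_deriv cutoff1_deriv cutoff2_continuous[OF N1(2)]])
    note p = C21_mult[OF \<rho> ch]
    define F where "F y s = (qt y s - e * qxx y s + g y * qx y s) * (\<rho> y s * cutoff N y)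
        + q y s * ((\<rho> y s * (- (a * y\<^sup>2 * k + k2)) * cutoff N y + \<rho> y s * 0)
           + e * ((\<rho> y s * (- 2 * a * \<kappa> s * y)\<^sup>2 + \<rho> y s * (- 2 * a * \<kappa> s)) * cutoff N y
               + 2 * (\<rho> y s * (- 2 * a * \<kappa> s * y)) * cutoff1 N y + \<rho> y s * cutoff2 N y)
           + g y * (\<rho> y s * (- 2 * a * \<kappa> s * y) * cutoff N y + \<rho> y s * cutoff1 N y)
           + g' y * (\<rho> y s * cutoff N y))" for y s
    define J where "J s = integral {-(N+1)..N+1} (\<lambda>y. q y s * (\<rho> y s * cutoff N y))" for s
    \<comment> \<open>On the strips the integrand is at most \<open>D * q\<close>. Each of the two
      strips is a unit interval centred at distance \<open>N + 1/2\<close> from 0, so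
      \<open>mass\<close> applies to it and \<open>\<eta>\<close> carries a factor 2.\<close>
    define D where "D = exp (- a * N\<^sup>2) * (e * (144 * a * (N+1) + 306) + 18 * G)"
    define \<eta> where "\<eta> = 2 * (D * (K * exp (A * (N + 1/2)\<^sup>2)))"
    have D0: "D \<ge> 0" using e a N1 G0 by (simp add: D_def)
    have ends: "cutoff N (-(N+1)) = 0" "cutoff N (N+1) = 0" "cutoff1 N (-(N+1)) = 0" "cutoff1 N (N+1) = 0"
      using cutoff_end[OF N1(2)] N1 by auto
    have dJ: "(J has_real_derivative integral {-(N+1)..N+1} (\<lambda>y. F y s)) (at s within {0..T})"
      if s: "s \<in> {0..T}" for s
      unfolding J_def[abs_def] F_def
      by (rule weighted_mass_derivative[OF q p g g' s, where e = e]) (use N1 in simp, simp_all only: ends mult_zero_right add_0_right)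
    have Fle: "F y s \<le> q y s * \<rho> y s * (e * (2 * (- 2 * a * \<kappa> s * y) * cutoff1 N y + cutoff2 N y) + g y * cutoff1 N y)"
      if s: "s \<in> {s0..t1}" "s > 0" and y: "\<bar>y\<bar> \<le> N + 1" for y s
    proof -
      have sT: "s \<in> {0..T}" "s \<in> {0<..T}" using s s0 by auto
      have 1: "(qt y s - e * qxx y s + g y * qx y s) * (\<rho> y s * cutoff N y) \<le> 0"
        using sub[OF sT(2), of y] \<rho>pos[of y s] cutoff_bounds(1)[OF N1(2) y]
        by (intro mult_nonpos_nonneg) auto
      have "- (a * y\<^sup>2 * k + k2) + e * ((- 2 * a * \<kappa> s * y)\<^sup>2 - 2 * a * \<kappa> s)
         + g y * (- 2 * a * \<kappa> s * y) + g' y \<le> 0"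
        unfolding k_def k2_def using \<kappa>[OF s(1)]
        by (intro gaussian_weight_supersolution[OF a(1) e _ _ gG gL]) auto
      then have 2: "q y s * \<rho> y s * cutoff N y * (- (a * y\<^sup>2 * k + k2) + e * ((- 2 * a * \<kappa> s * y)\<^sup>2 - 2 * a * \<kappa> s)
         + g y * (- 2 * a * \<kappa> s * y) + g' y) \<le> 0"
        using pos[OF sT(1), of y] \<rho>pos[of y s] cutoff_bounds(1)[OF N1(2) y]
        by (intro mult_nonneg_nonpos) auto
      \<comment> \<open>The regrouping is proved for plain variables so that the simplifier does not
        rewrite inside the coefficients. It isolates the adjoint operator applied to the Gaussian,
        which has a sign, from the derivatives of the cutoff.\<close>
      have "M + Z * ((r * c0 * c + r * 0) + e * ((r * X\<^sup>2 + r * Y) * c + 2 * (r * X) * c1 + r * c2)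
           + g0 * (r * X * c + r * c1) + h * (r * c))
          = M + Z * r * c * (c0 + e * (X\<^sup>2 + Y) + g0 * X + h) + Z * r * (e * (2 * X * c1 + c2) + g0 * c1)"
        for M Z r c0 c X Y c1 c2 g0 h :: real by (simp add: algebra_simps)
      from this[of "(qt y s - e * qxx y s + g y * qx y s) * (\<rho> y s * cutoff N y)" "q y s" "\<rho> y s"
          "- (a * y\<^sup>2 * k + k2)" "cutoff N y" "- 2 * a * \<kappa> s * y" "- 2 * a * \<kappa> s" "cutoff1 N y" "cutoff2 N y" "g y" "g' y"]
      show ?thesis unfolding F_def using 1 2 by simp
    qed
    have cg: "continuous_on S g" for S
      using g by (meson DERIV_isCont continuous_at_imp_continuous_on)
    have cg': "continuous_on S g'" for S using g' continuous_on_subset by blast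
    have cc: "continuous_on S (cutoff N)" "continuous_on S (cutoff1 N)" "continuous_on S (cutoff2 N)" for S
      using cutoff_deriv cutoff1_deriv cutoff2_continuous[OF N1(2)] 
      by (meson DERIV_isCont continuous_at_imp_continuous_on continuous_on_subset subset_UNIV)+
    have cF: "continuous_on S (\<lambda>y. F y s)" if "s \<in> {0..T}" for S s
      unfolding F_def by (intro continuous_intros c\<rho> cq cg cg' cc that)
    have Iest: "integral {-(N+1)..N+1} (\<lambda>y. F y s) \<le> \<eta>" if s: "s \<in> {s0..t1}" "s > 0" for s
    proof -
      have sT: "s \<in> {0..T}" using s s0 by auto
      have intF: "(\<lambda>y. F y s) integrable_on {u..v}" for u v
        by (rule integrable_continuous_real) (rule cF[OF sT])
      have outer: "F y s \<le> D * q y s" if y: "N \<le> \<bar>y\<bar>" "\<bar>y\<bar> \<le> N + 1" for y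
      proof -
        note cb = cutoff_bounds[OF N1(2) y(2)]
        have k1: "1 \<le> \<kappa> s" "\<kappa> s \<le> 2" using \<kappa>[OF s(1)] by auto
        have "N\<^sup>2 \<le> y\<^sup>2" using y(1) N1 by (metis abs_le_square_iff abs_of_nonneg)
        then have "a * N\<^sup>2 * 1 \<le> a * y\<^sup>2 * \<kappa> s" using a k1 by (intro mult_mono) auto
        then have r: "\<rho> y s \<le> exp (- a * N\<^sup>2)" using mult_nonneg_nonneg[OF k2, of s] s unfolding \<rho>_def
          by simp
        have "\<bar>2 * (- 2 * a * \<kappa> s * y) * cutoff1 N y\<bar> = 4 * a * \<kappa> s * \<bar>y\<bar> * \<bar>cutoff1 N y\<bar>"
          using a k1 by (simp add: abs_mult)
        also have "\<dots> \<le> 4 * a * 2 * (N+1) * 18" using a k1 y cb N1 by (intro mult_mono) auto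
        finally have "2 * (- 2 * a * \<kappa> s * y) * cutoff1 N y + cutoff2 N y \<le> 144 * a * (N+1) + 306" using cb(4) by linarith
        then have 1: "e * (2 * (- 2 * a * \<kappa> s * y) * cutoff1 N y + cutoff2 N y) \<le> e * (144 * a * (N+1) + 306)"
          using e by (intro mult_left_mono) auto
        have "\<bar>g y * cutoff1 N y\<bar> \<le> G * 18" unfolding abs_mult using gG cb G0 by (intro mult_mono) auto
        with 1 have 2: "e * (2 * (- 2 * a * \<kappa> s * y) * cutoff1 N y + cutoff2 N y) + g y * cutoff1 N y \<le> e * (144 * a * (N+1) + 306) + 18 * G"
          by linarith
        have "F y s \<le> q y s * \<rho> y s * (e * (2 * (- 2 * a * \<kappa> s * y) * cutoff1 N y + cutoff2 N y) + g y * cutoff1 N y)"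
          by (rule Fle[OF s y(2)])
        also have "\<dots> \<le> q y s * \<rho> y s * (e * (144 * a * (N+1) + 306) + 18 * G)"
          using 2 pos[OF sT] \<rho>pos[of y s] by (intro mult_left_mono) auto
        also have "\<dots> \<le> q y s * exp (- a * N\<^sup>2) * (e * (144 * a * (N+1) + 306) + 18 * G)"
          using r pos[OF sT] e a N1 G0 by (intro mult_right_mono mult_left_mono) auto
        finally show ?thesis by (simp add: D_def mult_ac)
      qed
      have qi: "(\<lambda>y. D * q y s) integrable_on {u..v}" for u v
        by (intro integrable_continuous_real continuous_intros cq sT)
      have 1: "integral {-(N+1)..-N} (\<lambda>y. F y s) \<le> D * (K * exp (A * (N + 1/2)\<^sup>2))"
      proof -
        have "integral {-(N+1)..-N} (\<lambda>y. F y s) \<le> integral {-(N+1)..-N} (\<lambda>y. D * q y s)"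
          by (rule integral_le[OF intF qi]) (use outer N1 in auto)
        also have "\<dots> = D * integral {-(N+1/2)-1/2..-(N+1/2)+1/2} (\<lambda>y. q y s)"
        proof -
          have "-(N+1/2)-1/2 = -(N+1)" "-(N+1/2)+1/2 = -N" by simp_all
          then show ?thesis by (simp only: integral_mult_right)
        qed
        also have "\<dots> \<le> D * (K * exp (A * (-(N + 1/2))\<^sup>2))"
          by (intro mult_left_mono mass s D0)
        finally show ?thesis by (simp only: power2_minus)
      qed
      have 3: "integral {N..N+1} (\<lambda>y. F y s) \<le> D * (K * exp (A * (N + 1/2)\<^sup>2))"
      proof -
        have "integral {N..N+1} (\<lambda>y. F y s) \<le> integral {N..N+1} (\<lambda>y. D * q y s)"
          by (rule integral_le[OF intF qi]) (use outer N1 in auto)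
        also have "\<dots> = D * integral {(N+1/2)-1/2..(N+1/2)+1/2} (\<lambda>y. q y s)"
        proof -
          have "(N+1/2)-1/2 = N" "(N+1/2)+1/2 = N+1" by simp_all
          then show ?thesis by (simp only: integral_mult_right)
        qed
        also have "\<dots> \<le> D * (K * exp (A * (N + 1/2)\<^sup>2))"
          by (intro mult_left_mono mass s D0)
        finally show ?thesis by simp
      qed
      \<comment> \<open>Inside radius \<open>N\<close> the cutoff is constant and no error term
        survives.\<close>
      have 2: "integral {-N..N} (\<lambda>y. F y s) \<le> 0"
      proof -
        have "F y s \<le> 0" if "y \<in> {-N..N}" for y
          using Fle[OF s, of y] cutoff_inside[OF N1(2), of y] that by auto
        then have "integral {-N..N} (\<lambda>y. F y s) \<le> integral {-N..N} (\<lambda>y. 0)"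
          by (intro integral_le intF) auto
        then show ?thesis by simp
      qed
      have "integral {-(N+1)..N+1} (\<lambda>y. F y s) = 
        integral {-(N+1)..-N} (\<lambda>y. F y s) + integral {-N..N+1} (\<lambda>y. F y s)"
        by (rule Henstock_Kurzweil_Integration.integral_combine[symmetric]) (use N1 intF in auto)
      also have "integral {-N..N+1} (\<lambda>y. F y s) = integral {-N..N} (\<lambda>y. F y s) + integral {N..N+1} (\<lambda>y. F y s)"
        by (rule Henstock_Kurzweil_Integration.integral_combine[symmetric]) (use N1 intF in auto)
      finally show ?thesis using 1 2 3 by (simp add: \<eta>_def)
    qed
    have "\<eta> * s0 - J s0 \<le> \<eta> * t1 - J t1"
    proof (rule nondecreasing_from_derivative[where T = T and J = "\<lambda>s. \<eta> * s - J s" and J' = "\<lambda>s. \<eta> - integral {-(N+1)..N+1} (\<lambda>y. F y s)"])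
      fix s assume "s \<in> {0..T}"
      from dJ[OF this] show "((\<lambda>s. \<eta> * s - J s) has_real_derivative \<eta> - integral {-(N+1)..N+1} (\<lambda>y. F y s)) (at s within {0..T})"
        by (auto intro!: derivative_eq_intros)
    next
      fix s assume "s0 < s" "s < t1"
      then show "0 \<le> \<eta> - integral {-(N+1)..N+1} (\<lambda>y. F y s)" using Iest[of s] s0 by auto
    qed (use s0 in auto)
    moreover have "J s0 = 0" by (simp add: J_def init)
    ultimately have "J t1 \<le> \<eta> * (t1 - s0)" by (simp add: algebra_simps)
    also have "\<dots> \<le> \<eta> * T" using s0 D0 K by (intro mult_left_mono) (auto simp: \<eta>_def)
    also have "\<eta> * T \<le> Q / N"
    proof -
      \<comment> \<open>The cutoff errors grow only linearly in \<open>N\<close>, so the crude decay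
        \<open>exp (- N^2) \<le> 1 / N^2\<close> already leaves \<open>Q / N\<close>.\<close>
      have "A * (N + 1/2)\<^sup>2 \<le> A * (2 * N\<^sup>2 + 1/2)"
        using sum_squares_bound[of N "1/2"] A by (intro mult_left_mono) (auto simp: power2_sum power_divide)
      then have "- a * N\<^sup>2 + A * (N + 1/2)\<^sup>2 \<le> A / 2 - N\<^sup>2" by (simp add: a_def algebra_simps)
      then have "exp (- a * N\<^sup>2) * exp (A * (N + 1/2)\<^sup>2) \<le> exp (A/2) * exp (- N\<^sup>2)"
        by (simp add: exp_add[symmetric])
      also have "exp (- N\<^sup>2) \<le> 1 / N\<^sup>2"
      proof -
        have "N\<^sup>2 \<le> exp (N\<^sup>2)" using exp_ge_add_one_self[of "N\<^sup>2"] by linarith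
        then show ?thesis using N1 by (simp add: exp_minus field_simps)
      qed
      finally have 1: "exp (- a * N\<^sup>2) * exp (A * (N + 1/2)\<^sup>2) \<le> exp (A/2) * (1 / N\<^sup>2)" by simp
      have 2: "e * (144 * a * (N+1) + 306) + 18 * G \<le> (e * (144 * a * 2 + 306) + 18 * G) * N"
      proof -
        have "e * 144 * a * (N + 1) \<le> e * 144 * a * (2 * N)" using e a N1 by (intro mult_left_mono) auto
        moreover have "e * 306 * 1 \<le> e * 306 * N" "18 * G * 1 \<le> 18 * G * N" using e G0 N1 by (intro mult_left_mono; simp)+
        ultimately show ?thesis by (simp add: algebra_simps)
      qed
      have "\<eta> * T = 2 * T * K * (exp (- a * N\<^sup>2) * exp (A * (N + 1/2)\<^sup>2)) * (e * (144 * a * (N+1) + 306) + 18 * G)"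
        by (simp add: \<eta>_def D_def)
      also have "\<dots> \<le> 2 * T * K * (exp (A/2) * (1 / N\<^sup>2)) * ((e * (144 * a * 2 + 306) + 18 * G) * N)"
        using s0 K N1 e a G0 by (intro mult_mono mult_left_mono 1 2 mult_nonneg_nonneg add_nonneg_nonneg) auto
      also have "\<dots> = Q / N" using N1 by (simp add: Q_def power2_eq_square)
      finally show ?thesis .
    qed
    finally have J: "J t1 \<le> Q / N" .
    have "I0 = integral {-N0..N0} (\<lambda>y. q y t1 * (\<rho> y t1 * cutoff N y))"
      unfolding I0_def by (rule integral_cong) (use cutoff_inside[OF N1(2)] N in auto)
    also have "\<dots> \<le> J t1" unfolding J_def
      by (rule integral_subset_le)
        (use N t1 pos \<rho>pos[THEN less_imp_le] cutoff_bounds(1)[OF N1(2)] in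
          \<open>auto intro!: integrable_continuous_real continuous_intros cq c\<rho> cc mult_nonneg_nonneg\<close>)
    finally show ?thesis using J by simp
  qed
  have "I0 > 0"
  proof -
    have c: "continuous_on {-N0..N0} (\<lambda>y. q y t1 * \<rho> y t1)" by (intro continuous_intros cq c\<rho> t1)
    have n: "0 \<le> q y t1 * \<rho> y t1" for y using pos[OF t1] \<rho>pos[THEN less_imp_le] by simp
    have "I0 \<ge> 0" unfolding I0_def by (intro integral_nonneg integrable_continuous_real c n)
    moreover have "I0 \<noteq> 0"
    proof
      assume "I0 = 0"
      then have "\<forall>y\<in>{-N0..N0}. q y t1 * \<rho> y t1 = 0"
        using integral_eq_0_iff[OF c _ n] by (auto simp: I0_def N0_def)
      moreover have "x1 \<in> {-N0..N0}" by (simp add: N0_def abs_if)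
      ultimately have "q x1 t1 * \<rho> x1 t1 = 0" by blast
      then show False using \<open>q x1 t1 \<noteq> 0\<close> \<rho>pos[of x1 t1] by simp
    qed
    ultimately show ?thesis by simp
  qed
  define N where "N = max N0 (\<bar>Q\<bar> / I0 + 1)"
  have "N \<ge> N0" "N > 0" "N > \<bar>Q\<bar> / I0" by (auto simp: N_def N0_def)
  then have "I0 * N > \<bar>Q\<bar>" using \<open>I0 > 0\<close> by (simp add: field_simps)
  then have "I0 > Q / N" using \<open>N > 0\<close> by (simp add: field_simps)
  then show False using main[OF \<open>N \<ge> N0\<close>] by simp
qed

text \<open>The step length allowed by \<open>vanish_step\<close> depends on \<open>e\<close> and
  \<open>A\<close> only, and the same \<open>A\<close> is valid on all of \<open>{0..S}\<close>.
  Steps of one fixed length \<open>\<delta>\<close> therefore reach any time in that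
  interval.\<close>

lemma vanish_of_gaussian_mass:
  assumes q: "C21 T q qx qxx qt" and e: "e > 0"
    and g: "\<And>x. (g has_real_derivative g' x) (at x)" and g': "continuous_on UNIV g'"
    and gG: "\<And>x. \<bar>g x\<bar> \<le> G" and gL: "\<And>x. \<bar>g' x\<bar> \<le> Lg"
    and pos: "\<And>x t. t \<in> {0..T} \<Longrightarrow> q x t \<ge> 0"
    and sub: "\<And>x t. t \<in> {0<..T} \<Longrightarrow> qt x t \<le> e * qxx x t - g x * qx x t"
    and A: "A \<ge> 0" and K: "K \<ge> 0" and S: "S \<le> T"
    and mass: "\<And>x s. s \<in> {0..S} \<Longrightarrow> integral {x-1/2..x+1/2} (\<lambda>y. q y s) \<le> K * exp (A * x\<^sup>2)"
    and init: "\<And>x. q x 0 = 0" and t: "t \<in> {0..S}"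
  shows "q x t = 0"
proof -
  define \<delta> where "\<delta> = 1 / (16 * e * (2 * A + 1) + 1)"
  have \<delta>: "\<delta> > 0" using e A by (simp add: \<delta>_def add_nonneg_pos)
  have "\<forall>t\<in>{0..S}. t \<le> real n * \<delta> \<longrightarrow> (\<forall>x. q x t = 0)" for n
  proof (induction n)
    case 0
    then show ?case using init by auto
  next
    case (Suc n)
    show ?case
    proof (intro ballI impI allI)
      fix t x assume t: "t \<in> {0..S}" "t \<le> real (Suc n) * \<delta>"
      show "q x t = 0"
      proof (cases "t \<le> real n * \<delta>")
        case True
        then show ?thesis using Suc t by auto
      next
        case False
        define s0 where "s0 = real n * \<delta>"
        have s0: "0 \<le> s0" "s0 \<le> t" "t - s0 \<le> \<delta>" "s0 \<in> {0..S}"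
          using False t \<delta> by (auto simp: s0_def algebra_simps)
        show ?thesis
        proof (rule vanish_step[OF q e g g' gG gL pos sub A K])
          show "integral {x-1/2..x+1/2} (\<lambda>y. q y s) \<le> K * exp (A * x\<^sup>2)" if "s \<in> {s0..t}" for x s
            using that mass t s0 by auto
          show "q x s0 = 0" for x using Suc s0 by (auto simp: s0_def)
        qed (use s0 t S in \<open>auto simp: \<delta>_def\<close>)
      qed
    qed
  qed
  moreover obtain n where "t < real n * \<delta>" using ex_less_of_nat_mult[OF \<delta>] by blast
  ultimately show ?thesis using t less_imp_le by blast
qed

text \<open>A convex \<open>C\<^sup>2\<close> substitute for the positive part, with linear growth: its second derivative is a hat function.\<close>

definition spline :: "real \<Rightarrow> real" where "spline s = pos3 s - 2 * pos3 (s - 1) + pos3 (s - 2)"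
definition spline1 :: "real \<Rightarrow> real" where
  "spline1 s = 3 * (max 0 s)^2 - 2 * (3 * (max 0 (s - 1))^2) + 3 * (max 0 (s - 2))^2"
definition spline2 :: "real \<Rightarrow> real" where
  "spline2 s = 6 * max 0 s - 2 * (6 * max 0 (s - 1)) + 6 * max 0 (s - 2)"

lemma spline_deriv: "(spline has_real_derivative spline1 s) (at s)"
proof -
  have 1: "((\<lambda>s. pos3 (s - c)) has_real_derivative 3 * (max 0 (s - c))^2) (at s)" for c
  proof -
    have "((\<lambda>s. s - c) has_real_derivative 1) (at s)" by (auto intro!: derivative_eq_intros)
    from DERIV_chain2[OF pos3_deriv this] show ?thesis by simp
  qed
  show ?thesis unfolding spline_def[abs_def] spline1_def
    using 1[of 0] by (auto intro!: derivative_eq_intros 1)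
qed

lemma spline1_deriv: "(spline1 has_real_derivative spline2 s) (at s)"
proof -
  have 1: "((\<lambda>s. 3 * (max 0 (s - c))^2) has_real_derivative 6 * max 0 (s - c)) (at s)" for c
  proof -
    have "((\<lambda>s. s - c) has_real_derivative 1) (at s)" by (auto intro!: derivative_eq_intros)
    from DERIV_chain2[OF pos3_deriv2 this] show ?thesis by simp
  qed
  show ?thesis unfolding spline1_def[abs_def] spline2_def
    using DERIV_add[OF DERIV_diff[OF 1[of 0] DERIV_cmult[OF 1[of 1], of 2]] 1[of 2]] by simp
qed

text \<open>All of this is integrated up from \<open>spline2 \<ge> 0\<close>: \<open>spline1\<close>
  increases from 0 to its final value 6, the area under the hat. The linear bound lets a mass bound
  for \<open>z\<close> pass to \<open>spline (z - K)\<close>, and strict positivity on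
  \<open>s > 0\<close> turns vanishing of the composition into \<open>z \<le> K\<close>.\<close>

lemma spline_props:
  "spline2 s \<ge> 0" "spline1 s \<ge> 0" "spline s \<ge> 0" "spline s \<le> 6 * max 0 s" "s \<le> 0 \<Longrightarrow> spline s = 0"
  "s > 0 \<Longrightarrow> spline s > 0"
proof -
  show s2: "spline2 s \<ge> 0" for s by (auto simp: spline2_def max_def)
  have s1: "spline1 s \<ge> 0" for s
  proof (cases "s \<le> 0")
    case True then show ?thesis by (simp add: spline1_def)
  next
    case False
    have "spline1 0 \<le> spline1 s"
      by (rule DERIV_nonneg_imp_nondecreasing) (use False spline1_deriv s2 in auto)
    then show ?thesis by (simp add: spline1_def)
  qed
  show "spline1 s \<ge> 0" by (rule s1)
  show z: "spline s = 0" if "s \<le> 0" for s using that by (simp add: spline_def pos3_def)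
  show p: "spline s > 0" if "s > 0" for s
  proof -
    define r where "r = min s 1"
    have "spline r \<le> spline s"
      by (rule DERIV_nonneg_imp_nondecreasing) (use spline_deriv s1 in \<open>auto simp: r_def\<close>)
    moreover have "spline r = r^3" "r > 0" using that by (auto simp: r_def spline_def pos3_def)
    ultimately show ?thesis using zero_less_power[of r 3] by linarith
  qed
  show "spline s \<ge> 0" using z[of s] p[of s] by linarith
  have s1b: "spline1 s \<le> 6" for s
  proof -
    have eq: "spline1 s = 6" if "s \<ge> 2" for s
      using that by (simp add: spline1_def power2_eq_square algebra_simps)
    have "spline1 s \<le> spline1 (max s 2)"
      by (rule DERIV_nonneg_imp_nondecreasing) (use spline1_deriv s2 in auto)
    then show ?thesis using eq[of "max s 2"] by simp
  qed
  show "spline s \<le> 6 * max 0 s"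
  proof (cases "s \<le> 0")
    case True then show ?thesis using z[of s] by simp
  next
    case False
    have "6 * 0 - spline 0 \<le> 6 * s - spline s"
      by (rule DERIV_nonneg_imp_nondecreasing[of 0 s "\<lambda>s. 6 * s - spline s"])
        (use False s1b in \<open>auto intro!: exI derivative_eq_intros spline_deriv\<close>)
    then show ?thesis using z[of 0] False by simp
  qed
qed

lemma spline2_continuous: "continuous_on UNIV spline2"
  unfolding spline2_def[abs_def] by (intro continuous_intros)

text \<open>The rate given by \<open>unit_mass_bound\<close> blows up towards \<open>T\<close>. The
  argument is therefore run on \<open>{0..s}\<close> for each \<open>s < T\<close> with the rate
  belonging to \<open>s\<close>, and time \<open>T\<close> itself is reached by continuity. The
  lower inequality for \<open>zt\<close> yields the mass bound, the upper one the
  comparison.\<close>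

lemma positive_solution_upper_bound:
  assumes z: "C21 T z zx zxx zt" and T: "T > 0" and e: "e > 0" and C: "C \<ge> 0"
    and g: "\<And>x. (g has_real_derivative g' x) (at x)" and g': "continuous_on UNIV g'"
    and gG: "\<And>x. \<bar>g x\<bar> \<le> G" and gL: "\<And>x. \<bar>g' x\<bar> \<le> Lg"
    and pos: "\<And>x t. t \<in> {0..T} \<Longrightarrow> z x t \<ge> 0"
    and sup: "\<And>x t. t \<in> {0<..T} \<Longrightarrow> zt x t \<ge> e * zxx x t - g x * zx x t - C * z x t"
    and sub: "\<And>x t. t \<in> {0<..T} \<Longrightarrow> zt x t \<le> e * zxx x t - g x * zx x t"
    and init: "\<And>x. z x 0 \<le> K" and t: "t \<in> {0..T}"
  shows "z x t \<le> K"
proof -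
  obtain M where M: "M \<ge> 0" "\<And>x s. s \<in> {0..<T} \<Longrightarrow>
      integral {x-1/2..x+1/2} (\<lambda>y. z y s) \<le> M * exp (x\<^sup>2 / (e * (T - s)))"
    using unit_mass_bound[OF z T e C g g' gG gL pos sup] by blast
  have K: "K \<ge> 0" using init[of 0] pos[of 0 0] T by auto
  have zK: "C21 T (\<lambda>x t. z x t - K) zx zxx zt"
    using C21_add[OF z C21_time[of "\<lambda>_. - K" "\<lambda>_. 0" T]] by simp
  note q = C21_compose[OF spline_deriv spline1_deriv spline2_continuous zK]
  have before: "z x s \<le> K" if s: "s \<in> {0..<T}" for x s
  proof -
    define A where "A = 1 / (e * (T - s))"
    have A: "A \<ge> 0" using e s by (simp add: A_def)
    have "spline (z x s - K) = 0"
    proof (rule vanish_of_gaussian_mass[OF q e g g' gG gL _ _ A, where K = "6 * M" and t = s and S = s])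
      fix x t assume t: "t \<in> {0<..T}"
      \<comment> \<open>Convexity enters here: the chain rule produces the extra term
        \<open>e * spline2 * zx^2\<close>, which is nonnegative and may be added on the
        right.\<close>
      have "spline1 (z x t - K) * zt x t \<le> spline1 (z x t - K) * (e * zxx x t - g x * zx x t)"
        using spline_props sub[OF t] by (intro mult_left_mono) auto
      also have "\<dots> \<le> spline1 (z x t - K) * (e * zxx x t - g x * zx x t) + e * (spline2 (z x t - K) * (zx x t)\<^sup>2)"
        using spline_props e by simp
      finally show "spline1 (z x t - K) * zt x t \<le> e * (spline2 (z x t - K) * (zx x t)\<^sup>2 + spline1 (z x t - K) * zxx x t)
          - g x * (spline1 (z x t - K) * zx x t)" by (simp add: algebra_simps)
    next
      fix x \<tau> assume \<tau>: "\<tau> \<in> {0..s}"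
      then have \<tau>T: "\<tau> \<in> {0..T}" "\<tau> \<in> {0..<T}" using s by auto
      have "integral {x-1/2..x+1/2} (\<lambda>y. spline (z y \<tau> - K)) \<le> integral {x-1/2..x+1/2} (\<lambda>y. 6 * z y \<tau>)"
      proof (rule integral_le)
        show "(\<lambda>y. spline (z y \<tau> - K)) integrable_on {x-1/2..x+1/2}"
          by (rule integrable_continuous_real) (rule C21_slice_continuous(1)[OF q \<tau>T(1)])
        show "(\<lambda>y. 6 * z y \<tau>) integrable_on {x-1/2..x+1/2}"
          by (intro integrable_continuous_real continuous_intros C21_slice_continuous(1)[OF z \<tau>T(1)])
        show "spline (z y \<tau> - K) \<le> 6 * z y \<tau>" for y
          using spline_props(4)[of "z y \<tau> - K"] pos[OF \<tau>T(1), of y] K by (simp add: max_def split: if_splits)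
      qed
      also have "\<dots> = 6 * integral {x-1/2..x+1/2} (\<lambda>y. z y \<tau>)" by simp
      also have "\<dots> \<le> 6 * (M * exp (x\<^sup>2 / (e * (T - \<tau>))))" using M(2)[OF \<tau>T(2), of x] by simp
      also have "\<dots> \<le> 6 * (M * exp (x\<^sup>2 / (e * (T - s))))"
        using M(1) \<tau> s e by (intro mult_left_mono) (auto intro!: divide_left_mono mult_left_mono)
      finally show "integral {x-1/2..x+1/2} (\<lambda>y. spline (z y \<tau> - K)) \<le> 6 * M * exp (A * x\<^sup>2)"
        by (simp add: A_def)
    qed (use s M spline_props init in auto)
    then show ?thesis using spline_props(6)[of "z x s - K"] by linarith
  qed
  show ?thesis
  proof (cases "t < T")
    case True then show ?thesis using before t by auto
  next
    case False
    then have "t = T" using t by auto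
    have "continuous (at T within {0..T}) (\<lambda>s. z x s)"
      using DERIV_continuous[OF C21D(3)[OF z]] T by auto
    then have "((\<lambda>s. z x s) \<longlongrightarrow> z x T) (at T within {0..T})" by (simp add: continuous_within)
    then have "((\<lambda>s. z x s) \<longlongrightarrow> z x T) (at_left T)" using at_within_Icc_at_left[OF T] by simp
    moreover have "\<forall>\<^sub>F s in at_left T. z x s \<le> K"
      using before T eventually_at_left_real[OF T] by (auto elim!: eventually_mono)
    ultimately show ?thesis using \<open>t = T\<close> by (intro tendsto_upperbound) auto
  qed
qed

text \<open>No growth condition is needed: since \<open>z \<ge> 0\<close>, adding
  \<open>\<delta> * exp (L * t) * (1 + x^2)\<close> lifts \<open>z\<close> above \<open>k\<close>
  outside a compact set. A value below \<open>k\<close> would then give a minimum at an interior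
  point and a positive time, contradicting the inequality for \<open>z\<close>.\<close>

lemma positive_supersolution_lower_bound:
  assumes z: "C21 T z zx zxx zt" and T: "T > 0" and e: "e > 0"
    and gG: "\<And>x. \<bar>g x\<bar> \<le> G"
    and pos: "\<And>x t. t \<in> {0..T} \<Longrightarrow> z x t \<ge> 0"
    and sup: "\<And>x t. t \<in> {0<..T} \<Longrightarrow> zt x t \<ge> e * zxx x t - g x * zx x t"
    and init: "\<And>x. z x 0 \<ge> k" and t: "t \<in> {0..T}"
  shows "z x t \<ge> k"
proof -
  \<comment> \<open>\<open>2 * e\<close> pays for the diffusion of the barrier, \<open>G\<close> for
    its drift by \<open>2 \<bar>x\<bar> \<le> 1 + x^2\<close>, and the last 1 makes the inequality
    strict.\<close>
  define L where "L = 2 * e + G + 1"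
  have G0: "G \<ge> 0" using gG[of 0] by linarith
  have L0: "L > 0" using e G0 by (simp add: L_def)
  have "z x t + \<delta> * (exp (L * t) * (1 + x\<^sup>2)) \<ge> k" if \<delta>: "\<delta> > 0" for \<delta>
  proof (rule ccontr)
    assume neg: "\<not> ?thesis"
    define p where "p x t = z x t + \<delta> * (exp (L * t) * (1 + x\<^sup>2))" for x t
    have b: "C21 T (\<lambda>x t. \<delta> * (exp (L * t) * (1 + x\<^sup>2))) (\<lambda>x t. \<delta> * (exp (L * t) * (2 * x)))
      (\<lambda>x t. \<delta> * (exp (L * t) * 2)) (\<lambda>x t. \<delta> * (L * exp (L * t) * (1 + x\<^sup>2)))"
      unfolding C21_def by (auto intro!: continuous_intros derivative_eq_intros)
    note p = C21_add[OF z b]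
    \<comment> \<open>Wide enough to contain the offending point \<open>x\<close> and to give
      \<open>\<delta> * (1 + y^2) \<ge> \<bar>k\<bar>\<close> outside.\<close>
    define X where "X = max \<bar>x\<bar> (\<bar>k\<bar> / \<delta> + 1)"
    have far: "p y s \<ge> k" if "\<bar>y\<bar> \<ge> X" "s \<in> {0..T}" for y s
    proof -
      have "\<bar>y\<bar> \<ge> 1" "\<bar>y\<bar> \<ge> \<bar>k\<bar> / \<delta>" using that \<delta> by (auto simp: X_def intro: order_trans[rotated])
      then have "\<bar>k\<bar> / \<delta> \<le> 1 + y\<^sup>2" 
      proof -
        have "\<bar>y\<bar> * 1 \<le> \<bar>y\<bar> * \<bar>y\<bar>" using \<open>\<bar>y\<bar> \<ge> 1\<close> by (intro mult_left_mono) auto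
        then show ?thesis using \<open>\<bar>y\<bar> \<ge> \<bar>k\<bar> / \<delta>\<close> by (simp add: power2_eq_square)
      qed
      also have "\<dots> \<le> exp (L * s) * (1 + y\<^sup>2)"
      proof -
        have "exp (L * s) \<ge> 1" using L0 that by simp
        from mult_right_mono[OF this, of "1 + y\<^sup>2"] show ?thesis by simp
      qed
      finally have "\<bar>k\<bar> \<le> \<delta> * (exp (L * s) * (1 + y\<^sup>2))" using \<delta> by (simp add: field_simps)
      then show ?thesis using pos[OF that(2), of y] by (simp add: p_def)
    qed
    have "compact ({-X..X} \<times> {0..T})" by (intro compact_Times) auto
    moreover have "continuous_on ({-X..X} \<times> {0..T}) (\<lambda>q. p (fst q) (snd q))"
      unfolding p_def by (rule continuous_on_subset[OF C21D(4)[OF p]]) auto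
    moreover have xt: "(x, t) \<in> {-X..X} \<times> {0..T}" using t by (auto simp: X_def)
    ultimately obtain q where q: "q \<in> {-X..X} \<times> {0..T}" 
      "\<And>r. r \<in> {-X..X} \<times> {0..T} \<Longrightarrow> p (fst q) (snd q) \<le> p (fst r) (snd r)"
      using continuous_attains_inf[of "{-X..X} \<times> {0..T}" "\<lambda>q. p (fst q) (snd q)"] by blast
    obtain x0 t0 where x0: "q = (x0, t0)" by (cases q)
    have mn: "p x0 t0 \<le> p y s" if "y \<in> {-X..X}" "s \<in> {0..T}" for y s
      using q(2)[of "(y, s)"] that x0 by simp
    have x0X: "\<bar>x0\<bar> \<le> X" and t0: "t0 \<in> {0..T}" using q(1) x0 by auto
    have "p x0 t0 \<le> p x t" using xt by (intro mn) auto
    also have "\<dots> < k" using neg by (simp add: p_def)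
    finally have less: "p x0 t0 < k" .
    have "t0 \<noteq> 0"
    proof
      assume "t0 = 0"
      then have "p x0 t0 \<ge> k" using init[of x0] \<delta> by (simp add: p_def add_increasing2)
      then show False using less by simp
    qed
    then have t0': "t0 \<in> {0<..T}" using t0 by auto
    have x0': "\<bar>x0\<bar> < X" using far[of x0 t0] less x0X t0 by fastforce
    have loc: "p x0 t0 \<le> p y t0" if "\<bar>y - x0\<bar> < X - \<bar>x0\<bar>" for y
      using that t0 by (intro mn) auto
    have "X - \<bar>x0\<bar> > 0" using x0' by simp
    note sd = second_derivative_nonneg_at_min[OF C21D(1)[OF p t0] C21D(2)[OF p t0] this loc[unfolded p_def]]
    have dx: "zx x0 t0 + \<delta> * (exp (L * t0) * (2 * x0)) = 0" 
      and dxx: "zxx x0 t0 + \<delta> * (exp (L * t0) * 2) \<ge> 0"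
      using sd by auto
    have dt: "zt x0 t0 + \<delta> * (L * exp (L * t0) * (1 + x0\<^sup>2)) \<le> 0"
      by (rule left_derivative_nonpos_at_min[OF C21D(3)[OF p t0] t0'])
        (use mn[of x0, unfolded p_def] x0X in \<open>simp add: abs_le_iff\<close>)
    define E where "E = \<delta> * exp (L * t0)"
    have E: "E > 0" using \<delta> by (simp add: E_def)
    have dx': "zx x0 t0 = - (E * 2 * x0)" using dx by (simp add: E_def)
    have "0 \<ge> e * zxx x0 t0 - g x0 * zx x0 t0 + E * L * (1 + x0\<^sup>2)"
    proof -
      have "\<delta> * (L * exp (L * t0) * (1 + x0\<^sup>2)) = E * L * (1 + x0\<^sup>2)" by (simp add: E_def mult_ac)
      then show ?thesis using sup[OF t0', of x0] dt by linarith
    qed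
    also have "e * zxx x0 t0 - g x0 * zx x0 t0 + E * L * (1 + x0\<^sup>2) \<ge>
        e * (- (E * 2)) + g x0 * (E * 2 * x0) + E * L * (1 + x0\<^sup>2)"
    proof -
      have "zxx x0 t0 \<ge> - (E * 2)" using dxx by (simp add: E_def)
      from mult_left_mono[OF this, of e] e show ?thesis by (simp add: dx')
    qed
    finally have 1: "E * (- 2 * e + 2 * x0 * g x0 + L * (1 + x0\<^sup>2)) \<le> 0" by (simp add: algebra_simps)
    have "\<bar>2 * x0 * g x0\<bar> \<le> (1 + x0\<^sup>2) * G"
    proof -
      have "2 * \<bar>x0\<bar> \<le> 1 + x0\<^sup>2" using sum_squares_bound[of 1 "\<bar>x0\<bar>"] by simp
      then show ?thesis unfolding abs_mult using gG[of x0] by (intro mult_mono) auto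
    qed
    then have 2: "- 2 * e + 2 * x0 * g x0 + L * (1 + x0\<^sup>2) \<ge> - 2 * e + (2 * e + 1) * (1 + x0\<^sup>2)"
      by (simp add: L_def algebra_simps)
    have 3: "- 2 * e + (2 * e + 1) * (1 + x0\<^sup>2) > 0" using e
      by (simp add: algebra_simps add_pos_nonneg)
    have "E * (- 2 * e + 2 * x0 * g x0 + L * (1 + x0\<^sup>2)) > 0"
      using 2 3 E by (intro mult_pos_pos) linarith+
    then show False using 1 by linarith
  qed
  then have "k \<le> z x t + \<delta>" if "\<delta> > 0" for \<delta>
  proof -
    define W where "W = exp (L * t) * (1 + x\<^sup>2)"
    have "W > 0" unfolding W_def by (intro mult_pos_pos add_pos_nonneg) auto
    then show ?thesis using \<open>\<And>\<delta>. \<delta> > 0 \<Longrightarrow> z x t + \<delta> * (exp (L * t) * (1 + x\<^sup>2)) \<ge> k\<close>[of "\<delta> / W"] that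
      by (simp add: W_def[symmetric])
  qed
  then show ?thesis by (rule field_le_epsilon)
qed

section \<open>Estimates for the Hamilton-Jacobi equation\<close>

text \<open>The factor \<open>exp (\<beta> * t)\<close> changes the potential
  \<open>- V/\<epsilon>\<close> into \<open>\<beta> - V/\<epsilon>\<close>, which has a sign for
  \<open>\<beta> = - m/\<epsilon>\<close> and for \<open>\<beta> = m/\<epsilon>\<close>. All
  exponents are multiples of \<open>1/\<epsilon>\<close>, so \<open>\<epsilon>\<close> cancels when
  logarithms are taken. An upper bound for \<open>v\<close> is a lower bound for \<open>w\<close>,
  and conversely.\<close>

lemma hamilton_jacobi_global_bound:
  assumes w: "C21 T w wx wxx wt" and T: "T > 0" and eps: "\<epsilon> > 0"
    and pde: "\<And>x t. t \<in> {0<..T} \<Longrightarrow>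
      wt x t + ((1/2) * (wx x t)\<^sup>2 + wx x t * g x - V x t) = (\<epsilon>/2) * wxx x t"
    and g: "\<And>x. (g has_real_derivative g' x) (at x)" and g': "continuous_on UNIV g'"
    and gG: "\<And>x. \<bar>g x\<bar> \<le> G" and gL: "\<And>x. \<bar>g' x\<bar> \<le> Lg"
    and V: "\<And>x t. t \<in> {0..T} \<Longrightarrow> \<bar>V x t\<bar> \<le> m"
    and init: "\<And>x. \<bar>w x 0\<bar> \<le> W0" and t: "t \<in> {0..T}"
  shows "\<bar>w x t\<bar> \<le> W0 + m * t"
proof -
  have m: "m \<ge> 0" using V[of 0 0] T by auto
  define v where "v x t = exp (- w x t / \<epsilon>)" for x t
  have d: "((\<lambda>s. exp (- s / \<epsilon>)) has_real_derivative - (1/\<epsilon>) * exp (- s / \<epsilon>)) (at s)" for s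
    using eps by (auto intro!: derivative_eq_intros simp: field_simps)
  have d2: "((\<lambda>s. - (1/\<epsilon>) * exp (- s / \<epsilon>)) has_real_derivative (1/\<epsilon>)\<^sup>2 * exp (- s / \<epsilon>)) (at s)" for s
    using DERIV_cmult[OF d, of "- (1/\<epsilon>)" s] by (simp add: power2_eq_square)
  have c2: "continuous_on UNIV (\<lambda>s. (1/\<epsilon>)\<^sup>2 * exp (- s / \<epsilon>))" using eps by (intro continuous_intros) auto
  note v = C21_compose[OF d d2 c2 w, folded v_def]
  have expC: "C21 T (\<lambda>x t. exp (\<beta> * t)) (\<lambda>x t. 0) (\<lambda>x t. 0) (\<lambda>x t. \<beta> * exp (\<beta> * t))" for \<beta>
    by (rule C21_time) (auto intro!: derivative_eq_intros continuous_intros)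
  define zx where "zx \<beta> x t = exp (\<beta> * t) * (- (1/\<epsilon>) * v x t * wx x t)" for \<beta> x t
  define zxx where "zxx \<beta> x t = exp (\<beta> * t) * ((1/\<epsilon>)\<^sup>2 * v x t * (wx x t)\<^sup>2 + - (1/\<epsilon>) * v x t * wxx x t)" for \<beta> x t
  define zt where "zt \<beta> x t = \<beta> * exp (\<beta> * t) * v x t + exp (\<beta> * t) * (- (1/\<epsilon>) * v x t * wt x t)" for \<beta> x t
  have z: "C21 T (\<lambda>x t. exp (\<beta> * t) * v x t) (zx \<beta>) (zxx \<beta>) (zt \<beta>)" for \<beta>
    using C21_mult[OF expC[of \<beta>] v] unfolding zx_def zxx_def zt_def by simp
  have eq: "zt \<beta> x t = (\<epsilon>/2) * zxx \<beta> x t - g x * zx \<beta> x t + (exp (\<beta> * t) * v x t) * (\<beta> - V x t / \<epsilon>)"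
    if "t \<in> {0<..T}" for \<beta> x t
  proof -
    have 1: "wt x t = (\<epsilon>/2) * wxx x t - ((1/2) * (wx x t)\<^sup>2 + wx x t * g x - V x t)"
      using pde[OF that, of x] by linarith
    show ?thesis unfolding zt_def zxx_def zx_def 1 using eps
      by (simp add: field_simps power2_eq_square)
  qed
  have vpos: "exp (\<beta> * t) * v x t > 0" for \<beta> x t by (simp add: v_def)
  have Vm: "- (m/\<epsilon>) \<le> V x t / \<epsilon>" "V x t / \<epsilon> \<le> m/\<epsilon>" if "t \<in> {0<..T}" for x t
  proof -
    have "- m \<le> V x t" "V x t \<le> m" using V[of t x] that by auto
    then show "- (m/\<epsilon>) \<le> V x t / \<epsilon>" "V x t / \<epsilon> \<le> m/\<epsilon>"
      using eps divide_right_mono[of "-m" "V x t" \<epsilon>] divide_right_mono[of "V x t" m \<epsilon>] by auto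
  qed
  \<comment> \<open>\<open>C\<close> is twice \<open>m/\<epsilon>\<close> because
    \<open>\<beta> - V/\<epsilon>\<close> may be as low as
    \<open>- 2 * (m/\<epsilon>)\<close>.\<close>
  have up: "exp (- (m/\<epsilon>) * t) * v x t \<le> exp (W0/\<epsilon>)"
  proof (rule positive_solution_upper_bound[OF z T _ _ g g' gG gL, where e = "\<epsilon>/2" and C = "2 * (m/\<epsilon>)"])
    fix x t assume t: "t \<in> {0<..T}"
    have "(exp (- (m/\<epsilon>) * t) * v x t) * (- (m/\<epsilon>) - V x t / \<epsilon>) \<le> 0"
      using vpos Vm[OF t, of x] by (intro mult_nonneg_nonpos less_imp_le[OF vpos]) auto
    then show "zt (- (m/\<epsilon>)) x t \<le> (\<epsilon>/2) * zxx (- (m/\<epsilon>)) x t - g x * zx (- (m/\<epsilon>)) x t"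
      unfolding eq[OF t] by linarith
    have "(exp (- (m/\<epsilon>) * t) * v x t) * (- (2 * (m/\<epsilon>))) \<le> (exp (- (m/\<epsilon>) * t) * v x t) * (- (m/\<epsilon>) - V x t / \<epsilon>)"
      using Vm[OF t, of x] by (intro mult_left_mono less_imp_le[OF vpos]) auto
    then show "(\<epsilon>/2) * zxx (- (m/\<epsilon>)) x t - g x * zx (- (m/\<epsilon>)) x t - 2 * (m/\<epsilon>) * (exp (- (m/\<epsilon>) * t) * v x t)
        \<le> zt (- (m/\<epsilon>)) x t"
      unfolding eq[OF t] by (simp only: mult.commute mult_minus_left mult_minus_right)
  next
    fix x
    have "- w x 0 \<le> W0" using init[of x] by linarith
    then show "exp (- (m/\<epsilon>) * 0) * v x 0 \<le> exp (W0/\<epsilon>)"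
      using eps divide_right_mono[of "- w x 0" W0 \<epsilon>] by (simp add: v_def)
  qed (use eps m t in \<open>auto simp: v_def\<close>)
  have low: "exp ((m/\<epsilon>) * t) * v x t \<ge> exp (- W0/\<epsilon>)"
  proof (rule positive_supersolution_lower_bound[OF z T _ gG, where e = "\<epsilon>/2"])
    fix x t assume t: "t \<in> {0<..T}"
    have "(exp ((m/\<epsilon>) * t) * v x t) * ((m/\<epsilon>) - V x t / \<epsilon>) \<ge> 0"
      using Vm[OF t, of x] by (intro mult_nonneg_nonneg less_imp_le[OF vpos]) auto
    then show "zt (m/\<epsilon>) x t \<ge> (\<epsilon>/2) * zxx (m/\<epsilon>) x t - g x * zx (m/\<epsilon>) x t"
      unfolding eq[OF t] by linarith
  next
    fix x
    have "- W0 \<le> - w x 0" using init[of x] by linarith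
    then show "exp (- W0/\<epsilon>) \<le> exp ((m/\<epsilon>) * 0) * v x 0"
      using eps divide_right_mono[of "- W0" "- w x 0" \<epsilon>] by (simp add: v_def)
  qed (use eps m t in \<open>auto simp: v_def\<close>)
  have "(- (m/\<epsilon>)) * t + - w x t / \<epsilon> \<le> W0 / \<epsilon>" using up by (simp add: v_def exp_add[symmetric])
  then have "(- w x t - m * t) / \<epsilon> \<le> W0 / \<epsilon>" by (simp add: diff_divide_distrib)
  then have 1: "- w x t - m * t \<le> W0" using eps by (simp add: divide_le_cancel)
  have "(m/\<epsilon>) * t + - w x t / \<epsilon> \<ge> - W0 / \<epsilon>" using low by (simp add: v_def exp_add[symmetric])
  then have "(- W0) / \<epsilon> \<le> (m * t - w x t) / \<epsilon>" by (simp add: diff_divide_distrib)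
  then have "- W0 \<le> m * t - w x t" using iffD1[OF divide_le_cancel] eps by blast
  with 1 show ?thesis by linarith
qed

text \<open>The pointwise inequality at a maximum of \<open>\<zeta> * D\<close>, multiplied by \<open>\<zeta>\<^sup>3\<close> so that it becomes
a cubic inequality for \<open>\<zeta> * d\<close>. Here \<open>A\<close> and \<open>B\<close> are \<open>u\<^sub>x\<close> at the two ends of the difference quotient.\<close>

lemma gradient_algebra:
  fixes \<zeta> zx zxx d dx dxx A B e \<kappa> u u' g G sa Lg V M sb S E :: real
  assumes \<zeta>: "0 < \<zeta>" "\<zeta> \<le> 1" "\<bar>zx\<bar> \<le> 1" "\<bar>zxx\<bar> \<le> 1" and d: "d \<ge> 2" "\<zeta> * d \<ge> 1"
    and A: "d - 1 \<le> \<bar>A\<bar>" "\<bar>A\<bar> \<le> d + 1" "\<bar>B\<bar> \<le> d + 1"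
    and e: "0 < e" "e \<le> 1/2" and \<kappa>: "1/2 \<le> \<kappa>" "\<kappa> \<le> 1"
    and u: "0 < u" "u \<le> E" "0 < u'" "u' \<le> E" "1 / u' \<le> E"
    and g: "\<bar>g\<bar> \<le> G" and sa: "\<bar>sa\<bar> \<le> Lg * \<bar>A\<bar>" and Lg: "Lg \<ge> 0" and V: "\<bar>V\<bar> \<le> M" and sb: "\<bar>sb\<bar> \<le> S"
    and eq1: "zx * d + \<zeta> * dx = 0" and ineq: "zxx * d + 2 * zx * dx + \<zeta> * dxx \<le> 0"
    and eqt: "0 \<le> e * dxx + \<kappa> * ((A + B) * dx / u' - A\<^sup>2 * d / (u * u')) - g * dx - sa - V * d / 2 - sb / 2"
  shows "\<zeta> * d \<le> 8 * E\<^sup>2 * (3 * E + 3/2 + G + 3/2 * Lg + M/2 + S/2)"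
proof -
  define X where "X = \<zeta> * d"
  have X: "X \<ge> 1" using d by (simp add: X_def)
  have E: "E > 0" using u by linarith
  have G0: "G \<ge> 0" "M \<ge> 0" "S \<ge> 0" using g V sb by linarith+
  \<comment> \<open>The first-order condition replaces each \<open>\<zeta> * dx\<close> by
    \<open>- zx * d\<close>; a factor \<open>\<zeta>\<close> is spent on every occurrence of
    \<open>dx\<close>.\<close>
  have \<zeta>dx: "\<zeta> * dx = - zx * d" using eq1 by linarith
  have z2: "0 \<le> \<zeta>\<^sup>2" "\<zeta>\<^sup>2 \<le> 1" and z3: "0 < \<zeta>^3" "\<zeta>^3 \<le> \<zeta>" using \<zeta> 
    by (auto simp: power_le_one power3_eq_cube mult_le_one mult_left_le)
  have t1: "\<zeta>^3 * (e * dxx) \<le> 3/2 * X"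
  proof -
    have "\<zeta>^3 * (e * dxx) = e * \<zeta>\<^sup>2 * (\<zeta> * dxx)" by (simp add: power2_eq_square power3_eq_cube)
    also have "\<dots> \<le> e * \<zeta>\<^sup>2 * (- zxx * d - 2 * zx * dx)" using ineq e by (intro mult_left_mono) auto
    also have "\<dots> = e * (\<zeta> * (- zxx) * X - 2 * zx * \<zeta> * (\<zeta> * dx))"
      by (simp add: X_def power2_eq_square algebra_simps)
    also have "\<dots> = e * (\<zeta> * (- zxx) * X + 2 * zx\<^sup>2 * X)"
      unfolding \<zeta>dx by (simp add: X_def power2_eq_square algebra_simps)
    also have "\<dots> \<le> e * (1 * X + 2 * 1 * X)"
    proof -
      have "\<bar>\<zeta> * (- zxx)\<bar> \<le> 1 * 1" unfolding abs_mult using \<zeta> by (intro mult_mono) auto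
      then have "\<zeta> * (- zxx) \<le> 1" by linarith
      moreover have "zx\<^sup>2 \<le> 1" using \<zeta>(3) by (simp add: abs_square_le_1)
      ultimately show ?thesis using X e by (intro mult_left_mono add_mono mult_right_mono) auto
    qed
    also have "\<dots> \<le> 1/2 * (1 * X + 2 * 1 * X)" using e X by (intro mult_right_mono) auto
    finally show ?thesis by simp
  qed
  have t2: "\<zeta>^3 * (\<kappa> * ((A + B) * dx / u')) \<le> 3 * E * X\<^sup>2"
  proof -
    have "\<zeta>^3 * (\<kappa> * ((A + B) * dx / u')) = \<kappa> * (A + B) * (1/u') * \<zeta>\<^sup>2 * (\<zeta> * dx)"
      by (simp add: power2_eq_square power3_eq_cube)
    also have "\<dots> \<le> \<bar>\<kappa> * (A + B) * (1/u') * \<zeta>\<^sup>2 * (\<zeta> * dx)\<bar>" by (rule abs_ge_self)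
    also have "\<dots> = \<kappa> * \<bar>A + B\<bar> * (1/u') * \<zeta>\<^sup>2 * (\<bar>zx\<bar> * d)"
      unfolding \<zeta>dx using u \<kappa> d by (simp add: abs_mult)
    also have "\<dots> \<le> 1 * (3 * d) * E * \<zeta>\<^sup>2 * (1 * d)"
      using \<kappa> A d u \<zeta> E by (intro mult_mono) auto
    also have "\<dots> = 3 * E * X\<^sup>2" by (simp add: X_def power2_eq_square)
    finally show ?thesis .
  qed
  have t3: "\<zeta>^3 * (\<kappa> * (A\<^sup>2 * d / (u * u'))) \<ge> X^3 / (8 * E\<^sup>2)"
  proof -
    \<comment> \<open>The damping term: \<open>\<kappa> \<ge> 1/2\<close>,
      \<open>\<bar>A\<bar> \<ge> d/2\<close> and \<open>u * u' \<le> E^2\<close> together give the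
      factor \<open>1/8\<close>.\<close>
    have "(d/2)\<^sup>2 \<le> \<bar>A\<bar>\<^sup>2" using A d by (intro power_mono) auto
    then have A2: "(d/2)\<^sup>2 \<le> A\<^sup>2" by simp
    have "u * u' \<le> E * E" using u by (intro mult_mono) auto
    then have "1 / (E * E) \<le> 1 / (u * u')" using u by (intro divide_left_mono) auto
    then have "\<zeta>^3 * (1/2 * ((d/2)\<^sup>2 * d * (1 / (E * E)))) \<le> \<zeta>^3 * (\<kappa> * (A\<^sup>2 * d * (1 / (u * u'))))"
      using \<kappa> A2 d E z3 by (intro mult_left_mono mult_mono) auto
    then show ?thesis by (simp add: X_def power2_eq_square power3_eq_cube mult_ac)
  qed
  have t4: "\<zeta>^3 * (- (g * dx)) \<le> G * X"
  proof -
    have "\<zeta>^3 * (- (g * dx)) = - g * \<zeta>\<^sup>2 * (\<zeta> * dx)" by (simp add: power2_eq_square power3_eq_cube)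
    also have "\<dots> = g * zx * \<zeta> * X" unfolding \<zeta>dx by (simp add: X_def power2_eq_square)
    also have "\<dots> \<le> \<bar>g * zx * \<zeta> * X\<bar>" by simp
    also have "\<dots> = \<bar>g\<bar> * \<bar>zx\<bar> * \<zeta> * X" using \<zeta> X by (simp add: abs_mult)
    also have "\<dots> \<le> G * 1 * 1 * X" using g \<zeta> X G0 by (intro mult_mono) auto
    finally show ?thesis by simp
  qed
  have z3d: "\<zeta>^3 * d \<le> X" using z3 d by (simp add: X_def mult_right_mono)
  have t5: "\<zeta>^3 * (- sa) \<le> 3/2 * Lg * X"
  proof -
    have "\<zeta>^3 * (- sa) \<le> \<zeta>^3 * (Lg * (3/2 * d))"
    proof (intro mult_left_mono)
      have "Lg * \<bar>A\<bar> \<le> Lg * (3/2 * d)" using A d Lg by (intro mult_left_mono) auto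
      then show "- sa \<le> Lg * (3/2 * d)" using sa by linarith
    qed (use z3 in auto)
    also have "\<dots> = 3/2 * Lg * (\<zeta>^3 * d)" by simp
    also have "\<dots> \<le> 3/2 * Lg * X" using z3d Lg by (intro mult_left_mono) auto
    finally show ?thesis .
  qed
  have t6: "\<zeta>^3 * (- (V * d / 2)) \<le> M/2 * X"
  proof -
    have "\<zeta>^3 * (- (V * d / 2)) = (- V / 2) * (\<zeta>^3 * d)" by simp
    also have "\<dots> \<le> (M/2) * X" using V z3d z3 d G0 by (intro mult_mono) auto
    finally show ?thesis .
  qed
  have t7: "\<zeta>^3 * (- (sb / 2)) \<le> S/2 * X"
  proof -
    have "\<zeta>^3 * (- (sb / 2)) \<le> 1 * (S/2)" using sb z3 \<zeta> G0 
      by (intro order_trans[OF mult_left_mono[of "- (sb/2)" "S/2"] mult_right_mono]) auto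
    also have "\<dots> \<le> S/2 * X" using X G0 by (simp add: mult_le_cancel_left1)
    finally show ?thesis .
  qed
  define c where "c = 3/2 + G + 3/2 * Lg + M/2 + S/2"
  have c: "c \<ge> 0" using G0 Lg by (simp add: c_def)
  have "0 \<le> \<zeta>^3 * (e * dxx + \<kappa> * ((A + B) * dx / u' - A\<^sup>2 * d / (u * u')) - g * dx - sa - V * d / 2 - sb / 2)"
    using eqt z3 by (intro mult_nonneg_nonneg) auto
  also have "\<dots> = \<zeta>^3 * (e * dxx) + \<zeta>^3 * (\<kappa> * ((A + B) * dx / u')) - \<zeta>^3 * (\<kappa> * (A\<^sup>2 * d / (u * u')))
      + \<zeta>^3 * (- (g * dx)) + \<zeta>^3 * (- sa) + \<zeta>^3 * (- (V * d / 2)) + \<zeta>^3 * (- (sb / 2))"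
    by (simp only: right_diff_distrib distrib_left mult_minus_right diff_conv_add_uminus)
  finally have "X^3 / (8 * E\<^sup>2) \<le> 3 * E * X\<^sup>2 + c * X"
    using t1 t2 t3 t4 t5 t6 t7 by (simp add: c_def algebra_simps)
  \<comment> \<open>\<open>X \<ge> 1\<close> puts the lower-order terms under the quadratic one,
    after which \<open>X^2\<close> cancels.\<close>
  also have "c * X \<le> c * X\<^sup>2" using X c by (intro mult_left_mono) (auto simp: power2_eq_square)
  finally have "X^3 / (8 * E\<^sup>2) \<le> (3 * E + c) * X\<^sup>2" by (simp add: algebra_simps)
  then have "X * X\<^sup>2 \<le> (8 * E\<^sup>2 * (3 * E + c)) * X\<^sup>2" using E by (simp add: field_simps power3_eq_cube power2_eq_square)
  then have "X \<le> 8 * E\<^sup>2 * (3 * E + c)" using X by (simp add: mult_le_cancel_right)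
  then show ?thesis by (simp add: X_def c_def algebra_simps)
qed

text \<open>\<open>E\<close> bounds both \<open>u\<close> and \<open>1/u\<close>. The summand 2
  forces \<open>d \<ge> 2\<close>, \<open>L * E\<close> rules out a maximum at time 0, and the rest
  is the bound of \<open>gradient_algebra\<close> with \<open>S = E * LV\<close>.\<close>

definition gradconst :: "real \<Rightarrow> real \<Rightarrow> real \<Rightarrow> real \<Rightarrow> real \<Rightarrow> real \<Rightarrow> real" where
  "gradconst K0 G Lg M LV L = (let E = exp (K0/2) in
     2 + L * E + 8 * E\<^sup>2 * (3 * E + 3/2 + G + 3/2 * Lg + M/2 + E * LV / 2))"

text \<open>A discrete product rule: \<open>u'\<close>, \<open>b\<close>, \<open>g\<close>,
  \<open>V\<close> live at the shifted point and \<open>v\<close>, \<open>a\<close>,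
  \<open>h\<close>, \<open>W\<close> at the original one. The difference of \<open>b^2/u'\<close>
  and \<open>a^2/v\<close> splits into a transport term and the discrete damping
  \<open>- a^2 D / (v u')\<close>, where \<open>D\<close> is the quotient of
  \<open>u\<close>.\<close>

lemma difference_quotient_identity:
  fixes e b2 k b u' g V a2 a v h W r :: real
  assumes "u' \<noteq> 0" "v \<noteq> 0" "r \<noteq> 0"
  shows "((e * b2 + k * (b\<^sup>2 / u') - g * b - V * u' / 2) - (e * a2 + k * (a\<^sup>2 / v) - h * a - W * v / 2)) / r
       = e * ((b2 - a2) / r) + k * ((a + b) * ((b - a) / r) / u' - a\<^sup>2 * ((u' - v) / r) / (v * u'))
         - g * ((b - a) / r) - a * ((g - h) / r) - V * ((u' - v) / r) / 2 - v * ((V - W) / r) / 2"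
proof -
  have 1: "(a + b) * ((b - a) / r) / u' = (b\<^sup>2 / u' - a\<^sup>2 / u') / r"
    using assms by (simp add: field_simps power2_eq_square)
  have 2: "a\<^sup>2 * ((u' - v) / r) / (v * u') = (a\<^sup>2 / v - a\<^sup>2 / u') / r"
    using assms by (simp add: field_simps)
  have 3: "(e * b2 + k * p - g * b - V * u' * m - (e * a2 + k * q - h * a - W * v * m)) * i
    = e * ((b2 - a2) * i) + k * ((p - c) * i - (q - c) * i) - g * ((b - a) * i) - a * ((g - h) * i)
      - V * ((u' - v) * i) * m - v * ((V - W) * i) * m" for p q c i m
    by (simp add: algebra_simps)
  show ?thesis unfolding 1 2 using 3[of "b\<^sup>2 / u'" "1 / 2" "a\<^sup>2 / v" "1 / r" "a\<^sup>2 / u'"] by simp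
qed

text \<open>The difference quotient \<open>D\<close> is of class \<open>C21\<close>, while
  \<open>ux\<close> need not be. Its step \<open>\<eta>\<close> comes from uniform continuity of
  \<open>ux\<close> and depends on the solution, but it only keeps \<open>D\<close> close to
  \<open>ux\<close> and does not enter the bound.\<close>

lemma local_gradient_bound_transformed:
  assumes w: "C21 T w wx wxx wt" and eps: "0 < \<epsilon>" "\<epsilon> < 1"
    and pde: "\<And>x t. t \<in> {0<..T} \<Longrightarrow>
      wt x t + ((1/2) * (wx x t)\<^sup>2 + wx x t * g x - V x t) = (\<epsilon>/2) * wxx x t"
    and gG: "\<And>x. \<bar>g x\<bar> \<le> G" and gL: "\<And>x y. \<bar>g x - g y\<bar> \<le> Lg * \<bar>x - y\<bar>"
    and V: "\<And>x t. t \<in> {0..T} \<Longrightarrow> \<bar>V x t\<bar> \<le> M"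
    and VL: "\<And>x y t. t \<in> {0..T} \<Longrightarrow> \<bar>x\<bar> \<le> \<rho> + 1 \<Longrightarrow> \<bar>y\<bar> \<le> \<rho> + 1 \<Longrightarrow> \<bar>V x t - V y t\<bar> \<le> LV * \<bar>x - y\<bar>"
    and wK: "\<And>x t. t \<in> {0..T} \<Longrightarrow> \<bar>w x t\<bar> \<le> K0"
    and init: "\<And>x. \<bar>wx x 0\<bar> \<le> L" and \<rho>: "\<rho> \<ge> 2" and \<sigma>: "\<bar>\<sigma>\<bar> = (1::real)"
    and x: "\<bar>x\<bar> \<le> \<rho>" and t: "t \<in> {0..T}"
  shows "\<sigma> * (1 - x\<^sup>2 / \<rho>\<^sup>2) * (- (1/2) * exp (- w x t / 2) * wx x t) \<le> gradconst K0 G Lg M LV L"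
proof (rule ccontr)
  define E where "E = exp (K0/2)"
  have T0: "T \<ge> 0" "0 \<in> {0..T}" using t by auto
  have K0: "K0 \<ge> 0" using wK[of 0 0] T0 by auto
  have E1: "E \<ge> 1" using K0 by (simp add: E_def)
  define Kc where "Kc = gradconst K0 G Lg M LV L"
  have L0: "L \<ge> 0" using init[of 0] by linarith
  have G0: "G \<ge> 0" using gG[of 0] by linarith
  have Lg0: "Lg \<ge> 0" using gL[of 0 1] by auto
  have M0: "M \<ge> 0" using V[OF T0(2), of 0] by linarith
  have LV0: "LV \<ge> 0" using VL[OF T0(2), of 0 1] \<rho> by auto
  have Kc: "Kc = 2 + L * E + 8 * E\<^sup>2 * (3 * E + 3/2 + G + 3/2 * Lg + M/2 + E * LV / 2)"
    by (simp add: Kc_def gradconst_def E_def Let_def)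
  have Kc2: "Kc \<ge> 2" "Kc > L * E" "Kc > 8 * E\<^sup>2 * (3 * E + 3/2 + G + 3/2 * Lg + M/2 + E * LV / 2)"
  proof -
    have "8 * E\<^sup>2 * (3 * E + 3/2 + G + 3/2 * Lg + M/2 + E * LV / 2) \<ge> 0" "L * E \<ge> 0"
      using E1 L0 G0 Lg0 M0 LV0 by simp_all
    then show "Kc \<ge> 2" "Kc > L * E" "Kc > 8 * E\<^sup>2 * (3 * E + 3/2 + G + 3/2 * Lg + M/2 + E * LV / 2)"
      unfolding Kc by linarith+
  qed
  define u where "u x t = exp (- w x t / 2)" for x t
  define ux where "ux x t = - (1/2) * u x t * wx x t" for x t
  define uxx where "uxx x t = (1/2)\<^sup>2 * u x t * (wx x t)\<^sup>2 + - (1/2) * u x t * wxx x t" for x t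
  define ut where "ut x t = - (1/2) * u x t * wt x t" for x t
  have d: "((\<lambda>s. exp (- s / 2)) has_real_derivative - (1/2) * exp (- s / 2)) (at s)" for s :: real
    by (auto intro!: derivative_eq_intros simp: field_simps)
  have d2: "((\<lambda>s. - (1/2) * exp (- s / 2)) has_real_derivative (1/2)\<^sup>2 * exp (- s / 2)) (at s)" for s :: real
    using DERIV_cmult[OF d, of "- (1/2)" s] by (simp add: power2_eq_square)
  have c2: "continuous_on UNIV (\<lambda>s::real. (1/2)\<^sup>2 * exp (- s / 2))" by (intro continuous_intros) auto
  have u: "C21 T u ux uxx ut"
    using C21_compose[OF d d2 c2 w] unfolding u_def ux_def uxx_def ut_def .
  have ub: "0 < u x t" "u x t \<le> E" "1 / u x t \<le> E" if "t \<in> {0..T}" for x t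
  proof -
    show "0 < u x t" by (simp add: u_def)
    show "u x t \<le> E" using wK[OF that, of x] by (simp add: u_def E_def)
    have "1 / u x t = exp (w x t / 2)" by (simp add: u_def exp_minus field_simps)
    then show "1 / u x t \<le> E" using wK[OF that, of x] by (simp add: E_def)
  qed
  define \<kappa> where "\<kappa> = 1 - \<epsilon>/2"
  have ueq: "ut x t = (\<epsilon>/2) * uxx x t + \<kappa> * ((ux x t)\<^sup>2 / u x t) - g x * ux x t - V x t * u x t / 2"
    if "t \<in> {0<..T}" for x t
  proof -
    have 1: "wt x t = (\<epsilon>/2) * wxx x t - ((1/2) * (wx x t)\<^sup>2 + wx x t * g x - V x t)"
      using pde[OF that, of x] by linarith
    have "(ux x t)\<^sup>2 / u x t = (1/4) * u x t * (wx x t)\<^sup>2"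
      by (simp add: ux_def u_def power2_eq_square field_simps)
    then show ?thesis unfolding ut_def uxx_def \<kappa>_def ux_def 1
      by (simp add: field_simps power2_eq_square)
  qed
  \<comment> \<open>It vanishes at distance \<open>\<rho>\<close> from 0, which keeps a positive
    maximum of the product in the interior, and \<open>\<rho> \<ge> 2\<close> makes its first two
    derivatives at most 1 in modulus.\<close>
  define \<zeta> where "\<zeta> x = 1 - x\<^sup>2 / \<rho>\<^sup>2" for x
  define xs ts where "xs = x" and "ts = t"
  assume "\<not> ?thesis"
  then have contra: "\<sigma> * \<zeta> xs * ux xs ts > Kc" by (simp add: \<zeta>_def ux_def u_def Kc_def xs_def ts_def)
  \<comment> \<open>At most the excess over \<open>Kc\<close>, so that \<open>D\<close> in place of
    \<open>ux\<close> still violates the bound; at most 1, so that \<open>ux\<close> at both ends of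
    the quotient is within 1 of \<open>D\<close>.\<close>
  define gap where "gap = min 1 (\<sigma> * \<zeta> xs * ux xs ts - Kc)"
  have gap: "0 < gap" "gap \<le> 1" using contra by (auto simp: gap_def)
  have \<zeta>01: "0 \<le> \<zeta> x" "\<zeta> x \<le> 1" if "\<bar>x\<bar> \<le> \<rho>" for x
  proof -
    have "x\<^sup>2 \<le> \<rho>\<^sup>2" using power_mono[OF that, of 2] by simp
    then show "0 \<le> \<zeta> x" "\<zeta> x \<le> 1" using \<rho> by (auto simp: \<zeta>_def)
  qed
  have "compact ({-\<rho>..\<rho>+1} \<times> {0..T})" by (intro compact_Times) auto
  moreover have "continuous_on ({-\<rho>..\<rho>+1} \<times> {0..T}) (\<lambda>p. ux (fst p) (snd p))"
    by (rule continuous_on_subset[OF C21D(5)[OF u]]) auto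
  ultimately have "uniformly_continuous_on ({-\<rho>..\<rho>+1} \<times> {0..T}) (\<lambda>p. ux (fst p) (snd p))"
    by (rule compact_uniformly_continuous[rotated])
  then obtain \<delta> where \<delta>: "\<delta> > 0" "\<And>p q. p \<in> {-\<rho>..\<rho>+1} \<times> {0..T} \<Longrightarrow> q \<in> {-\<rho>..\<rho>+1} \<times> {0..T} \<Longrightarrow>
      dist q p < \<delta> \<Longrightarrow> dist (ux (fst q) (snd q)) (ux (fst p) (snd p)) < gap"
    unfolding uniformly_continuous_on_def using gap(1) by meson
  have uc: "\<bar>ux x t - ux y t\<bar> < gap" if "x \<in> {-\<rho>..\<rho>+1}" "y \<in> {-\<rho>..\<rho>+1}" "t \<in> {0..T}" "\<bar>x - y\<bar> < \<delta>" for x y t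
    using \<delta>(2)[of "(y, t)" "(x, t)"] that by (auto simp: dist_Pair_Pair dist_real_def)
  \<comment> \<open>At most 1, so that the shifted point stays in the region where \<open>ux\<close>
    is uniformly continuous and \<open>VL\<close> applies.\<close>
  define \<eta> where "\<eta> = min 1 (\<delta>/2)"
  have \<eta>: "0 < \<eta>" "\<eta> \<le> 1" "\<eta> < \<delta>" using \<delta>(1) by (auto simp: \<eta>_def)
  define D where "D x t = (u (x + \<eta>) t - u x t) / \<eta>" for x t
  define Dx where "Dx x t = (ux (x + \<eta>) t - ux x t) / \<eta>" for x t
  define Dxx where "Dxx x t = (uxx (x + \<eta>) t - uxx x t) / \<eta>" for x t
  define Dt where "Dt x t = (ut (x + \<eta>) t - ut x t) / \<eta>" for x t
  have D: "C21 T D Dx Dxx Dt"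
  proof -
    note us = C21_shift[OF u, of \<eta>]
    have cst: "C21 T (\<lambda>x t. c) (\<lambda>x t. 0) (\<lambda>x t. 0) (\<lambda>x t. 0)" for c :: real
      by (rule C21_time) auto
    show ?thesis unfolding D_def Dx_def Dxx_def Dt_def
      using C21_mult[OF cst[of "1/\<eta>"] C21_add[OF us C21_mult[OF cst[of "-1"] u]]] by simp
  qed
  have mvt: "\<exists>\<xi>. x < \<xi> \<and> \<xi> < x + \<eta> \<and> D x t = ux \<xi> t" if t: "t \<in> {0..T}" for x t
  proof -
    obtain \<xi> where "x < \<xi>" "\<xi> < x + \<eta>" "u (x + \<eta>) t - u x t = (x + \<eta> - x) * ux \<xi> t"
      using MVT2[of x "x + \<eta>" "\<lambda>x. u x t" "\<lambda>x. ux x t"] C21D(1)[OF u t] \<eta> by auto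
    then show ?thesis using \<eta> by (auto simp: D_def)
  qed
  have close: "\<bar>D x t - ux x t\<bar> < gap" "\<bar>D x t - ux (x + \<eta>) t\<bar> < gap" if t: "t \<in> {0..T}" and x: "\<bar>x\<bar> \<le> \<rho>" for x t
  proof -
    obtain \<xi> where \<xi>: "x < \<xi>" "\<xi> < x + \<eta>" "D x t = ux \<xi> t" using mvt[OF t] by blast
    then show "\<bar>D x t - ux x t\<bar> < gap" "\<bar>D x t - ux (x + \<eta>) t\<bar> < gap"
      using uc[of \<xi> x t] uc[of \<xi> "x + \<eta>" t] x t \<eta> by auto
  qed
  have \<sigma>2: "\<sigma> * \<sigma> = 1" using \<sigma> by (auto simp: abs_if split: if_splits)
  \<comment> \<open>The sign makes a positive maximum of \<open>\<sigma> * \<zeta> * D\<close> a minimum of \<open>P\<close>.\<close>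
  define P where "P x t = - \<sigma> * \<zeta> x * D x t" for x t
  have zc: "C21 T (\<lambda>x t. - \<sigma> * \<zeta> x) (\<lambda>x t. - \<sigma> * (- 2 * x / \<rho>\<^sup>2)) (\<lambda>x t. - \<sigma> * (- 2 / \<rho>\<^sup>2)) (\<lambda>x t. 0)"
    unfolding \<zeta>_def using \<rho>
    by (intro C21_space) (auto intro!: derivative_eq_intros continuous_intros
      simp: field_simps power2_eq_square power4_eq_xxxx)
  note Pc = C21_mult[OF zc D]
  have "compact ({-\<rho>..\<rho>} \<times> {0..T})" by (intro compact_Times) auto
  moreover have "continuous_on ({-\<rho>..\<rho>} \<times> {0..T}) (\<lambda>q. P (fst q) (snd q))"
    unfolding P_def by (rule continuous_on_subset[OF C21D(4)[OF Pc]]) auto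
  moreover have xst: "(xs, ts) \<in> {-\<rho>..\<rho>} \<times> {0..T}" using t x by (auto simp: xs_def ts_def)
  ultimately obtain q where q: "q \<in> {-\<rho>..\<rho>} \<times> {0..T}" 
      "\<And>r. r \<in> {-\<rho>..\<rho>} \<times> {0..T} \<Longrightarrow> P (fst q) (snd q) \<le> P (fst r) (snd r)"
    using continuous_attains_inf[of "{-\<rho>..\<rho>} \<times> {0..T}" "\<lambda>q. P (fst q) (snd q)"] by blast
  obtain x0 t0 where x0: "q = (x0, t0)" by (cases q)
  have mn: "P x0 t0 \<le> P y s" if "y \<in> {-\<rho>..\<rho>}" "s \<in> {0..T}" for y s
    using q(2)[of "(y, s)"] that x0 by simp
  have x0\<rho>: "\<bar>x0\<bar> \<le> \<rho>" and t0: "t0 \<in> {0..T}" using q(1) x0 by auto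
  define d where "d = \<sigma> * D x0 t0"
  have X: "\<zeta> x0 * d > Kc"
  proof -
    have "\<bar>\<sigma> * \<zeta> xs * (D xs ts - ux xs ts)\<bar> \<le> \<bar>D xs ts - ux xs ts\<bar>"
    proof -
      have "\<bar>xs\<bar> \<le> \<rho>" using xst by auto
      then have "\<bar>\<zeta> xs\<bar> \<le> 1" using \<zeta>01[of xs] by simp
      then show ?thesis unfolding abs_mult \<sigma> by (simp add: mult_left_le_one_le)
    qed
    also have "\<dots> < gap" using close(1)[of ts xs] xst by auto
    also have "gap \<le> \<sigma> * \<zeta> xs * ux xs ts - Kc" by (simp add: gap_def)
    finally have "\<sigma> * \<zeta> xs * D xs ts > Kc" by (simp add: algebra_simps abs_less_iff)
    moreover have "P x0 t0 \<le> P xs ts" using xst by (intro mn) auto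
    ultimately show ?thesis by (simp add: P_def d_def algebra_simps)
  qed
  have z0: "\<zeta> x0 > 0" using X Kc2 \<zeta>01[OF x0\<rho>] by (cases "\<zeta> x0 = 0") auto
  have d2: "d \<ge> 2"
  proof -
    have "\<zeta> x0 * d > 0" using X Kc2 by linarith
    then have "d > 0" using z0 by (simp add: zero_less_mult_iff)
    then have "\<zeta> x0 * d \<le> d" using \<zeta>01[OF x0\<rho>] by (simp add: mult_le_cancel_right1)
    then show ?thesis using X Kc2 by linarith
  qed
  have absd: "\<bar>D x0 t0\<bar> = d"
  proof -
    have "\<bar>d\<bar> = \<bar>D x0 t0\<bar>" unfolding d_def abs_mult \<sigma> by simp
    then show ?thesis using d2 by linarith
  qed
  \<comment> \<open>At time 0 the quotient is a value of \<open>ux\<close> by the mean value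
    theorem, hence at most \<open>L * E\<close>, which is less than \<open>Kc\<close>.\<close>
  have "t0 \<noteq> 0"
  proof
    assume "t0 = 0"
    obtain \<xi> where "D x0 t0 = ux \<xi> t0" using mvt[OF t0] by blast
    then have "d = \<bar>ux \<xi> 0\<bar>" using absd \<open>t0 = 0\<close> by simp
    also have "\<dots> = 1/2 * u \<xi> 0 * \<bar>wx \<xi> 0\<bar>" using ub(1)[OF T0(2), of \<xi>] by (simp add: ux_def abs_mult)
    also have "\<dots> \<le> 1 * E * L" using ub[OF T0(2), of \<xi>] init[of \<xi>] E1 by (intro mult_mono) auto
    finally have "d \<le> L * E" by (simp add: mult.commute)
    moreover have "\<zeta> x0 * d \<le> d" using \<zeta>01[OF x0\<rho>] d2 by (simp add: mult_le_cancel_right1)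
    ultimately show False using X Kc2 by linarith
  qed
  then have t0': "t0 \<in> {0<..T}" using t0 by auto
  have x0': "\<bar>x0\<bar> < \<rho>"
  proof (rule ccontr)
    assume "\<not> \<bar>x0\<bar> < \<rho>"
    then have "x0\<^sup>2 = \<rho>\<^sup>2" using x0\<rho> by (metis less_eq_real_def power2_abs)
    then show False using z0 \<rho> by (simp add: \<zeta>_def)
  qed
  have loc: "P x0 t0 \<le> P y t0" if "\<bar>y - x0\<bar> < \<rho> - \<bar>x0\<bar>" for y
    using that t0 by (intro mn) auto
  have "\<rho> - \<bar>x0\<bar> > 0" using x0' by simp
  note sd = second_derivative_nonneg_at_min[OF C21D(1)[OF Pc t0] C21D(2)[OF Pc t0] this loc[unfolded P_def]]
  have dt: "- \<sigma> * \<zeta> x0 * Dt x0 t0 \<le> 0"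
    using left_derivative_nonpos_at_min[OF C21D(3)[OF Pc t0] t0'] mn[of x0, unfolded P_def] x0\<rho>
    by (simp add: abs_le_iff)
  define A where "A = ux x0 t0"
  define B where "B = ux (x0 + \<eta>) t0"
  define dx where "dx = \<sigma> * Dx x0 t0"
  define dxx where "dxx = \<sigma> * Dxx x0 t0"
  define s1 where "s1 = \<sigma> * A * ((g (x0 + \<eta>) - g x0) / \<eta>)"
  define s2 where "s2 = \<sigma> * u x0 t0 * ((V (x0 + \<eta>) t0 - V x0 t0) / \<eta>)"
  have Dteq: "Dt x0 t0 = (\<epsilon>/2) * Dxx x0 t0 + \<kappa> * ((A + B) * Dx x0 t0 / u (x0 + \<eta>) t0
      - A\<^sup>2 * D x0 t0 / (u x0 t0 * u (x0 + \<eta>) t0)) - g (x0 + \<eta>) * Dx x0 t0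
      - A * ((g (x0 + \<eta>) - g x0) / \<eta>) - V (x0 + \<eta>) t0 * D x0 t0 / 2 
      - u x0 t0 * ((V (x0 + \<eta>) t0 - V x0 t0) / \<eta>) / 2"
  proof -
    show ?thesis unfolding Dt_def Dxx_def Dx_def D_def A_def B_def ueq[OF t0']
      by (rule difference_quotient_identity) (use \<eta> ub(1)[OF t0] in \<open>simp_all add: less_imp_neq[symmetric]\<close>)
  qed
  have "\<zeta> x0 * d \<le> 8 * E\<^sup>2 * (3 * E + 3/2 + G + 3/2 * Lg + M/2 + (E * LV)/2)"
  proof (rule gradient_algebra[where \<zeta> = "\<zeta> x0" and zx = "- 2 * x0 / \<rho>\<^sup>2" and zxx = "- 2 / \<rho>\<^sup>2" and
      dx = dx and dxx = dxx and A = A and B = B and e = "\<epsilon>/2" and \<kappa> = \<kappa> and u = "u x0 t0"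
      and u' = "u (x0 + \<eta>) t0" and g = "g (x0 + \<eta>)" and sa = s1 and V = "V (x0 + \<eta>) t0" and sb = s2])
    show "0 < \<zeta> x0" "\<zeta> x0 \<le> 1" using z0 \<zeta>01[OF x0\<rho>] by auto
    have \<rho>2: "\<rho>\<^sup>2 \<ge> 2 * \<rho>" "\<rho>\<^sup>2 \<ge> 4" using \<rho> power_mono[of 2 \<rho> 2] by (auto simp: power2_eq_square)
    then show "\<bar>- 2 * x0 / \<rho>\<^sup>2\<bar> \<le> 1" using x0\<rho> \<rho> by (auto simp: abs_mult abs_divide divide_le_eq)
    show "\<bar>- 2 / \<rho>\<^sup>2\<bar> \<le> 1" using \<rho>2 by (auto simp: abs_divide divide_le_eq)
    show "d \<ge> 2" by (rule d2)
    show "\<zeta> x0 * d \<ge> 1" using X Kc2 by linarith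
    show "d - 1 \<le> \<bar>A\<bar>" "\<bar>A\<bar> \<le> d + 1" "\<bar>B\<bar> \<le> d + 1"
      using close[OF t0 x0\<rho>] gap absd unfolding A_def B_def by linarith+
    show "0 < \<epsilon>/2" "\<epsilon>/2 \<le> 1/2" "1/2 \<le> \<kappa>" "\<kappa> \<le> 1" using eps by (auto simp: \<kappa>_def)
    show "0 < u x0 t0" "u x0 t0 \<le> E" "0 < u (x0 + \<eta>) t0" "u (x0 + \<eta>) t0 \<le> E" "1 / u (x0 + \<eta>) t0 \<le> E"
      using ub[OF t0] by auto
    show "\<bar>g (x0 + \<eta>)\<bar> \<le> G" by (rule gG)
    have "\<bar>(g (x0 + \<eta>) - g x0) / \<eta>\<bar> \<le> Lg" using gL[of "x0 + \<eta>" x0] \<eta> by (simp add: abs_divide divide_le_eq)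
    then have "\<bar>A\<bar> * \<bar>(g (x0 + \<eta>) - g x0) / \<eta>\<bar> \<le> \<bar>A\<bar> * Lg" by (intro mult_left_mono) auto
    then show "\<bar>s1\<bar> \<le> Lg * \<bar>A\<bar>" unfolding s1_def abs_mult \<sigma> by (simp add: mult.commute)
    show "Lg \<ge> 0" by (rule Lg0)
    show "\<bar>V (x0 + \<eta>) t0\<bar> \<le> M" by (rule V[OF t0])
    have "\<bar>(V (x0 + \<eta>) t0 - V x0 t0) / \<eta>\<bar> \<le> LV" using VL[OF t0, of "x0 + \<eta>" x0] \<eta> x0\<rho> 
      by (simp add: abs_divide divide_le_eq)
    then have "\<bar>u x0 t0\<bar> * \<bar>(V (x0 + \<eta>) t0 - V x0 t0) / \<eta>\<bar> \<le> E * LV" 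
      using ub[OF t0, of x0] E1 by (intro mult_mono) auto
    then show "\<bar>s2\<bar> \<le> E * LV" unfolding s2_def abs_mult \<sigma> by simp
    show "- 2 * x0 / \<rho>\<^sup>2 * d + \<zeta> x0 * dx = 0" using sd(1) by (simp add: d_def dx_def algebra_simps)
    show "- 2 / \<rho>\<^sup>2 * d + 2 * (- 2 * x0 / \<rho>\<^sup>2) * dx + \<zeta> x0 * dxx \<le> 0"
      using sd(2) by (simp add: d_def dx_def dxx_def algebra_simps)
    have "0 \<le> \<zeta> x0 * (\<sigma> * Dt x0 t0)" using dt by (simp add: algebra_simps)
    then have "0 \<le> \<sigma> * Dt x0 t0" using z0 by (simp add: zero_le_mult_iff)
    also have "\<sigma> * Dt x0 t0 = (\<epsilon>/2) * dxx + \<kappa> * ((A + B) * dx / u (x0 + \<eta>) t0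
      - A\<^sup>2 * d / (u x0 t0 * u (x0 + \<eta>) t0)) - g (x0 + \<eta>) * dx - s1 - V (x0 + \<eta>) t0 * d / 2 - s2 / 2"
      unfolding Dteq d_def dx_def dxx_def s1_def s2_def by (simp add: algebra_simps)
    finally show "0 \<le> (\<epsilon>/2) * dxx + \<kappa> * ((A + B) * dx / u (x0 + \<eta>) t0
      - A\<^sup>2 * d / (u x0 t0 * u (x0 + \<eta>) t0)) - g (x0 + \<eta>) * dx - s1 - V (x0 + \<eta>) t0 * d / 2 - s2 / 2" .
  qed
  then show False using X Kc2 by simp
qed

text \<open>The cutoff has radius \<open>2 * R\<close>, so it is at least \<open>3/4\<close> for
  \<open>\<bar>x\<bar> \<le> R\<close>; both signs \<open>\<sigma>\<close> give the modulus. The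
  constant is \<open>2 * (4/3)\<close>, the 2 coming from
  \<open>w_x = - 2 exp (w/2) u_x\<close>.\<close>

lemma local_gradient_bound:
  assumes w: "C21 T w wx wxx wt" and eps: "0 < \<epsilon>" "\<epsilon> < 1"
    and pde: "\<And>x t. t \<in> {0<..T} \<Longrightarrow>
      wt x t + ((1/2) * (wx x t)\<^sup>2 + wx x t * g x - V x t) = (\<epsilon>/2) * wxx x t"
    and gG: "\<And>x. \<bar>g x\<bar> \<le> G" and gL: "\<And>x y. \<bar>g x - g y\<bar> \<le> Lg * \<bar>x - y\<bar>"
    and V: "\<And>x t. t \<in> {0..T} \<Longrightarrow> \<bar>V x t\<bar> \<le> M"
    and VL: "\<And>x y t. t \<in> {0..T} \<Longrightarrow> \<bar>x\<bar> \<le> 2 * R + 1 \<Longrightarrow> \<bar>y\<bar> \<le> 2 * R + 1 \<Longrightarrow> \<bar>V x t - V y t\<bar> \<le> LV * \<bar>x - y\<bar>"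
    and wK: "\<And>x t. t \<in> {0..T} \<Longrightarrow> \<bar>w x t\<bar> \<le> K0"
    and init: "\<And>x. \<bar>wx x 0\<bar> \<le> L" and R: "R \<ge> 1"
    and x: "\<bar>x\<bar> \<le> R" and t: "t \<in> {0..T}"
  shows "\<bar>wx x t\<bar> \<le> 8/3 * exp (K0/2) * gradconst K0 G Lg M LV L"
proof -
  define c where "c = gradconst K0 G Lg M LV L"
  define \<zeta> where "\<zeta> = 1 - x\<^sup>2 / (2*R)\<^sup>2"
  define v where "v = (1/2) * exp (- w x t / 2) * wx x t"
  have b: "\<sigma> * \<zeta> * (- v) \<le> c" if "\<bar>\<sigma>\<bar> = 1" for \<sigma>
    using local_gradient_bound_transformed[where \<rho> = "2 * R", OF w eps pde gG gL V VL wK init _ that, of x t] x t R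
    by (simp add: c_def \<zeta>_def v_def)
  have "\<zeta> * \<bar>v\<bar> \<le> c" using b[of 1] b[of "-1"] by (auto simp: abs_if)
  moreover have "\<zeta> \<ge> 3/4"
  proof -
    have "x\<^sup>2 \<le> R\<^sup>2" using power_mono[OF x, of 2] by simp
    then show ?thesis using R by (simp add: \<zeta>_def divide_le_eq)
  qed
  then have "3/4 * \<bar>v\<bar> \<le> \<zeta> * \<bar>v\<bar>" by (intro mult_right_mono) auto
  ultimately have v: "\<bar>v\<bar> \<le> 4/3 * c" by linarith
  have "exp (w x t / 2) \<le> exp (K0 / 2)" using wK[OF t, of x] by simp
  moreover have "\<bar>wx x t\<bar> = 2 * exp (w x t / 2) * \<bar>v\<bar>"
    by (simp add: v_def abs_mult exp_minus field_simps)
  ultimately have "\<bar>wx x t\<bar> \<le> 2 * exp (K0 / 2) * (4/3 * c)" using v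
    by (simp only:) (intro mult_mono; simp)
  then show ?thesis by (simp add: c_def)
qed

text \<open>No bound on \<open>wxx\<close> uniform in \<open>\<epsilon>\<close> is at hand, but its
  integral over an interval is a difference of values of \<open>wx\<close>. Averaging over length
  \<open>\<delta>\<close> costs order \<open>\<delta>\<close> in space, and in time the viscous term
  contributes order \<open>(t - s) / \<delta>\<close>; \<open>\<delta> = sqrt (t - s)\<close>
  balances the two.\<close>

lemma local_time_modulus:
  assumes w: "C21 T w wx wxx wt" and eps: "0 < \<epsilon>" "\<epsilon> < 1"
    and pde: "\<And>x t. t \<in> {0<..T} \<Longrightarrow>
      wt x t + ((1/2) * (wx x t)\<^sup>2 + wx x t * g x - V x t) = (\<epsilon>/2) * wxx x t"
    and gG: "\<And>x. \<bar>g x\<bar> \<le> G"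
    and V: "\<And>x t. t \<in> {0..T} \<Longrightarrow> \<bar>V x t\<bar> \<le> M"
    and wx: "\<And>y t. \<bar>y\<bar> \<le> R + sqrt T \<Longrightarrow> t \<in> {0..T} \<Longrightarrow> \<bar>wx y t\<bar> \<le> K"
    and x: "\<bar>x\<bar> \<le> R" and st: "0 \<le> s" "s < t" "t \<le> T"
  shows "\<bar>w x t - w x s\<bar> \<le> 3 * K * sqrt (t - s) + (K\<^sup>2 / 2 + K * G + M) * (t - s)"
proof -
  define \<delta> where "\<delta> = sqrt (t - s)"
  define C where "C = K\<^sup>2 / 2 + K * G + M"
  have \<delta>: "\<delta> > 0" "\<delta> \<le> sqrt T" "\<delta> * \<delta> = t - s" using st by (auto simp: \<delta>_def)
  have "\<bar>wx x t\<bar> \<le> K" by (rule wx) (use x st \<delta> in auto)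
  then have K0: "K \<ge> 0" by linarith
  have in': "\<bar>y\<bar> \<le> R + sqrt T" if "y \<in> {x..x+\<delta>}" for y using that x \<delta> by auto
  define J where "J \<tau> = integral {x..x+\<delta>} (\<lambda>y. w y \<tau>)" for \<tau>
  define J' where "J' \<tau> = integral {x..x+\<delta>} (\<lambda>y. wt y \<tau>)" for \<tau>
  have dJ: "(J has_real_derivative J' \<tau>) (at \<tau> within {0..T})" if "\<tau> \<in> {0..T}" for \<tau>
    using integral_derivative[OF w that, of x "x+\<delta>"] unfolding J_def[abs_def] J'_def .
  have J': "\<bar>J' \<tau>\<bar> \<le> K + C * \<delta>" if \<tau>: "\<tau> \<in> {0<..T}" for \<tau>
  proof -
    have \<tau>0: "\<tau> \<in> {0..T}" using \<tau> by auto
    define k where "k y = (\<epsilon>/2) * wxx y \<tau> - wt y \<tau>" for y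
    have ck: "continuous_on {x..x+\<delta>} k"
      unfolding k_def by (intro continuous_intros C21_slice_continuous[OF w \<tau>0])
    have kb: "norm (k y) \<le> C" if "y \<in> {x..x+\<delta>}" for y
    proof -
      have "k y = (1/2) * (wx y \<tau>)\<^sup>2 + wx y \<tau> * g y - V y \<tau>" using pde[OF \<tau>, of y] by (simp add: k_def)
      moreover have b: "\<bar>wx y \<tau>\<bar> \<le> K" by (rule wx[OF in'[OF that] \<tau>0])
      moreover have "(wx y \<tau>)\<^sup>2 \<le> K\<^sup>2" using power_mono[OF b, of 2] by simp
      moreover have "\<bar>wx y \<tau> * g y\<bar> \<le> K * G" unfolding abs_mult using b gG[of y] K0 by (intro mult_mono) auto
      moreover have "0 \<le> (wx y \<tau>)\<^sup>2" by simp
      ultimately show ?thesis using V[OF \<tau>0, of y] unfolding C_def real_norm_def by linarith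
    qed
    have ik: "\<bar>integral {x..x+\<delta>} k\<bar> \<le> C * \<delta>"
      using integral_bound[OF _ ck kb] \<delta> by simp
    have "((\<lambda>y. wxx y \<tau>) has_integral (wx (x+\<delta>) \<tau> - wx x \<tau>)) {x..x+\<delta>}"
      by (rule fundamental_theorem_of_calculus)
        (use \<delta> C21D(2)[OF w \<tau>0] in \<open>auto simp: has_real_derivative_iff_has_vector_derivative[symmetric] 
          intro: has_field_derivative_at_within\<close>)
    then have "((\<lambda>y. (\<epsilon>/2) * wxx y \<tau>) has_integral (\<epsilon>/2) * (wx (x+\<delta>) \<tau> - wx x \<tau>)) {x..x+\<delta>}"
      by (rule has_integral_mult_right)
    from has_integral_diff[OF this integrable_integral[OF integrable_continuous_real[OF ck]]]
    have "J' \<tau> = (\<epsilon>/2) * (wx (x+\<delta>) \<tau> - wx x \<tau>) - integral {x..x+\<delta>} k"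
      unfolding J'_def by (intro integral_unique) (simp add: k_def)
    moreover have "\<bar>(\<epsilon>/2) * (wx (x+\<delta>) \<tau> - wx x \<tau>)\<bar> \<le> (1/2) * (2 * K)"
      unfolding abs_mult using eps wx[OF in' \<tau>0, of x] wx[OF in' \<tau>0, of "x+\<delta>"] \<delta> by (intro mult_mono) auto
    ultimately show ?thesis using ik by linarith
  qed
  \<comment> \<open>\<open>K\<close> bounds the viscous flux through the two ends,
    \<open>C * \<delta>\<close> the integrated Hamiltonian.\<close>
  define B where "B = K + C * \<delta>"
  have Jb: "0 \<le> B - J' \<tau>" "0 \<le> B + J' \<tau>" if "s < \<tau>" "\<tau> < t" for \<tau>
    using J'[of \<tau>] that st by (auto simp: B_def abs_le_iff)
  have lin: "((\<lambda>\<tau>. B * \<tau>) has_real_derivative B) (at \<tau> within {0..T})" for \<tau>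
    by (auto intro!: derivative_eq_intros)
  have "B * s - J s \<le> B * t - J t"
    by (rule nondecreasing_from_derivative[where T = T and J = "\<lambda>\<tau>. B * \<tau> - J \<tau>" and J' = "\<lambda>\<tau>. B - J' \<tau>"])
      (use st Jb in \<open>auto intro: DERIV_diff[OF lin dJ]\<close>)
  moreover have "B * s + J s \<le> B * t + J t"
    by (rule nondecreasing_from_derivative[where T = T and J = "\<lambda>\<tau>. B * \<tau> + J \<tau>" and J' = "\<lambda>\<tau>. B + J' \<tau>"])
      (use st Jb in \<open>auto intro: DERIV_add[OF lin dJ]\<close>)
  ultimately have Jst: "\<bar>J t - J s\<bar> \<le> B * (t - s)" by (simp add: algebra_simps abs_le_iff)
  have Jw: "\<bar>J \<tau> - \<delta> * w x \<tau>\<bar> \<le> K * \<delta> * \<delta>" if \<tau>: "\<tau> \<in> {0..T}" for \<tau>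
  proof -
    have cw: "continuous_on {x..x+\<delta>} (\<lambda>y. w y \<tau>)" by (rule C21_slice_continuous[OF w \<tau>])
    have "norm (integral {x..x+\<delta>} (\<lambda>y. w y \<tau> - w x \<tau>)) \<le> K * \<delta> * (x + \<delta> - x)"
    proof (rule integral_bound)
      fix y assume y: "y \<in> {x..x+\<delta>}"
      show "norm (w y \<tau> - w x \<tau>) \<le> K * \<delta>"
      proof (cases "y = x")
        case False
        obtain \<xi> where \<xi>: "x < \<xi>" "\<xi> < y" "w y \<tau> - w x \<tau> = (y - x) * wx \<xi> \<tau>"
          using MVT2[of x y "\<lambda>y. w y \<tau>" "\<lambda>y. wx y \<tau>"] C21D(1)[OF w \<tau>] y False by auto
        have "\<bar>y - x\<bar> * \<bar>wx \<xi> \<tau>\<bar> \<le> \<delta> * K" using wx[OF in' \<tau>, of \<xi>] \<xi> y \<delta> by (intro mult_mono) auto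
        then show ?thesis by (simp add: \<xi>(3) abs_mult mult.commute)
      qed (use K0 \<delta> in simp)
    qed (use \<delta> cw in \<open>auto intro!: continuous_intros\<close>)
    moreover have "integral {x..x+\<delta>} (\<lambda>y. w y \<tau> - w x \<tau>) = J \<tau> - \<delta> * w x \<tau>"
      using Henstock_Kurzweil_Integration.integral_diff[OF integrable_continuous_real[OF cw] integrable_const_ivl[of "w x \<tau>" x "x+\<delta>"]] \<delta> 
      by (simp add: J_def)
    ultimately show ?thesis by simp
  qed
  have "\<delta> * \<bar>w x t - w x s\<bar> = \<bar>\<delta> * w x t - \<delta> * w x s\<bar>" using \<delta> by (simp add: abs_mult right_diff_distrib[symmetric])
  also have "\<dots> \<le> 2 * (K * \<delta> * \<delta>) + B * (t - s)" using Jst Jw[of t] Jw[of s] st by auto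
  also have "\<dots> = \<delta> * (3 * K * \<delta> + C * (\<delta> * \<delta>))" unfolding B_def \<delta>(3)[symmetric] by (simp add: algebra_simps)
  finally have "\<bar>w x t - w x s\<bar> \<le> 3 * K * \<delta> + C * (\<delta> * \<delta>)" using \<delta>(1) by (simp add: mult_le_cancel_left_pos)
  then show ?thesis unfolding \<delta>(3) by (simp add: \<delta>_def C_def)
qed

section \<open>The coefficients\<close>

text \<open>Because \<open>f 0 = 0\<close>, the difference quotient of the odd extension at 0 is
  \<open>f \<bar>h\<bar> / \<bar>h\<bar>\<close>, so the one-sided limit of \<open>f\<close> becomes
  a two-sided one.\<close>

lemma gfun_has_derivative:
  assumes f: "C1b_nonneg f fd" and f0: "f 0 = 0"
  shows "(gfun f has_real_derivative fd (abs x)) (at x)"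
proof -
  have d: "(f has_real_derivative fd x) (at x within {0..})" if "x \<ge> 0" for x
    using f that by (auto simp: C1b_nonneg_def)
  have d': "(f has_real_derivative fd x) (at x)" if "x > 0" for x
    using d[of x] that at_within_interior[of x "{0..}"] by simp
  consider "x > 0" | "x < 0" | "x = 0" by linarith
  then show ?thesis
  proof cases
    case 1
    have "(gfun f has_real_derivative fd x) (at x)"
      by (rule has_field_derivative_transform_within_open[OF d'[OF 1], of "{0<..}"]) (use 1 in \<open>auto simp: gfun_def\<close>)
    then show ?thesis using 1 by simp
  next
    case 2
    have "((\<lambda>y. - y) has_real_derivative -1) (at x)" by (auto intro!: derivative_eq_intros)
    from DERIV_minus[OF DERIV_chain2[OF d'[of "- x"] this]] 2
    have "((\<lambda>y. - f (- y)) has_real_derivative fd (- x)) (at x)" by simp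
    then have "(gfun f has_real_derivative fd (- x)) (at x)"
      by (rule has_field_derivative_transform_within_open[of _ _ _ "{..<0}"]) (use 2 in \<open>auto simp: gfun_def\<close>)
    then show ?thesis using 2 by simp
  next
    case 3
    have "((\<lambda>y. f y / y) \<longlongrightarrow> fd 0) (at 0 within {0..})"
      using d[of 0] f0 by (simp add: has_field_derivative_iff)
    moreover have "filterlim (\<lambda>h::real. \<bar>h\<bar>) (at 0 within {0..}) (at 0)"
    proof -
      have "((\<lambda>h::real. \<bar>h\<bar>) \<longlongrightarrow> 0) (at 0)" by (rule tendsto_rabs_zero) (rule tendsto_ident_at)
      then show ?thesis unfolding filterlim_at by (simp add: eventually_at_filter)
    qed
    ultimately have "((\<lambda>h. f \<bar>h\<bar> / \<bar>h\<bar>) \<longlongrightarrow> fd 0) (at 0)" by (rule filterlim_compose)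
    moreover have "f \<bar>h\<bar> / \<bar>h\<bar> = (gfun f (0 + h) - gfun f 0) / h" for h
      by (auto simp: gfun_def abs_if sgn_if)
    ultimately have "(gfun f has_real_derivative fd 0) (at 0)" by (simp add: DERIV_def)
    then show ?thesis using 3 by simp
  qed
qed

section \<open>Bounds and Lipschitz constants of the potential, uniform in \<epsilon>\<close>

lemma bounded_image_nonneg_abs:
  fixes f :: "real \<Rightarrow> real"
  assumes "bounded (f ` {0..})"
  obtains B where "B \<ge> 0" "\<And>x. x \<ge> 0 \<Longrightarrow> \<bar>f x\<bar> \<le> B"
proof -
  obtain B where "\<forall>x\<in>{0..}. norm (f x) \<le> B" using assms by (auto simp: bounded_iff)
  then show ?thesis using that[of "max B 0"] by force
qed

lemma lipschitz_derivative_bound: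
  assumes "L-lipschitz_on UNIV f" and d: "(f has_real_derivative D) (at x)"
  shows "\<bar>D\<bar> \<le> L"
proof -
  have "((\<lambda>y. \<bar>(f y - f x) / (y - x)\<bar>) \<longlongrightarrow> \<bar>D\<bar>) (at x)"
    using d by (intro tendsto_rabs) (simp add: has_field_derivative_iff)
  \<comment> \<open>At \<open>y = x\<close> the quotient is 0 by division by zero; this case uses
    that \<open>L\<close> is nonnegative.\<close>
  moreover have "\<bar>(f y - f x) / (y - x)\<bar> \<le> L" for y
    using lipschitz_onD[OF assms(1), of y x] lipschitz_on_nonneg[OF assms(1)]
    by (auto simp: dist_real_def abs_divide divide_le_eq mult.commute)
  ultimately show ?thesis by (intro tendsto_upperbound[of _ "\<bar>D\<bar>" "at x"]) auto
qed

lemma smooth_solutionE: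
  assumes "smooth_solution \<epsilon> T H w0 w"
  obtains wx wxx wt where "C21 T w wx wxx wt"
    "\<And>x t. t \<in> {0<..T} \<Longrightarrow> wt x t + H x t (wx x t) = (\<epsilon>/2) * wxx x t" "\<And>x. w x 0 = w0 x"
  using assms that unfolding smooth_solution_def C21_def by (auto simp: case_prod_unfold)

lemma Vw_bounded:
  assumes f: "C1b_nonneg f fd" and y: "C1b_nonneg y yd" and h: "C2b_nonneg h h1 h2"
  obtains M where "\<And>\<epsilon> x t. 0 < \<epsilon> \<Longrightarrow> \<epsilon> < 1 \<Longrightarrow> t \<ge> 0 \<Longrightarrow> \<bar>Vw fd y yd h h2 \<epsilon> x t\<bar> \<le> M"
proof -
  obtain F where F: "F \<ge> 0" "\<And>x. x \<ge> 0 \<Longrightarrow> \<bar>fd x\<bar> \<le> F"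
    using f bounded_image_nonneg_abs unfolding C1b_nonneg_def by metis
  obtain Y where Y: "Y \<ge> 0" "\<And>x. x \<ge> 0 \<Longrightarrow> \<bar>y x\<bar> \<le> Y"
    using y bounded_image_nonneg_abs unfolding C1b_nonneg_def by metis
  obtain Y' where Y': "Y' \<ge> 0" "\<And>x. x \<ge> 0 \<Longrightarrow> \<bar>yd x\<bar> \<le> Y'"
    using y bounded_image_nonneg_abs unfolding C1b_nonneg_def by metis
  obtain B where B: "B \<ge> 0" "\<And>x. x \<ge> 0 \<Longrightarrow> \<bar>h x\<bar> \<le> B"
    using h bounded_image_nonneg_abs unfolding C2b_nonneg_def by metis
  obtain B2 where B2: "B2 \<ge> 0" "\<And>x. x \<ge> 0 \<Longrightarrow> \<bar>h2 x\<bar> \<le> B2"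
    using h bounded_image_nonneg_abs unfolding C2b_nonneg_def by metis
  have "\<bar>Vw fd y yd h h2 \<epsilon> x t\<bar> \<le> 1/2 * B\<^sup>2 + Y' * B + F + 1/2 * Y * B2"
    if e: "0 < \<epsilon>" "\<epsilon> < 1" and t: "t \<ge> 0" for \<epsilon> x t
  proof -
    have 1: "\<bar>(1/2) * (h (abs x))\<^sup>2\<bar> \<le> 1/2 * B\<^sup>2" using power_mono[OF B(2)[of "abs x"], of 2] by simp
    have 2: "\<bar>yd t * h (abs x)\<bar> \<le> Y' * B" unfolding abs_mult using Y' B t by (intro mult_mono) auto
    have 3: "\<bar>\<epsilon> * fd (abs x)\<bar> \<le> 1 * F" unfolding abs_mult using F e by (intro mult_mono) auto
    have 4: "\<bar>(\<epsilon>/2) * y t * h2 (abs x)\<bar> \<le> 1/2 * Y * B2" unfolding abs_mult using Y B2 e t by (intro mult_mono) auto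
    show ?thesis unfolding Vw_def using 1 2 3 4 by linarith
  qed
  then show ?thesis using that by blast
qed

text \<open>\<open>f'\<close> and \<open>h''\<close> are merely continuous, so Lipschitz dependence
  of \<open>Vw\<close> on \<open>x\<close> has to come from the hypothesis on the Hamiltonian. That
  hypothesis gives one constant for each \<open>\<epsilon>\<close>, whereas the gradient estimate
  needs a common one.\<close>

lemma Vw_locally_lipschitz:
  assumes H: "\<And>\<epsilon>. 0 < \<epsilon> \<Longrightarrow> \<epsilon> < 1 \<Longrightarrow> H_loc_lipschitz T (Hfun f fd y yd h h2 \<epsilon>)" and R: "R > 0"
  obtains L where "\<And>\<epsilon> x z t. 0 < \<epsilon> \<Longrightarrow> \<epsilon> < 1 \<Longrightarrow> t \<in> {0..T} \<Longrightarrow> \<bar>x\<bar> \<le> R \<Longrightarrow> \<bar>z\<bar> \<le> R \<Longrightarrow>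
    \<bar>Vw fd y yd h h2 \<epsilon> x t - Vw fd y yd h h2 \<epsilon> z t\<bar> \<le> L * \<bar>x - z\<bar>"
proof -
  have ex: "\<exists>L. \<forall>x z t. t \<in> {0..T} \<and> \<bar>x\<bar> \<le> R \<and> \<bar>z\<bar> \<le> R \<longrightarrow>
      \<bar>Vw fd y yd h h2 \<epsilon> x t - Vw fd y yd h h2 \<epsilon> z t\<bar> \<le> L * \<bar>x - z\<bar>" if e: "0 < \<epsilon>" "\<epsilon> < 1" for \<epsilon>
  proof -
    have "\<forall>R>0. \<exists>L. \<forall>x1 x2 t1 t2 p1 p2.
      \<bar>x1\<bar> \<le> R \<and> \<bar>x2\<bar> \<le> R \<and> t1 \<in> {0..T} \<and> t2 \<in> {0..T} \<and> \<bar>p1\<bar> \<le> R \<and> \<bar>p2\<bar> \<le> R \<longrightarrow>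
      \<bar>Hfun f fd y yd h h2 \<epsilon> x1 t1 p1 - Hfun f fd y yd h h2 \<epsilon> x2 t2 p2\<bar> \<le> L * (\<bar>x1 - x2\<bar> + \<bar>t1 - t2\<bar> + \<bar>p1 - p2\<bar>)"
      using H[OF e] unfolding H_loc_lipschitz_def .
    then obtain L where L: "\<forall>x1 x2 t1 t2 p1 p2.
      \<bar>x1\<bar> \<le> R \<and> \<bar>x2\<bar> \<le> R \<and> t1 \<in> {0..T} \<and> t2 \<in> {0..T} \<and> \<bar>p1\<bar> \<le> R \<and> \<bar>p2\<bar> \<le> R \<longrightarrow>
      \<bar>Hfun f fd y yd h h2 \<epsilon> x1 t1 p1 - Hfun f fd y yd h h2 \<epsilon> x2 t2 p2\<bar> \<le> L * (\<bar>x1 - x2\<bar> + \<bar>t1 - t2\<bar> + \<bar>p1 - p2\<bar>)"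
      using R by meson
    have "\<bar>Vw fd y yd h h2 \<epsilon> x t - Vw fd y yd h h2 \<epsilon> z t\<bar> \<le> L * \<bar>x - z\<bar>"
      if "t \<in> {0..T}" "\<bar>x\<bar> \<le> R" "\<bar>z\<bar> \<le> R" for x z t
      \<comment> \<open>At momentum 0 the Hamiltonian is \<open>- Vw\<close>.\<close>
      using L[rule_format, of x z t t 0 0] that R by (simp add: Hfun_def abs_minus_commute)
    then show ?thesis by blast
  qed
  obtain L1 where L1: "\<And>x z t. t \<in> {0..T} \<and> \<bar>x\<bar> \<le> R \<and> \<bar>z\<bar> \<le> R \<Longrightarrow>
      \<bar>Vw fd y yd h h2 (1/2) x t - Vw fd y yd h h2 (1/2) z t\<bar> \<le> L1 * \<bar>x - z\<bar>"
    using ex[of "1/2"] by auto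
  obtain L2 where L2: "\<And>x z t. t \<in> {0..T} \<and> \<bar>x\<bar> \<le> R \<and> \<bar>z\<bar> \<le> R \<Longrightarrow>
      \<bar>Vw fd y yd h h2 (1/4) x t - Vw fd y yd h h2 (1/4) z t\<bar> \<le> L2 * \<bar>x - z\<bar>"
    using ex[of "1/4"] by auto
  have "\<bar>Vw fd y yd h h2 \<epsilon> x t - Vw fd y yd h h2 \<epsilon> z t\<bar> \<le> (3 * L1 + 2 * L2) * \<bar>x - z\<bar>"
    if e: "0 < \<epsilon>" "\<epsilon> < 1" and t: "t \<in> {0..T}" "\<bar>x\<bar> \<le> R" "\<bar>z\<bar> \<le> R" for \<epsilon> x z t
  proof -
    define a where "a = Vw fd y yd h h2 (1/2) x t - Vw fd y yd h h2 (1/2) z t"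
    define b where "b = Vw fd y yd h h2 (1/4) x t - Vw fd y yd h h2 (1/4) z t"
    have ab: "\<bar>a\<bar> \<le> L1 * \<bar>x - z\<bar>" "\<bar>b\<bar> \<le> L2 * \<bar>x - z\<bar>" using L1[of t x z] L2[of t x z] t by (auto simp: a_def b_def)
    \<comment> \<open>\<open>Vw\<close> is affine in \<open>\<epsilon>\<close>, so its values at \<open>1/2\<close> and \<open>1/4\<close> control all others.\<close>
    have "Vw fd y yd h h2 \<epsilon> x t - Vw fd y yd h h2 \<epsilon> z t = a + (\<epsilon> - 1/2) * 4 * (a - b)"
      unfolding a_def b_def Vw_def by (simp add: field_simps)
    moreover have "\<bar>(\<epsilon> - 1/2) * 4 * (a - b)\<bar> \<le> 2 * (\<bar>a\<bar> + \<bar>b\<bar>)"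
    proof -
      have "\<bar>(\<epsilon> - 1/2) * 4\<bar> \<le> 2" using e by (simp add: abs_if)
      then have "\<bar>(\<epsilon> - 1/2) * 4\<bar> * \<bar>a - b\<bar> \<le> 2 * (\<bar>a\<bar> + \<bar>b\<bar>)" by (intro mult_mono) auto
      then show ?thesis by (simp only: abs_mult)
    qed
    ultimately have "\<bar>Vw fd y yd h h2 \<epsilon> x t - Vw fd y yd h h2 \<epsilon> z t\<bar> \<le> 3 * \<bar>a\<bar> + 2 * \<bar>b\<bar>"
      using abs_triangle_ineq[of a "(\<epsilon> - 1/2) * 4 * (a - b)"]
      by (simp only:) (erule order_trans, simp)
    also have "\<dots> \<le> (3 * L1 + 2 * L2) * \<bar>x - z\<bar>" using ab by (simp add: algebra_simps)
    finally show ?thesis .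
  qed
  then show ?thesis using that by blast
qed

section \<open>Assembly of the estimates\<close>

theorem mainTheorem4:
  fixes f fd y yd h h1 h2 w0 :: "real \<Rightarrow> real"
    and w :: "real \<Rightarrow> real \<Rightarrow> real \<Rightarrow> real"
    and T :: real
  assumes f: "C1b_nonneg f fd" and f0: "f 0 = 0"
    and y: "C1b_nonneg y yd"
    and h: "C2b_nonneg h h1 h2"
    and w0b: "bounded (range w0)" and w0l: "\<exists>L. L-lipschitz_on UNIV w0"
    and T: "T > 0"
    and Hhyp: "\<forall>eps. 0 < eps \<and> eps < 1 \<longrightarrow>
        H_loc_lipschitz T (Hfun f fd y yd h h2 eps) \<and>
        H_loc_unif_lipschitz_p T (Hfun f fd y yd h h2 eps) \<and>
        H_convex_p T (Hfun f fd y yd h h2 eps) \<and>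
        H_coercive_p T (Hfun f fd y yd h h2 eps)"
    and sol: "\<forall>eps. 0 < eps \<and> eps < 1 \<longrightarrow>
        smooth_solution eps T (Hfun f fd y yd h h2 eps) w0 (w eps) \<and>
        (\<forall>v. smooth_solution eps T (Hfun f fd y yd h h2 eps) w0 v \<longrightarrow>
             (\<forall>x. \<forall>t\<in>{0..T}. v x t = w eps x t))"
  shows "(\<forall>Q. compact Q \<and> Q \<subseteq> UNIV \<times> {0..T} \<longrightarrow>
            (\<exists>eps0>0. \<exists>K>0. \<forall>eps. 0 < eps \<and> eps < min eps0 1 \<longrightarrow>
               (\<forall>x t s. (x, t) \<in> Q \<and> (x, s) \<in> Q \<longrightarrow>
                  \<bar>w eps x t\<bar> \<le> K \<and>
                  \<bar>deriv (\<lambda>\<xi>. w eps \<xi> t) x\<bar> \<le> K \<and>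
                  \<bar>w eps x t - w eps x s\<bar> \<le> K * (sqrt \<bar>t - s\<bar> + \<bar>t - s\<bar>))))
      \<and> (\<forall>R::real. R \<ge> 8 \<longrightarrow> (\<forall>eps. 0 < eps \<and> eps < 1 / (32 * R^4) \<longrightarrow>
            (\<forall>x t. \<bar>x\<bar> \<le> R \<and> t \<in> {0..T} \<longrightarrow>
               \<bar>w eps x t\<bar> \<le> (SUP z. \<bar>w0 z\<bar>)
                 + (8 * (1 + (SUP z. \<bar>gfun f z\<bar>))
                    + (SUP p\<in>UNIV \<times> {0..T}. \<bar>Vw fd y yd h h2 eps (fst p) (snd p)\<bar>) + 1) * T
                 + 1)))"
proof -
  let ?g = "gfun f"
  obtain L where L: "L-lipschitz_on UNIV w0" using w0l by blast
  obtain G where G: "G \<ge> 0" "\<And>x. x \<ge> 0 \<Longrightarrow> \<bar>f x\<bar> \<le> G"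
    using f bounded_image_nonneg_abs unfolding C1b_nonneg_def by metis
  obtain Lg where Lg: "Lg \<ge> 0" "\<And>x. x \<ge> 0 \<Longrightarrow> \<bar>fd x\<bar> \<le> Lg"
    using f bounded_image_nonneg_abs unfolding C1b_nonneg_def by metis
  obtain M where M: "\<And>\<epsilon> x t. 0 < \<epsilon> \<Longrightarrow> \<epsilon> < 1 \<Longrightarrow> t \<ge> 0 \<Longrightarrow> \<bar>Vw fd y yd h h2 \<epsilon> x t\<bar> \<le> M"
    using Vw_bounded[OF f y h] by blast
  have M0: "M \<ge> 0" using M[of "1/2" 0 0] by (smt (verit) field_sum_of_halves zero_less_divide_1_iff)
  have HH: "H_loc_lipschitz T (Hfun f fd y yd h h2 \<epsilon>)" if "0 < \<epsilon>" "\<epsilon> < 1" for \<epsilon>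
    using Hhyp that by blast
  note gd = gfun_has_derivative[OF f f0]
  have gd': "\<bar>fd (abs x)\<bar> \<le> Lg" for x by (rule Lg) simp
  have gc: "continuous_on UNIV (\<lambda>x. fd (abs x))"
    using f by (intro continuous_on_compose2[of "{0..}" fd UNIV abs]) (auto simp: C1b_nonneg_def intro!: continuous_intros)
  have gG: "\<bar>?g x\<bar> \<le> G" for x
  proof -
    have "\<bar>?g x\<bar> \<le> \<bar>f (abs x)\<bar>" by (simp add: gfun_def abs_mult abs_sgn_eq)
    then show ?thesis using G(2)[of "abs x"] by linarith
  qed
  have gL: "\<bar>?g x - ?g z\<bar> \<le> Lg * \<bar>x - z\<bar>" for x z
    using field_differentiable_bound[of UNIV ?g "\<lambda>x. fd (abs x)" Lg x z] gd gd' by simp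
  define W0 where "W0 = (SUP z. \<bar>w0 z\<bar>)"
  have "bdd_above (range (\<lambda>z. \<bar>w0 z\<bar>))" using w0b by (auto simp: bounded_iff bdd_above_def)
  then have W0: "\<bar>w0 z\<bar> \<le> W0" for z unfolding W0_def by (intro cSUP_upper) auto
  have W00: "W0 \<ge> 0" using W0[of 0] by linarith
  have sol': "\<exists>wx wxx wt. C21 T (w \<epsilon>) wx wxx wt \<and> (\<forall>x. \<forall>t\<in>{0<..T}. 
      wt x t + ((1/2) * (wx x t)\<^sup>2 + wx x t * ?g x - Vw fd y yd h h2 \<epsilon> x t) = (\<epsilon>/2) * wxx x t) \<and> (\<forall>x. w \<epsilon> x 0 = w0 x)"
    if "0 < \<epsilon>" "\<epsilon> < 1" for \<epsilon>
  proof -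
    have "smooth_solution \<epsilon> T (Hfun f fd y yd h h2 \<epsilon>) w0 (w \<epsilon>)" using sol that by blast
    then show ?thesis by (rule smooth_solutionE) (unfold Hfun_def, blast)
  qed
  \<comment> \<open>\<open>m\<close> stays free: the compact estimates use the bound
    \<open>M\<close> common to all \<open>\<epsilon>\<close>, the last claim the supremum for the
    given one.\<close>
  have bound: "\<bar>w \<epsilon> x t\<bar> \<le> W0 + m * t" if e: "0 < \<epsilon>" "\<epsilon> < 1" and t: "t \<in> {0..T}"
      and m: "\<And>x t. t \<in> {0..T} \<Longrightarrow> \<bar>Vw fd y yd h h2 \<epsilon> x t\<bar> \<le> m" for \<epsilon> x t m
  proof -
    obtain wx wxx wt where s: "C21 T (w \<epsilon>) wx wxx wt" "\<And>x t. t \<in> {0<..T} \<Longrightarrow> 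
      wt x t + ((1/2) * (wx x t)\<^sup>2 + wx x t * ?g x - Vw fd y yd h h2 \<epsilon> x t) = (\<epsilon>/2) * wxx x t" "\<And>x. w \<epsilon> x 0 = w0 x"
      using sol'[OF e] by blast
    show ?thesis
      by (rule hamilton_jacobi_global_bound[OF s(1) T e(1) s(2) gd gc gG gd' m _ t]) (use W0 s(3) in auto)
  qed
  show ?thesis
  proof (intro conjI allI impI)
    fix Q :: "(real \<times> real) set"
    assume Q: "compact Q \<and> Q \<subseteq> UNIV \<times> {0..T}"
    have "bounded Q" using Q compact_imp_bounded by blast
    then obtain R0 where R0: "\<forall>p\<in>Q. norm p \<le> R0" unfolding bounded_iff by blast
    define R where "R = max 1 R0"
    have R1': "R \<ge> 1" by (simp add: R_def)
    have R: "\<bar>x\<bar> \<le> R" "t \<in> {0..T}" if "(x, t) \<in> Q" for x t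
    proof -
      have "\<bar>x\<bar> \<le> norm (x, t)" using norm_fst_le[of x t] by simp
      then show "\<bar>x\<bar> \<le> R" using R0 that by (fastforce simp: R_def)
      show "t \<in> {0..T}" using Q that by blast
    qed
    \<comment> \<open>The time modulus on radius \<open>R\<close> needs the gradient bound
      \<open>sqrt T\<close> further out.\<close>
    define R1 where "R1 = R + sqrt T"
    have R1: "R1 \<ge> 1" using R1' T by (simp add: R1_def add_increasing2)
    obtain LV where LV: "\<And>\<epsilon> x z t. 0 < \<epsilon> \<Longrightarrow> \<epsilon> < 1 \<Longrightarrow> t \<in> {0..T} \<Longrightarrow> \<bar>x\<bar> \<le> 2 * R1 + 1 \<Longrightarrow> \<bar>z\<bar> \<le> 2 * R1 + 1 \<Longrightarrow>
        \<bar>Vw fd y yd h h2 \<epsilon> x t - Vw fd y yd h h2 \<epsilon> z t\<bar> \<le> LV * \<bar>x - z\<bar>"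
      by (rule Vw_locally_lipschitz[OF HH, of "2 * R1 + 1"]) (assumption, assumption, use R1 in simp, rule that)
    define K0 where "K0 = W0 + M * T"
    define K1 where "K1 = 8/3 * exp (K0/2) * gradconst K0 G Lg M LV L"
    define C where "C = K1\<^sup>2 / 2 + K1 * G + M"
    \<comment> \<open>Majorizes \<open>K0\<close>, \<open>K1\<close>, \<open>3 * K1\<close> and
      \<open>C\<close> at once; the absolute values and the 1 give positivity.\<close>
    define K where "K = \<bar>K0\<bar> + 4 * \<bar>K1\<bar> + \<bar>C\<bar> + 1"
    have est: "\<bar>w \<epsilon> x t\<bar> \<le> K \<and> \<bar>deriv (\<lambda>\<xi>. w \<epsilon> \<xi> t) x\<bar> \<le> K \<and>
        \<bar>w \<epsilon> x t - w \<epsilon> x s\<bar> \<le> K * (sqrt \<bar>t - s\<bar> + \<bar>t - s\<bar>)"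
      if e: "0 < \<epsilon>" "\<epsilon> < 1" and xts: "(x, t) \<in> Q" "(x, s) \<in> Q" for \<epsilon> x t s
    proof -
      obtain wx wxx wt where S: "C21 T (w \<epsilon>) wx wxx wt" "\<And>x t. t \<in> {0<..T} \<Longrightarrow> 
        wt x t + ((1/2) * (wx x t)\<^sup>2 + wx x t * ?g x - Vw fd y yd h h2 \<epsilon> x t) = (\<epsilon>/2) * wxx x t" "\<And>x. w \<epsilon> x 0 = w0 x"
        using sol'[OF e] by blast
      have Me: "\<bar>Vw fd y yd h h2 \<epsilon> x t\<bar> \<le> M" if "t \<in> {0..T}" for x t using M[OF e, of t x] that by simp
      have wK: "\<bar>w \<epsilon> x t\<bar> \<le> K0" if t: "t \<in> {0..T}" for x t
      proof -
        have "M * t \<le> M * T" using t M0 by (intro mult_left_mono) auto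
        then show ?thesis using bound[OF e t Me, of x] by (simp add: K0_def)
      qed
      have init: "\<bar>wx x 0\<bar> \<le> L" for x
      proof (rule lipschitz_derivative_bound[OF L])
        show "(w0 has_real_derivative wx x 0) (at x)" using C21D(1)[OF S(1), of 0 x] T S(3) by simp
      qed
      have wxK: "\<bar>wx x t\<bar> \<le> K1" if "\<bar>x\<bar> \<le> R1" "t \<in> {0..T}" for x t
        unfolding K1_def
        by (rule local_gradient_bound[OF S(1) e S(2) gG gL Me LV[OF e] wK init R1 that])
      have x: "\<bar>x\<bar> \<le> R" and t: "t \<in> {0..T}" and s: "s \<in> {0..T}" using R[OF xts(1)] R[OF xts(2)] by auto
      have xR1: "\<bar>x\<bar> \<le> R1" using x T by (simp add: R1_def add_increasing2)
      have mod: "\<bar>w \<epsilon> x b - w \<epsilon> x a\<bar> \<le> K * (sqrt \<bar>b - a\<bar> + \<bar>b - a\<bar>)"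
        if ab: "0 \<le> a" "a < b" "b \<le> T" for a b
      proof -
        have "\<bar>w \<epsilon> x b - w \<epsilon> x a\<bar> \<le> 3 * K1 * sqrt (b - a) + C * (b - a)"
          unfolding C_def
          by (rule local_time_modulus[OF S(1) e S(2) gG Me _ x ab]) (use wxK in \<open>auto simp: R1_def\<close>)
        also have "\<dots> \<le> K * sqrt (b - a) + K * (b - a)"
          using ab by (intro add_mono mult_right_mono) (auto simp: K_def)
        finally show ?thesis using ab by (simp add: distrib_left)
      qed
      have "\<bar>w \<epsilon> x t - w \<epsilon> x s\<bar> \<le> K * (sqrt \<bar>t - s\<bar> + \<bar>t - s\<bar>)"
      proof (cases s t rule: linorder_cases)
        case less
        then show ?thesis using mod[of s t] s t by simp
      next
        case greater
        then show ?thesis using mod[of t s] s t by (simp add: abs_minus_commute)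
      qed simp
      moreover have "deriv (\<lambda>\<xi>. w \<epsilon> \<xi> t) x = wx x t" by (rule DERIV_imp_deriv[OF C21D(1)[OF S(1) t]])
      moreover have "\<bar>w \<epsilon> x t\<bar> \<le> K" using wK[OF t, of x] by (simp add: K_def)
      moreover have "\<bar>wx x t\<bar> \<le> K" using wxK[OF xR1 t] by (simp add: K_def)
      ultimately show ?thesis by simp
    qed
    have Kpos: "K > 0" unfolding K_def by (simp add: K_def add_nonneg_pos)
    show "\<exists>eps0>0. \<exists>K>0. \<forall>eps. 0 < eps \<and> eps < min eps0 1 \<longrightarrow>
               (\<forall>x t s. (x, t) \<in> Q \<and> (x, s) \<in> Q \<longrightarrow>
                  \<bar>w eps x t\<bar> \<le> K \<and>
                  \<bar>deriv (\<lambda>\<xi>. w eps \<xi> t) x\<bar> \<le> K \<and>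
                  \<bar>w eps x t - w eps x s\<bar> \<le> K * (sqrt \<bar>t - s\<bar> + \<bar>t - s\<bar>))"
    \<comment> \<open>\<open>est\<close> holds for every \<epsilon> below 1, so the threshold is
      1.\<close>
    proof (rule exI[of _ 1], rule conjI, simp, rule exI[of _ K], rule conjI, rule Kpos, intro allI impI)
      fix eps x t s :: real
      assume "0 < eps \<and> eps < min 1 1" "(x, t) \<in> Q \<and> (x, s) \<in> Q"
      then show "\<bar>w eps x t\<bar> \<le> K \<and> \<bar>deriv (\<lambda>\<xi>. w eps \<xi> t) x\<bar> \<le> K \<and>
          \<bar>w eps x t - w eps x s\<bar> \<le> K * (sqrt \<bar>t - s\<bar> + \<bar>t - s\<bar>)"
        using est[of eps x t s] by simp
    qed
  next
    fix R eps x t :: real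
    assume R: "8 \<le> R" and eps: "0 < eps \<and> eps < 1 / (32 * R^4)" and xt: "\<bar>x\<bar> \<le> R \<and> t \<in> {0..T}"
    \<comment> \<open>The threshold lies below 1, so the global bound \<open>W0 + m * t\<close> is
      available.\<close>
    have "R^4 \<ge> 1" using R by (intro one_le_power) auto
    then have "1 / (32 * R^4) \<le> 1" by (subst divide_le_eq_1) auto
    then have e: "0 < eps" "eps < 1" using eps by auto
    define m where "m = (SUP p\<in>UNIV \<times> {0..T}. \<bar>Vw fd y yd h h2 eps (fst p) (snd p)\<bar>)"
    have bdd: "bdd_above ((\<lambda>p. \<bar>Vw fd y yd h h2 eps (fst p) (snd p)\<bar>) ` (UNIV \<times> {0..T}))"
      using M[OF e] by (intro bdd_aboveI2) auto
    have m: "\<bar>Vw fd y yd h h2 eps x t\<bar> \<le> m" if "t \<in> {0..T}" for x t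
      unfolding m_def using cSUP_upper[OF _ bdd, of "(x, t)"] that by simp
    have m0: "m \<ge> 0" using m[of 0 0] T by auto
    have "bdd_above (range (\<lambda>z. \<bar>?g z\<bar>))" using gG by (intro bdd_aboveI2) auto
    then have "\<bar>?g 0\<bar> \<le> (SUP z. \<bar>?g z\<bar>)" by (intro cSUP_upper) auto
    then have g0: "0 \<le> (SUP z. \<bar>?g z\<bar>)" by linarith
    have "\<bar>w eps x t\<bar> \<le> W0 + m * t" by (rule bound[OF e _ m]) (use xt in auto)
    \<comment> \<open>The bracket in the claim exceeds \<open>m\<close>, and
      \<open>t \<le> T\<close>.\<close>
    also have "m * t \<le> (8 * (1 + (SUP z. \<bar>?g z\<bar>)) + m + 1) * T"
      using xt m0 g0 by (intro mult_mono) auto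
    finally show "\<bar>w eps x t\<bar> \<le> (SUP z. \<bar>w0 z\<bar>)
                 + (8 * (1 + (SUP z. \<bar>gfun f z\<bar>))
                    + (SUP p\<in>UNIV \<times> {0..T}. \<bar>Vw fd y yd h h2 eps (fst p) (snd p)\<bar>) + 1) * T
                 + 1"
      unfolding W0_def m_def by simp
  qed
qed

end
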